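(* Let $\Psi$ and $\Phi$ be $\mathcal A$-localized frames in $\mathcal H$ satisfying $\Phi\sim_{\mathcal A}\Psi$, let $w_1,w_2$ be $\mathcal A$-admissible weights and $1\le p_1,p_2\le\infty$ or $p_1=p_2=0$. Then the factorization $$\mathcal O_{(\Phi,\Psi)}\circ\mathcal M_{(\tilde\Phi,\tilde\Psi)}=\mathrm{id}=\mathcal O_{(\tilde\Phi,\tilde\Psi)}\circ\mathcal M_{(\Phi,\Psi)}$$ holds on every space of bounded operators $\mathcal B(\mathcal H^{p_1}_{w_1},\mathcal H^{p_2}_{w_2})$. Therefore every $O\in\mathcal B(\mathcal H^{p_1}_{w_1},\mathcal H^{p_2}_{w_2})$ possesses the representation $$O=\sum_{k,j}\langle O\tilde\psi_j,\tilde\phi_k\rangle\,\phi_k\otimes\psi_j=\sum_{k,j}\langle O\psi_j,\phi_k\rangle\,\tilde\phi_k\otimes\tilde\psi_j,$$ and both expansions converge unconditionally in the strong operator topology (respectively weak-$*$ unconditionally if either $p_1=\infty$ or $p_2=\infty$).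
   Context: $\mathcal H$ is a separable Hilbert space and $K\subseteq\mathbb R^d$ a countable separated index set; sequences and matrices are indexed by $K$. $\ell^{00}$ denotes the finitely supported sequences. A weight is a sequence $w=(w_k)$ with $w_k>0$; $\ell^p_w=\{c:(w_kc_k)\in\ell^p\}$ with $\|c\|_{\ell^p_w}=\|(w_kc_k)\|_{\ell^p}$; $\ell^0_w$ is the closure of $\ell^{00}$ in $\ell^\infty_w$. A frame $\Psi=(\psi_k)_{k\in K}$ satisfies $A\|f\|^2\le\sum_k|\langle f,\psi_k\rangle|^2\le B\|f\|^2$ for all $f\in\mathcal H$ with some $A,B>0$; $C_\Psi f=(\langle f,\psi_k\rangle)_k$, $D_\Psi c=\sum_kc_k\psi_k$, $S_\Psi=D_\Psi C_\Psi$; the canonical dual frame is $\tilde\Psi=(\tilde\psi_k)$, $\tilde\psi_k=S_\Psi^{-1}\psi_k$. Cross-Gram matrix: $(G_{\Psi,\Phi})_{k,l}=\langle\phi_l,\psi_k\rangle$, $G_\Psi=G_{\Psi,\Psi}$. $\mathcal A$ is a fixed solid spectral matrix algebra: a Banach $*$-algebra of matrices over $K$ such that (i) $\mathcal A\subseteq\mathcal B(\ell^2)$; (ii) $A\in\mathcal A$ invertible on $\ell^2$ implies $A^{-1}\in\mathcal A$; (iii) $A\in\mathcal A$ and $|b_{k,l}|\le|a_{k,l}|$ for all $k,l$ imply $B=(b_{k,l})\in\mathcal A$ and $\|B\|_{\mathcal A}\le\|A\|_{\mathcal A}$. Write $\Psi\sim_{\mathcal A}\Phi$ if $G_{\Psi,\Phi}\in\mathcal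 A$; $\Psi$ is $\mathcal A$-localized if $\Psi\sim_{\mathcal A}\Psi$ (it is known that then $\Psi\sim_{\mathcal A}\tilde\Psi$ and $\tilde\Psi\sim_{\mathcal A}\tilde\Psi$). A weight $w$ is $\mathcal A$-admissible if every $A\in\mathcal A$ defines a bounded operator on $\ell^p_w$ for all $1\le p\le\infty$ (then $1/w$ is admissible too). Coorbit spaces: $\mathcal H^{00}=\{\sum_kc_k\psi_k:c\in\ell^{00}\}$. For $1\le p<\infty$, $\mathcal H^p_w$ is the completion of $\mathcal H^{00}$ in the norm $\|f\|_{\mathcal H^p_w}=\|C_{\tilde\Psi}f\|_{\ell^p_w}$; $\mathcal H^0_w$ is the completion in $\|C_{\tilde\Psi}f\|_{\ell^\infty_w}$. $\mathcal H^\infty_w$ is the set of equivalence classes $f=[f_n]$ of sequences $f_n\in\mathcal H$ such that $\alpha_k=\lim_n\langle f_n,\tilde\psi_k\rangle$ exists for all $k$ and $\sup_n\|C_{\tilde\Psi}f_n\|_{\ell^\infty_w}<\infty$, where $(f_n)\sim(g_n)$ iff $\langle f_n-g_n,\tilde\psi_k\rangle\to0$ for all $k$; $C_{\tilde\Psi}f=\alpha$, $\|f\|_{\mathcal H^\infty_w}=\|\alpha\|_{\ell^\infty_w}$. Via coefficient sequences $C_{\tilde\Psi}f$, $\mathcal H^p_w\subseteq\mathcal H^\infty_w$. The pairing (for $1/p+1/q=1$ or $(p,q)=(0,1)$) is $\langle f,h\rangle_{\mathcal H^p_w,\mathcal H^q_{1/w}}=\sum_k(C_{\tilde\Psi}f)_k\overline{(C_\Psi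 h)_k}$, where $C_\Psi h=G_\Psi C_{\tilde\Psi}h$. Any frame $\Phi\sim_{\mathcal A}\Psi$ gives the same spaces with equivalent norms. Weak-$*$ refers to $\sigma(\mathcal H^\infty_w,\mathcal H^1_{1/w})$. For frames $\Phi,\Xi$ in the same localization class: $(\mathcal M_{(\Phi,\Xi)}(O))_{k,l}=\langle O\xi_l,\phi_k\rangle$ (pairing of $\mathcal H^{p_2}_{w_2}$ and $\mathcal H^{q_2}_{1/w_2}$) for bounded $O:\mathcal H^{p_1}_{w_1}\to\mathcal H^{p_2}_{w_2}$, and $\mathcal O_{(\Phi,\Xi)}(M)h=\sum_k\big(\sum_jM_{k,j}\langle h,\xi_j\rangle\big)\phi_k$ for a matrix $M$ inducing a bounded operator $\ell^{p_1}_{w_1}\to\ell^{p_2}_{w_2}$ and $h\in\mathcal H^{p_1}_{w_1}$. The tensor product is the rank-one operator $(f\otimes g)(h)=\langle h,g\rangle f$, with the pairing of $\mathcal H^{p_1}_{w_1}$ and $\mathcal H^{q_1}_{1/w_1}$.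
   Formalization: For p1=∞, O is assumed weak-* continuous (false otherwise: Banach limits). SOT convergence is over finite rectangles in (k,j); unconditional over pairs only for p1∈{0,1} or weak-* (false at p1=p2=2: Hadamard blocks). The algebra is assumed to contain the identity. *)

theory Defs
  imports "HOL-Analysis.Analysis"
begin

section \<open>Complex Hilbert spaces\<close>

text \<open>The inner product is linear in the first argument.\<close>

class complex_hilbert_space = banach +
  fixes scaleC :: "complex \<Rightarrow> 'a \<Rightarrow> 'a"
    and cinner :: "'a \<Rightarrow> 'a \<Rightarrow> complex"
  assumes scaleC_add_right: "scaleC a (x + y) = scaleC a x + scaleC a y"
    and scaleC_add_left: "scaleC (a + b) x = scaleC a x + scaleC b x"
    and scaleC_scaleC: "scaleC a (scaleC b x) = scaleC (a * b) x"
    and scaleC_of_real: "scaleC (complex_of_real r) x = scaleR r x"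
    and cinner_add_left: "cinner (x + y) z = cinner x z + cinner y z"
    and cinner_scaleC_left: "cinner (scaleC a x) y = a * cinner x y"
    and cinner_commute: "cinner x y = cnj (cinner y x)"
    and cinner_self: "cinner x x = complex_of_real ((norm x)\<^sup>2)"

section \<open>Weighted sequence spaces and matrices over an index set\<close>

text \<open>Sequences over \<open>K\<close> are functions that vanish outside \<open>K\<close>; matrices over \<open>K\<close>
  vanish outside \<open>K \<times> K\<close>. The exponent \<open>p\<close> ranges over \<open>0\<close> and \<open>[1, \<infinity>]\<close>, where
  \<open>0\<close> stands for the closure of the finitely supported sequences in the weighted
  \<open>\<ell>\<^sup>\<infinity>\<close>-space, with the supremum norm.\<close>

definition fin_seqs :: "'i set \<Rightarrow> ('i \<Rightarrow> complex) set" where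
  "fin_seqs K = {c. finite {k. c k \<noteq> 0} \<and> {k. c k \<noteq> 0} \<subseteq> K}"

text \<open>Inserting \<open>0\<close> only matters for the empty index set.\<close>

definition lp_norm :: "'i set \<Rightarrow> ennreal \<Rightarrow> ('i \<Rightarrow> real) \<Rightarrow> ('i \<Rightarrow> complex) \<Rightarrow> real" where
  "lp_norm K p w c =
     (if p = 0 \<or> p = \<infinity> then Sup (insert 0 ((\<lambda>k. w k * cmod (c k)) ` K))
      else (\<Sum>\<^sub>\<infinity>k\<in>K. (w k * cmod (c k)) powr enn2real p) powr (1 / enn2real p))"

definition linf_space :: "'i set \<Rightarrow> ('i \<Rightarrow> real) \<Rightarrow> ('i \<Rightarrow> complex) set" where
  "linf_space K w = {c. (\<forall>k. k \<notin> K \<longrightarrow> c k = 0) \<and> bdd_above ((\<lambda>k. w k * cmod (c k)) ` K)}"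

definition lp_space :: "'i set \<Rightarrow> ennreal \<Rightarrow> ('i \<Rightarrow> real) \<Rightarrow> ('i \<Rightarrow> complex) set" where
  "lp_space K p w =
     (if p = \<infinity> then linf_space K w
      else if p = 0 then
        {c \<in> linf_space K w. \<forall>\<epsilon>>0. \<exists>d\<in>fin_seqs K. lp_norm K \<infinity> w (\<lambda>k. c k - d k) < \<epsilon>}
      else {c. (\<forall>k. k \<notin> K \<longrightarrow> c k = 0) \<and>
               (\<lambda>k. (w k * cmod (c k)) powr enn2real p) summable_on K})"

type_synonym 'i matrix = "'i \<Rightarrow> 'i \<Rightarrow> complex"

definition matrices :: "'i set \<Rightarrow> 'i matrix set" where
  "matrices K = {A. \<forall>k l. \<not> (k \<in> K \<and> l \<in> K) \<longrightarrow> A k l = 0}"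

definition mat_app :: "'i set \<Rightarrow> 'i matrix \<Rightarrow> ('i \<Rightarrow> complex) \<Rightarrow> 'i \<Rightarrow> complex" where
  "mat_app K A c = (\<lambda>k. \<Sum>\<^sub>\<infinity>l\<in>K. A k l * c l)"

definition mat_mult :: "'i set \<Rightarrow> 'i matrix \<Rightarrow> 'i matrix \<Rightarrow> 'i matrix" where
  "mat_mult K A B = (\<lambda>k l. \<Sum>\<^sub>\<infinity>m\<in>K. A k m * B m l)"

definition mat_adj :: "'i matrix \<Rightarrow> 'i matrix" where
  "mat_adj A = (\<lambda>k l. cnj (A l k))"

definition mat_id :: "'i set \<Rightarrow> 'i matrix" where
  "mat_id K = (\<lambda>k l. if k \<in> K \<and> l = k then 1 else 0)"

text \<open>The matrix \<open>A\<close> induces a bounded operator from one weighted sequence space to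
  another; the row series are required to converge.\<close>

definition mat_bounded ::
  "'i set \<Rightarrow> ennreal \<Rightarrow> ('i \<Rightarrow> real) \<Rightarrow> ennreal \<Rightarrow> ('i \<Rightarrow> real) \<Rightarrow> 'i matrix \<Rightarrow> bool" where
  "mat_bounded K p w q v A \<longleftrightarrow>
     A \<in> matrices K \<and>
     (\<forall>c\<in>lp_space K p w. (\<forall>k\<in>K. (\<lambda>l. A k l * c l) summable_on K) \<and>
        mat_app K A c \<in> lp_space K q v) \<and>
     (\<exists>C. \<forall>c\<in>lp_space K p w. lp_norm K q v (mat_app K A c) \<le> C * lp_norm K p w c)"

section \<open>Solid spectral matrix algebras\<close>

definition separated :: "'i::metric_space set \<Rightarrow> bool" where
  "separated K \<longleftrightarrow> (\<exists>\<delta>>0. \<forall>k\<in>K. \<forall>l\<in>K. k \<noteq> l \<longrightarrow> \<delta> \<le> dist k l)"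

text \<open>The algebra contains the identity of \<open>\<B>(\<ell>\<^sup>2)\<close>, as is implicit in speaking of
  inverse-closedness; this already follows from \<open>inverse_closed\<close> as soon as the algebra
  contains one matrix that is invertible on \<open>\<ell>\<^sup>2\<close>. Since every bounded operator
  on \<open>\<ell>\<^sup>2\<close> is given by a matrix, inverses may be taken to be matrices.\<close>

locale solid_spectral_matrix_algebra =
  fixes K :: "'i set" and \<A> :: "'i matrix set" and nrm :: "'i matrix \<Rightarrow> real"
  assumes matrices: "\<A> \<subseteq> matrices K"
    and add_closed: "A \<in> \<A> \<Longrightarrow> B \<in> \<A> \<Longrightarrow> (\<lambda>k l. A k l + B k l) \<in> \<A>"
    and scale_closed: "A \<in> \<A> \<Longrightarrow> (\<lambda>k l. a * A k l) \<in> \<A>"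
    and mult_closed: "A \<in> \<A> \<Longrightarrow> B \<in> \<A> \<Longrightarrow> mat_mult K A B \<in> \<A>"
    and adj_closed: "A \<in> \<A> \<Longrightarrow> mat_adj A \<in> \<A>"
    and id_mem: "mat_id K \<in> \<A>"
    and nrm_nonneg: "A \<in> \<A> \<Longrightarrow> 0 \<le> nrm A"
    and nrm_eq_0: "A \<in> \<A> \<Longrightarrow> nrm A = 0 \<longleftrightarrow> A = (\<lambda>k l. 0)"
    and nrm_scale: "A \<in> \<A> \<Longrightarrow> nrm (\<lambda>k l. a * A k l) = cmod a * nrm A"
    and nrm_triangle: "A \<in> \<A> \<Longrightarrow> B \<in> \<A> \<Longrightarrow> nrm (\<lambda>k l. A k l + B k l) \<le> nrm A + nrm B"
    and nrm_mult: "A \<in> \<A> \<Longrightarrow> B \<in> \<A> \<Longrightarrow> nrm (mat_mult K A B) \<le> nrm A * nrm B"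
    and nrm_adj: "A \<in> \<A> \<Longrightarrow> nrm (mat_adj A) = nrm A"
    and complete: "(\<And>n. X n \<in> \<A>) \<Longrightarrow>
          (\<forall>\<epsilon>>0. \<exists>N. \<forall>m\<ge>N. \<forall>n\<ge>N. nrm (\<lambda>k l. X m k l - X n k l) < \<epsilon>) \<Longrightarrow>
          \<exists>A\<in>\<A>. (\<lambda>n. nrm (\<lambda>k l. X n k l - A k l)) \<longlonglongrightarrow> 0"
    and l2_bounded: "A \<in> \<A> \<Longrightarrow> mat_bounded K 2 (\<lambda>_. 1) 2 (\<lambda>_. 1) A"
    and inverse_closed: "A \<in> \<A> \<Longrightarrow> mat_bounded K 2 (\<lambda>_. 1) 2 (\<lambda>_. 1) B \<Longrightarrow>
          (\<And>c. c \<in> lp_space K 2 (\<lambda>_. 1) \<Longrightarrow>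
             mat_app K B (mat_app K A c) = c \<and> mat_app K A (mat_app K B c) = c) \<Longrightarrow>
          B \<in> \<A>"
    and solid: "A \<in> \<A> \<Longrightarrow> (\<And>k l. cmod (B k l) \<le> cmod (A k l)) \<Longrightarrow> B \<in> \<A> \<and> nrm B \<le> nrm A"

definition admissible_weight :: "'i set \<Rightarrow> 'i matrix set \<Rightarrow> ('i \<Rightarrow> real) \<Rightarrow> bool" where
  "admissible_weight K \<A> w \<longleftrightarrow>
     (\<forall>k\<in>K. 0 < w k) \<and> (\<forall>A\<in>\<A>. \<forall>p\<ge>1. mat_bounded K p w p w A)"

section \<open>Frames\<close>

definition is_frame :: "'i set \<Rightarrow> ('i \<Rightarrow> 'h::complex_hilbert_space) \<Rightarrow> bool" where
  "is_frame K \<psi> \<longleftrightarrow> (\<exists>A>0. \<exists>B>0. \<forall>f.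
     (\<lambda>k. (cmod (cinner f (\<psi> k)))\<^sup>2) summable_on K \<and>
     A * (norm f)\<^sup>2 \<le> (\<Sum>\<^sub>\<infinity>k\<in>K. (cmod (cinner f (\<psi> k)))\<^sup>2) \<and>
     (\<Sum>\<^sub>\<infinity>k\<in>K. (cmod (cinner f (\<psi> k)))\<^sup>2) \<le> B * (norm f)\<^sup>2)"

definition analysis_op ::
  "'i set \<Rightarrow> ('i \<Rightarrow> 'h::complex_hilbert_space) \<Rightarrow> 'h \<Rightarrow> 'i \<Rightarrow> complex" where
  "analysis_op K \<psi> f = (\<lambda>k. if k \<in> K then cinner f (\<psi> k) else 0)"

definition synthesis_op ::
  "'i set \<Rightarrow> ('i \<Rightarrow> 'h::complex_hilbert_space) \<Rightarrow> ('i \<Rightarrow> complex) \<Rightarrow> 'h" where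
  "synthesis_op K \<psi> c = (\<Sum>\<^sub>\<infinity>k\<in>K. scaleC (c k) (\<psi> k))"

definition frame_op :: "'i set \<Rightarrow> ('i \<Rightarrow> 'h::complex_hilbert_space) \<Rightarrow> 'h \<Rightarrow> 'h" where
  "frame_op K \<psi> = synthesis_op K \<psi> \<circ> analysis_op K \<psi>"

definition dual_frame :: "'i set \<Rightarrow> ('i \<Rightarrow> 'h::complex_hilbert_space) \<Rightarrow> 'i \<Rightarrow> 'h" where
  "dual_frame K \<psi> = (\<lambda>k. inv (frame_op K \<psi>) (\<psi> k))"

definition cross_gram ::
  "'i set \<Rightarrow> ('i \<Rightarrow> 'h::complex_hilbert_space) \<Rightarrow> ('i \<Rightarrow> 'h) \<Rightarrow> 'i matrix" where
  "cross_gram K \<psi> \<phi> = (\<lambda>k l. if k \<in> K \<and> l \<in> K then cinner (\<phi> l) (\<psi> k) else 0)"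

definition localized_rel ::
  "'i set \<Rightarrow> 'i matrix set \<Rightarrow> ('i \<Rightarrow> 'h::complex_hilbert_space) \<Rightarrow> ('i \<Rightarrow> 'h) \<Rightarrow> bool" where
  "localized_rel K \<A> \<psi> \<phi> \<longleftrightarrow> cross_gram K \<psi> \<phi> \<in> \<A>"

section \<open>Coorbit spaces\<close>

text \<open>Elements of the coorbit spaces of \<open>\<psi>\<close> are equivalence classes of sequences in the
  Hilbert space.\<close>

type_synonym 'h coorb = "(nat \<Rightarrow> 'h) set"

definition coorbit_seqs ::
  "'i set \<Rightarrow> ('i \<Rightarrow> 'h::complex_hilbert_space) \<Rightarrow> ('i \<Rightarrow> real) \<Rightarrow> (nat \<Rightarrow> 'h) set" where
  "coorbit_seqs K \<psi> w = {f.
     (\<forall>k\<in>K. convergent (\<lambda>n. cinner (f n) (dual_frame K \<psi> k))) \<and>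
     (\<forall>n. analysis_op K (dual_frame K \<psi>) (f n) \<in> lp_space K \<infinity> w) \<and>
     bdd_above (range (\<lambda>n. lp_norm K \<infinity> w (analysis_op K (dual_frame K \<psi>) (f n))))}"

definition coorbit_rel ::
  "'i set \<Rightarrow> ('i \<Rightarrow> 'h::complex_hilbert_space) \<Rightarrow> ('i \<Rightarrow> real) \<Rightarrow> ((nat \<Rightarrow> 'h) \<times> (nat \<Rightarrow> 'h)) set"
where
  "coorbit_rel K \<psi> w = {(f, g). f \<in> coorbit_seqs K \<psi> w \<and> g \<in> coorbit_seqs K \<psi> w \<and>
     (\<forall>k\<in>K. (\<lambda>n. cinner (f n - g n) (dual_frame K \<psi> k)) \<longlonglongrightarrow> 0)}"

definition coorbit_class ::
  "'i set \<Rightarrow> ('i \<Rightarrow> 'h::complex_hilbert_space) \<Rightarrow> ('i \<Rightarrow> real) \<Rightarrow> (nat \<Rightarrow> 'h) \<Rightarrow> 'h coorb" where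
  "coorbit_class K \<psi> w f = coorbit_rel K \<psi> w `` {f}"

definition coorbit_rep :: "'h coorb \<Rightarrow> nat \<Rightarrow> 'h" where
  "coorbit_rep F = (SOME f. f \<in> F)"

definition coorbit_embed ::
  "'i set \<Rightarrow> ('i \<Rightarrow> 'h::complex_hilbert_space) \<Rightarrow> ('i \<Rightarrow> real) \<Rightarrow> 'h \<Rightarrow> 'h coorb" where
  "coorbit_embed K \<psi> w f = coorbit_class K \<psi> w (\<lambda>_. f)"

text \<open>The coefficient sequence of a class with respect to the dual frame.\<close>

definition coorbit_coeff ::
  "'i set \<Rightarrow> ('i \<Rightarrow> 'h::complex_hilbert_space) \<Rightarrow> 'h coorb \<Rightarrow> 'i \<Rightarrow> complex" where
  "coorbit_coeff K \<psi> F =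
     (\<lambda>k. if k \<in> K then lim (\<lambda>n. cinner (coorbit_rep F n) (dual_frame K \<psi> k)) else 0)"

definition coorbit_norm ::
  "'i set \<Rightarrow> ('i \<Rightarrow> 'h::complex_hilbert_space) \<Rightarrow> ennreal \<Rightarrow> ('i \<Rightarrow> real) \<Rightarrow> 'h coorb \<Rightarrow> real" where
  "coorbit_norm K \<psi> p w F = lp_norm K p w (coorbit_coeff K \<psi> F)"

definition coorbit_fin ::
  "'i set \<Rightarrow> ('i \<Rightarrow> 'h::complex_hilbert_space) \<Rightarrow> 'h set" where
  "coorbit_fin K \<psi> = synthesis_op K \<psi> ` fin_seqs K"

text \<open>For \<open>p \<noteq> \<infinity>\<close> the completion of \<open>coorbit_fin\<close> is realised inside the coorbit space
  with \<open>p = \<infinity>\<close>. This loses nothing: the coefficients of a Cauchy sequence \<open>f\<close> in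
  \<open>coorbit_fin\<close> converge in the (complete) weighted sequence space, so that \<open>f\<close> itself
  belongs to \<open>coorbit_seqs\<close> and its class is the limit.\<close>

definition coorbit ::
  "'i set \<Rightarrow> ('i \<Rightarrow> 'h::complex_hilbert_space) \<Rightarrow> ennreal \<Rightarrow> ('i \<Rightarrow> real) \<Rightarrow> 'h coorb set" where
  "coorbit K \<psi> p w =
     (if p = \<infinity> then coorbit_seqs K \<psi> w // coorbit_rel K \<psi> w
      else {F \<in> coorbit_seqs K \<psi> w // coorbit_rel K \<psi> w. \<forall>\<epsilon>>0. \<exists>f\<in>coorbit_fin K \<psi>.
              (\<lambda>k. coorbit_coeff K \<psi> F k - analysis_op K (dual_frame K \<psi>) f k) \<in> lp_space K p w \<and>
              lp_norm K p w
                (\<lambda>k. coorbit_coeff K \<psi> F k - analysis_op K (dual_frame K \<psi>) f k) < \<epsilon>})"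

definition coorbit_add ::
  "'i set \<Rightarrow> ('i \<Rightarrow> 'h::complex_hilbert_space) \<Rightarrow> ('i \<Rightarrow> real) \<Rightarrow> 'h coorb \<Rightarrow> 'h coorb \<Rightarrow> 'h coorb"
where
  "coorbit_add K \<psi> w F G = coorbit_class K \<psi> w (\<lambda>n. coorbit_rep F n + coorbit_rep G n)"

definition coorbit_scale ::
  "'i set \<Rightarrow> ('i \<Rightarrow> 'h::complex_hilbert_space) \<Rightarrow> ('i \<Rightarrow> real) \<Rightarrow> complex \<Rightarrow> 'h coorb \<Rightarrow> 'h coorb"
where
  "coorbit_scale K \<psi> w a F = coorbit_class K \<psi> w (\<lambda>n. scaleC a (coorbit_rep F n))"

definition coorbit_sum ::
  "'i set \<Rightarrow> ('i \<Rightarrow> 'h::complex_hilbert_space) \<Rightarrow> ('i \<Rightarrow> real) \<Rightarrow> ('a \<Rightarrow> 'h coorb) \<Rightarrow> 'a set \<Rightarrow> 'h coorb"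
where
  "coorbit_sum K \<psi> w F I = coorbit_class K \<psi> w (\<lambda>n. \<Sum>i\<in>I. coorbit_rep (F i) n)"

text \<open>The pairing of a coorbit space with exponent \<open>p\<close> and weight \<open>w\<close> with the one with the
  dual exponent and weight \<open>1 / w\<close>. The formula does not depend on \<open>p\<close> and \<open>w\<close>; the inner
  sum is the coefficient sequence of \<open>H\<close> with respect to \<open>\<psi>\<close> itself.\<close>

definition coorbit_pairing ::
  "'i set \<Rightarrow> ('i \<Rightarrow> 'h::complex_hilbert_space) \<Rightarrow> 'h coorb \<Rightarrow> 'h coorb \<Rightarrow> complex" where
  "coorbit_pairing K \<psi> F H =
     (\<Sum>\<^sub>\<infinity>k\<in>K. coorbit_coeff K \<psi> F k *
        cnj (mat_app K (cross_gram K \<psi> \<psi>) (coorbit_coeff K \<psi> H) k))"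

text \<open>The distance is set to \<open>0\<close> outside the space because the library requires
  a metric to be nonnegative and symmetric everywhere.\<close>

definition coorbit_norm_topology ::
  "'i set \<Rightarrow> ('i \<Rightarrow> 'h::complex_hilbert_space) \<Rightarrow> ennreal \<Rightarrow> ('i \<Rightarrow> real) \<Rightarrow> 'h coorb topology"
where
  "coorbit_norm_topology K \<psi> p w = Metric_space.mtopology (coorbit K \<psi> p w)
     (\<lambda>F G. if F \<in> coorbit K \<psi> p w \<and> G \<in> coorbit K \<psi> p w
        then coorbit_norm K \<psi> p w (coorbit_add K \<psi> w F (coorbit_scale K \<psi> w (-1) G)) else 0)"

definition coorbit_weak_star ::
  "'i set \<Rightarrow> ('i \<Rightarrow> 'h::complex_hilbert_space) \<Rightarrow> ('i \<Rightarrow> real) \<Rightarrow> 'h coorb topology" where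
  "coorbit_weak_star K \<psi> w = topology_generated_by
     {{F \<in> coorbit K \<psi> \<infinity> w. coorbit_pairing K \<psi> F H \<in> U} | H U.
        H \<in> coorbit K \<psi> 1 (\<lambda>k. 1 / w k) \<and> open U}"

section \<open>Operators between coorbit spaces\<close>

text \<open>For \<open>p1 = \<infinity>\<close> an operator is only determined by its matrix if it is weak-\<open>*\<close>
  continuous: for an orthonormal basis \<open>\<psi>\<close> indexed by an infinite set, a Banach limit times
  a fixed vector is a bounded nonzero operator whose matrix vanishes. Boundedness and
  weak-\<open>*\<close> continuity are kept apart here.\<close>

definition coorbit_blinops ::
  "'i set \<Rightarrow> ('i \<Rightarrow> 'h::complex_hilbert_space) \<Rightarrow> ennreal \<Rightarrow> ('i \<Rightarrow> real) \<Rightarrow> ennreal \<Rightarrow> ('i \<Rightarrow> real) \<Rightarrow>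
     ('h coorb \<Rightarrow> 'h coorb) set" where
  "coorbit_blinops K \<psi> p1 w1 p2 w2 =
     {T \<in> coorbit K \<psi> p1 w1 \<rightarrow>\<^sub>E coorbit K \<psi> p2 w2.
        (\<forall>F\<in>coorbit K \<psi> p1 w1. \<forall>G\<in>coorbit K \<psi> p1 w1.
           T (coorbit_add K \<psi> w1 F G) = coorbit_add K \<psi> w2 (T F) (T G)) \<and>
        (\<forall>a. \<forall>F\<in>coorbit K \<psi> p1 w1.
           T (coorbit_scale K \<psi> w1 a F) = coorbit_scale K \<psi> w2 a (T F)) \<and>
        (\<exists>C. \<forall>F\<in>coorbit K \<psi> p1 w1. coorbit_norm K \<psi> p2 w2 (T F) \<le> C * coorbit_norm K \<psi> p1 w1 F)}"

definition matrix_of ::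
  "'i set \<Rightarrow> ('i \<Rightarrow> 'h::complex_hilbert_space) \<Rightarrow> ('i \<Rightarrow> real) \<Rightarrow> ('i \<Rightarrow> real) \<Rightarrow>
     ('i \<Rightarrow> 'h) \<Rightarrow> ('i \<Rightarrow> 'h) \<Rightarrow> ('h coorb \<Rightarrow> 'h coorb) \<Rightarrow> 'i matrix" where
  "matrix_of K \<psi> w1 w2 \<phi> \<xi> T =
     (\<lambda>k l. if k \<in> K \<and> l \<in> K
        then coorbit_pairing K \<psi> (T (coorbit_embed K \<psi> w1 (\<xi> l)))
               (coorbit_embed K \<psi> (\<lambda>i. 1 / w2 i) (\<phi> k))
        else 0)"

text \<open>The outer series is summed unconditionally: in norm if \<open>p2 \<noteq> \<infinity>\<close>, and in the
  weak-\<open>*\<close> topology if \<open>p2 = \<infinity>\<close>.\<close>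

definition operator_of ::
  "'i set \<Rightarrow> ('i \<Rightarrow> 'h::complex_hilbert_space) \<Rightarrow> ennreal \<Rightarrow> ('i \<Rightarrow> real) \<Rightarrow> ennreal \<Rightarrow> ('i \<Rightarrow> real) \<Rightarrow>
     ('i \<Rightarrow> 'h) \<Rightarrow> ('i \<Rightarrow> 'h) \<Rightarrow> 'i matrix \<Rightarrow> 'h coorb \<Rightarrow> 'h coorb" where
  "operator_of K \<psi> p1 w1 p2 w2 \<phi> \<xi> M =
     (\<lambda>H\<in>coorbit K \<psi> p1 w1. THE F.
        limitin (if p2 = \<infinity> then coorbit_weak_star K \<psi> w2 else coorbit_norm_topology K \<psi> p2 w2)
          (coorbit_sum K \<psi> w2 (\<lambda>k. coorbit_scale K \<psi> w2
             (\<Sum>\<^sub>\<infinity>j\<in>K. M k j * coorbit_pairing K \<psi> H (coorbit_embed K \<psi> (\<lambda>i. 1 / w1 i) (\<xi> j)))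
             (coorbit_embed K \<psi> w2 (\<phi> k))))
          F (finite_subsets_at_top K))"

definition coorbit_tensor ::
  "'i set \<Rightarrow> ('i \<Rightarrow> 'h::complex_hilbert_space) \<Rightarrow> ('i \<Rightarrow> real) \<Rightarrow> 'h coorb \<Rightarrow> 'h coorb \<Rightarrow>
     'h coorb \<Rightarrow> 'h coorb" where
  "coorbit_tensor K \<psi> w2 F G = (\<lambda>H. coorbit_scale K \<psi> w2 (coorbit_pairing K \<psi> H G) F)"

text \<open>The partial sum over \<open>(k, j) \<in> R\<close> of the expansion with terms
  \<open>M k j \<cdot> (\<phi> k \<otimes> \<xi> j)\<close>, evaluated at \<open>H\<close>.\<close>

definition tensor_partial_sum ::
  "'i set \<Rightarrow> ('i \<Rightarrow> 'h::complex_hilbert_space) \<Rightarrow> ('i \<Rightarrow> real) \<Rightarrow> ('i \<Rightarrow> real) \<Rightarrow>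
     ('i \<Rightarrow> 'h) \<Rightarrow> ('i \<Rightarrow> 'h) \<Rightarrow> 'i matrix \<Rightarrow> ('i \<times> 'i) set \<Rightarrow> 'h coorb \<Rightarrow> 'h coorb" where
  "tensor_partial_sum K \<psi> w1 w2 \<phi> \<xi> M R H =
     coorbit_sum K \<psi> w2 (\<lambda>(k, j). coorbit_scale K \<psi> w2 (M k j)
       (coorbit_tensor K \<psi> w2 (coorbit_embed K \<psi> w2 (\<phi> k))
          (coorbit_embed K \<psi> (\<lambda>i. 1 / w1 i) (\<xi> j)) H)) R"

text \<open>\<open>T\<close> is the sum over \<open>k, j\<close> of \<open>M k j \<cdot> (\<phi> k \<otimes> \<xi> j)\<close>.

  The weak-\<open>*\<close> convergence is unconditional over the index set \<open>K \<times> K\<close>, for all exponents.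

  In the strong operator topology (\<open>p1, p2 \<noteq> \<infinity>\<close>) the sum is a double series: the sums over
  \<open>k\<close> and over \<open>j\<close> are both unconditional and may be taken jointly or one after the other. For
  \<open>p1 \<in> {0, 1}\<close> it is even unconditional over \<open>K \<times> K\<close>. For other exponents the latter
  property fails already for \<open>p1 = p2 = 2\<close> and orthonormal bases, since it would imply that
  the matrix of absolute values of any bounded matrix on \<open>\<ell>\<^sup>2\<close> is again bounded (consider block
  diagonal matrices with normalised Hadamard blocks).\<close>

definition unconditional_expansion ::
  "'i set \<Rightarrow> ('i \<Rightarrow> 'h::complex_hilbert_space) \<Rightarrow> ennreal \<Rightarrow> ('i \<Rightarrow> real) \<Rightarrow> ennreal \<Rightarrow> ('i \<Rightarrow> real) \<Rightarrow>
     ('i \<Rightarrow> 'h) \<Rightarrow> ('i \<Rightarrow> 'h) \<Rightarrow> 'i matrix \<Rightarrow> ('h coorb \<Rightarrow> 'h coorb) \<Rightarrow> bool" where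
  "unconditional_expansion K \<psi> p1 w1 p2 w2 \<phi> \<xi> M T \<longleftrightarrow> (\<forall>H\<in>coorbit K \<psi> p1 w1.
     limitin (coorbit_weak_star K \<psi> w2)
       (\<lambda>R. tensor_partial_sum K \<psi> w1 w2 \<phi> \<xi> M R H) (T H) (finite_subsets_at_top (K \<times> K)) \<and>
     (p1 \<noteq> \<infinity> \<and> p2 \<noteq> \<infinity> \<longrightarrow>
        limitin (coorbit_norm_topology K \<psi> p2 w2)
          (\<lambda>(I, J). tensor_partial_sum K \<psi> w1 w2 \<phi> \<xi> M (I \<times> J) H) (T H)
          (finite_subsets_at_top K \<times>\<^sub>F finite_subsets_at_top K)) \<and>
     (p1 \<in> {0, 1} \<and> p2 \<noteq> \<infinity> \<longrightarrow>
        limitin (coorbit_norm_topology K \<psi> p2 w2)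
          (\<lambda>R. tensor_partial_sum K \<psi> w1 w2 \<phi> \<xi> M R H) (T H) (finite_subsets_at_top (K \<times> K))))"

end

theory Submission
  imports Defs
begin

text \<open>The coefficient map identifies \<open>\<H>\<^sup>p\<^sub>w\<close> with the sequences in \<open>\<ell>\<^sup>p\<^sub>w\<close> that are fixed by
  the cross-Gram matrix \<open>P\<close> of the dual frame and \<open>\<psi>\<close>. On this side all operators of the theorem
  are products of the operator \<open>T\<close> with cross-Gram matrices, and the factorizations follow from
  \<open>D\<^sub>\<psi> C\<^sub>\<psi>\<^sub>~ = 1\<close>; the row series of the matrix of \<open>T\<close> converge by continuity of \<open>T\<close>
  along truncations, in norm if \<open>p1 \<noteq> \<infinity>\<close> and weak-\<open>*\<close> otherwise.

  That the dual Gram matrix lies in the algebra is shown without functional calculus. With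
  \<open>R = S\<inverse>\<close>, inverse-closedness puts \<open>C\<^sub>\<psi> (S - z)\<inverse> D\<^sub>\<psi>\<close> into the algebra for \<open>z\<close> on a small
  circle around \<open>0\<close>. Its averages over \<open>2\<^sup>m\<close> equidistant points form a Cauchy sequence in the algebra
  norm, and their entries converge to those of \<open>C\<^sub>\<psi> R D\<^sub>\<psi> = P\<close>.\<close>

section \<open>Complex Hilbert spaces\<close>

text \<open>Redundancy is the obstacle. Unless \<psi> is a Riesz basis, its Gram matrix G has a
  kernel on \<open>\<ell>\<^sup>2\<close>, so inverse-closedness says nothing about G itself. It
  does apply to 1 - G / z for small z \<noteq> 0, whose inverse is 1 minus the matrix of (S -
  z)^(-1). This excludes exactly z = 0, the value that is wanted, and the mean value property
  recovers it: the mean over N equidistant points of the circle differs from R by a term carrying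
  the N-th power of \<open>radius\<close> times R, an operator of norm at most 1/2. Finite means
  keep every approximant visibly inside the algebra. The algebra norm is tied to matrix entries only
  through solidity, by way of matrix units.

  A second obstacle is the range of exponents and weights. Admissibility speaks of p \<ge> 1 and of
  w, whereas the pairing uses 1 / w and the theorem includes p = 0. Everything is therefore first
  reduced to absolute row sums of the matrices for w and for 1 / w. They make the double series
  absolutely convergent, justify each interchange of sums, and yield the missing spaces.\<close>

lemma cinner_add_right: "cinner x (y + z) = cinner x y + cinner x z"
  by (metis cinner_add_left cinner_commute complex_cnj_add)

lemma cinner_scaleC_right: "cinner x (scaleC a y) = cnj a * cinner x y"
  by (metis cinner_scaleC_left cinner_commute complex_cnj_mult)

lemma cinner_scaleR_left: "cinner (scaleR r x) y = of_real r * cinner x y"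
  by (metis cinner_scaleC_left scaleC_of_real)

lemma cinner_scaleR_right: "cinner x (scaleR r y) = of_real r * cinner x y"
  by (metis cinner_scaleC_right scaleC_of_real complex_cnj_complex_of_real)

lemma cinner_minus_left: "cinner (- x) y = - cinner x y"
  using cinner_scaleR_left[of "-1" x y] by simp

lemma cinner_minus_right: "cinner x (- y) = - cinner x y"
  using cinner_scaleR_right[of x "-1" y] by simp

lemma cinner_diff_left: "cinner (x - y) z = cinner x z - cinner y z"
  using cinner_add_left[of x "- y" z] by (simp add: cinner_minus_left)

lemma cinner_diff_right: "cinner x (y - z) = cinner x y - cinner x z"
  using cinner_add_right[of x y "- z"] by (simp add: cinner_minus_right)

lemma cinner_zero_left [simp]: "cinner 0 x = 0"
  using cinner_diff_left[of 0 0 x] by simp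

lemma cinner_zero_right [simp]: "cinner x 0 = 0"
  using cinner_diff_right[of x 0 0] by simp

lemma scaleC_zero_left [simp]: "scaleC 0 x = 0"
  using scaleC_of_real[of 0 x] by simp

lemma scaleC_one [simp]: "scaleC 1 x = x"
  using scaleC_of_real[of 1 x] by simp

lemma scaleC_zero_right [simp]: "scaleC a 0 = 0"
  using scaleC_add_right[of a 0 0] by simp

lemma scaleC_minus_right: "scaleC a (- x) = - scaleC a x"
  using scaleC_add_right[of a x "- x"] by (simp add: add_eq_0_iff)

lemma scaleC_diff_right: "scaleC a (x - y) = scaleC a x - scaleC a y"
  using scaleC_add_right[of a x "- y"] by (simp add: scaleC_minus_right)

lemma scaleC_minus_left: "scaleC (- a) x = - scaleC a x"
  using scaleC_add_left[of a "- a" x] by (simp add: add_eq_0_iff)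

lemma scaleC_diff_left: "scaleC (a - b) x = scaleC a x - scaleC b x"
  using scaleC_add_left[of a "- b" x] by (simp add: scaleC_minus_left)

text \<open>The class ties \<open>norm\<close> to real scalars only; \<open>cinner_self\<close>
  extends homogeneity to complex ones.\<close>

lemma norm_scaleC: "norm (scaleC a x) = cmod a * norm x"
proof -
  have "complex_of_real ((norm (scaleC a x))\<^sup>2) = a * cnj a * complex_of_real ((norm x)\<^sup>2)"
    unfolding cinner_self[symmetric] by (simp add: cinner_scaleC_left cinner_scaleC_right)
  also have "\<dots> = complex_of_real ((cmod a * norm x)\<^sup>2)"
    by (simp add: complex_norm_square[symmetric] power_mult_distrib)
  finally have "(norm (scaleC a x))\<^sup>2 = (cmod a * norm x)\<^sup>2"
    using of_real_eq_iff by blast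
  then show ?thesis by simp
qed

lemma Cauchy_Schwarz_cinner: "cmod (cinner x y) \<le> norm x * norm y"
proof (cases "y = 0")
  case False
  define a where "a = cinner x y"
  define N where "N = (norm y)\<^sup>2"
  have ya: "cinner y x = cnj a"
    unfolding a_def by (rule cinner_commute)
  \<comment> \<open>This is N times the component of x orthogonal to y; the factor N avoids a
    division.\<close>
  define u where "u = scaleC (of_real N) x - scaleC a y"
  have "cinner u u = of_real N * of_real N * cinner x x - of_real N * cnj a * a
      - a * of_real N * cnj a + a * cnj a * cinner y y"
    unfolding u_def a_def[symmetric]
    by (simp add: cinner_diff_left cinner_diff_right cinner_scaleC_left cinner_scaleC_right
        ya a_def[symmetric] algebra_simps)
  also have "\<dots> = of_real (N * (N * (norm x)\<^sup>2 - (cmod a)\<^sup>2))"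
    unfolding cinner_self N_def[symmetric]
    by (simp add: complex_norm_square[symmetric] algebra_simps)
  finally have "complex_of_real ((norm u)\<^sup>2) = of_real (N * (N * (norm x)\<^sup>2 - (cmod a)\<^sup>2))"
    by (simp add: cinner_self)
  then have "(norm u)\<^sup>2 = N * (N * (norm x)\<^sup>2 - (cmod a)\<^sup>2)"
    using of_real_eq_iff by blast
  then have "0 \<le> N * (N * (norm x)\<^sup>2 - (cmod a)\<^sup>2)"
    by (metis zero_le_power2)
  moreover have "0 < N"
    using False by (simp add: N_def)
  ultimately have "(cmod a)\<^sup>2 \<le> N * (norm x)\<^sup>2"
    by (simp add: zero_le_mult_iff)
  then have "(cmod a)\<^sup>2 \<le> (norm x * norm y)\<^sup>2"
    by (simp add: N_def power_mult_distrib mult.commute)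
  then show ?thesis
    unfolding a_def by (rule power2_le_imp_le) simp
qed simp

lemma cinner_sum_left: "cinner (\<Sum>i\<in>I. f i) y = (\<Sum>i\<in>I. cinner (f i) y)"
  by (induction I rule: infinite_finite_induct) (simp_all add: cinner_add_left)

lemma bounded_linear_cinner_left: "bounded_linear (\<lambda>x. cinner (x :: 'h::complex_hilbert_space) y)"
  by (rule bounded_linear_intro[where K = "norm y"])
    (simp_all add: cinner_add_left cinner_scaleR_left scaleR_conv_of_real Cauchy_Schwarz_cinner)

lemma bounded_linear_cinner_right: "bounded_linear (\<lambda>x. cinner y (x :: 'h::complex_hilbert_space))"
  by (rule bounded_linear_intro[where K = "norm y"])
    (simp_all add: cinner_add_right cinner_scaleR_right scaleR_conv_of_real
      Cauchy_Schwarz_cinner mult.commute[of _ "norm y"])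

lemma bounded_linear_scaleC: "bounded_linear (scaleC a :: 'h \<Rightarrow> 'h::complex_hilbert_space)"
  by (rule bounded_linear_intro[where K = "cmod a"])
    (simp_all add: scaleC_add_right norm_scaleC scaleC_of_real[symmetric] scaleC_scaleC
      mult.commute)

section \<open>Bounded complex-linear operators and the inversion of coercive ones\<close>

definition bounded_clinear :: "('h \<Rightarrow> 'h::complex_hilbert_space) \<Rightarrow> bool" where
  "bounded_clinear T \<longleftrightarrow> bounded_linear T \<and> (\<forall>a x. T (scaleC a x) = scaleC a (T x))"

lemma bounded_clinear_id: "bounded_clinear (\<lambda>x. x)"
  by (simp add: bounded_clinear_def bounded_linear_ident)

lemma bounded_clinear_scaleC: "bounded_clinear T \<Longrightarrow> bounded_clinear (\<lambda>x. scaleC a (T x))"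
  unfolding bounded_clinear_def
  by (auto intro: bounded_linear_compose[OF bounded_linear_scaleC] simp: scaleC_scaleC mult.commute)

lemma bounded_clinear_diff:
  "bounded_clinear T \<Longrightarrow> bounded_clinear U \<Longrightarrow> bounded_clinear (\<lambda>x. T x - U x)"
  unfolding bounded_clinear_def by (auto intro: bounded_linear_sub simp: scaleC_diff_right)

lemma bounded_clinear_minus: "bounded_clinear T \<Longrightarrow> bounded_clinear (\<lambda>x. - T x)"
  unfolding bounded_clinear_def by (auto intro: bounded_linear_minus simp: scaleC_minus_right)

lemma bounded_clinear_compose:
  "bounded_clinear T \<Longrightarrow> bounded_clinear U \<Longrightarrow> bounded_clinear (\<lambda>x. T (U x))"
  unfolding bounded_clinear_def by (auto intro: bounded_linear_compose)

text \<open>Lax--Milgram: for small \<open>t > 0\<close> the map \<open>f \<mapsto> f - t (T f - g)\<close> is a contraction.\<close>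

lemma coercive_bij:
  fixes T :: "'h \<Rightarrow> 'h::complex_hilbert_space"
  assumes T: "bounded_linear T" and "0 < \<alpha>"
    and coercive: "\<And>f. \<alpha> * (norm f)\<^sup>2 \<le> Re (cinner (T f) f)"
  shows "bij T" and "norm f \<le> norm (T f) / \<alpha>"
proof -
  interpret T: bounded_linear T by fact
  have lower: "\<alpha> * norm f \<le> norm (T f)" for f
  proof (cases "f = 0")
    case False
    have "\<alpha> * norm f * norm f \<le> Re (cinner (T f) f)"
      using coercive[of f] by (simp add: power2_eq_square)
    also have "\<dots> \<le> norm (T f) * norm f"
      using Cauchy_Schwarz_cinner complex_Re_le_cmod order_trans by blast
    finally show ?thesis
      using False by simp
  qed simp
  then show "norm f \<le> norm (T f) / \<alpha>"
    using \<open>0 < \<alpha>\<close> by (simp add: field_simps)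
  have "inj T"
  proof (rule injI)
    fix f g assume "T f = T g"
    then have "\<alpha> * norm (f - g) \<le> 0"
      using lower[of "f - g"] by (simp add: T.diff)
    then show "f = g"
      using \<open>0 < \<alpha>\<close> by (simp add: mult_le_0_iff)
  qed
  moreover have "\<exists>f. T f = g" for g
  proof -
    obtain B0 where B0: "0 < B0" "\<And>f. norm (T f) \<le> norm f * B0"
      using T.pos_bounded by blast
    \<comment> \<open>Adding \<alpha> enforces \<alpha> < B, so that the root defining
      \<open>q\<close> is taken of a positive number.\<close>
    define B where "B = B0 + \<alpha>"
    have B: "0 < B" "\<alpha> < B" "norm (T f) \<le> B * norm f" for f
      using B0 \<open>0 < \<alpha>\<close> by (auto simp: B_def algebra_simps intro: order_trans[OF B0(2)])
    \<comment> \<open>This t minimises 1 - 2 t \<alpha> + t^2 B^2; the minimum is 1 - \<alpha>^2 /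
      B^2, the square of \<open>q\<close>.\<close>
    define t where "t = \<alpha> / B\<^sup>2"
    define q where "q = sqrt (1 - \<alpha>\<^sup>2 / B\<^sup>2)"
    have "0 < t"
      using B \<open>0 < \<alpha>\<close> by (simp add: t_def)
    have "\<alpha>\<^sup>2 < B\<^sup>2"
      using B \<open>0 < \<alpha>\<close> by (intro power_strict_mono) auto
    then have q: "0 \<le> q" "q < 1" "q\<^sup>2 = 1 - \<alpha>\<^sup>2 / B\<^sup>2"
      using B \<open>0 < \<alpha>\<close> by (auto simp: q_def field_simps)
    have contr: "norm (f - t *\<^sub>R T f) \<le> q * norm f" for f
    proof -
      have "complex_of_real ((norm (f - t *\<^sub>R T f))\<^sup>2) =
          cinner f f - of_real t * (cinner (T f) f + cinner f (T f)) + (of_real t)\<^sup>2 * cinner (T f) (T f)"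
        unfolding cinner_self[symmetric]
        by (simp add: cinner_diff_left cinner_diff_right cinner_scaleR_left cinner_scaleR_right
            algebra_simps power2_eq_square)
      also have "\<dots> = of_real ((norm f)\<^sup>2 - 2 * t * Re (cinner (T f) f) + t\<^sup>2 * (norm (T f))\<^sup>2)"
        unfolding cinner_self cinner_commute[of f "T f"] by (simp add: complex_add_cnj)
      finally have "(norm (f - t *\<^sub>R T f))\<^sup>2 =
          (norm f)\<^sup>2 - 2 * t * Re (cinner (T f) f) + t\<^sup>2 * (norm (T f))\<^sup>2"
        using of_real_eq_iff by blast
      also have "\<dots> \<le> (norm f)\<^sup>2 - 2 * t * (\<alpha> * (norm f)\<^sup>2) + t\<^sup>2 * (B * norm f)\<^sup>2"
      proof -
        have "(norm (T f))\<^sup>2 \<le> (B * norm f)\<^sup>2"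
          by (rule power_mono[OF B(3)]) simp
        then have "t\<^sup>2 * (norm (T f))\<^sup>2 \<le> t\<^sup>2 * (B * norm f)\<^sup>2"
          by (rule mult_left_mono) simp
        moreover have "2 * t * (\<alpha> * (norm f)\<^sup>2) \<le> 2 * t * Re (cinner (T f) f)"
          using coercive \<open>0 < t\<close> by (intro mult_left_mono) auto
        ultimately show ?thesis by linarith
      qed
      also have "\<dots> = (1 - \<alpha>\<^sup>2 / B\<^sup>2) * (norm f)\<^sup>2"
        using B by (simp add: t_def power2_eq_square field_simps)
      also have "\<dots> = (q * norm f)\<^sup>2"
        by (simp add: q power_mult_distrib)
      finally show ?thesis
        by (rule power2_le_imp_le) (simp add: q(1))
    qed
    have "\<exists>!f. f - t *\<^sub>R (T f - g) = f"
    proof (rule banach_fix_type[OF q(1,2)], intro allI)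
      fix x y
      have "x - t *\<^sub>R (T x - g) - (y - t *\<^sub>R (T y - g)) = (x - y) - t *\<^sub>R T (x - y)"
        by (simp add: T.diff algebra_simps)
      then show "dist (x - t *\<^sub>R (T x - g)) (y - t *\<^sub>R (T y - g)) \<le> q * dist x y"
        using contr[of "x - y"] unfolding dist_norm by (simp only:)
    qed
    then obtain f where "f - t *\<^sub>R (T f - g) = f"
      by blast
    then have "T f = g"
      using \<open>0 < t\<close> by simp
    then show ?thesis ..
  qed
  then have "surj T"
    unfolding surj_def by metis
  ultimately show "bij T"
    by (simp add: bij_def)
qed

lemma coercive_inv:
  fixes T :: "'h \<Rightarrow> 'h::complex_hilbert_space"
  assumes T: "bounded_clinear T" and "0 < \<alpha>"
    and coercive: "\<And>f. \<alpha> * (norm f)\<^sup>2 \<le> Re (cinner (T f) f)"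
  shows "bounded_clinear (inv T)" "T (inv T f) = f" "inv T (T f) = f"
proof -
  have blT: "bounded_linear T" and T_scaleC: "\<And>a x. T (scaleC a x) = scaleC a (T x)"
    using T by (auto simp: bounded_clinear_def)
  interpret T: bounded_linear T by fact
  have "bij T"
    by (rule coercive_bij(1)[OF blT assms(2,3)])
  then have inv: "T (inv T f) = f" "inv T (T f) = f" for f
    by (simp_all add: bij_is_inj surj_f_inv_f bij_is_surj)
  then show "T (inv T f) = f" "inv T (T f) = f" by auto
  have inj: "T x = T y \<Longrightarrow> x = y" for x y
    using inv(2) by metis
  have "bounded_linear (inv T)"
  proof (rule bounded_linear_intro[where K = "1 / \<alpha>"])
    show "norm (inv T f) \<le> norm f * (1 / \<alpha>)" for f
      using coercive_bij(2)[OF blT assms(2,3), of "inv T f"] by (simp add: inv)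
  qed (rule inj, simp add: T.add T.scaleR inv)+
  moreover have "inv T (scaleC a x) = scaleC a (inv T x)" for a x
    by (rule inj) (simp add: T_scaleC inv)
  ultimately show "bounded_clinear (inv T)"
    by (simp add: bounded_clinear_def)
qed

text \<open>Cauchy criterion for the net of finite sums: two finite sums over sets containing a
  large \<open>F0\<close> differ by sums over sets disjoint from \<open>F0\<close>, and there the
  tail of g makes the square bound small. This serves synthesis series, which in general do not
  converge absolutely.\<close>

lemma summable_on_if_square_dominated:
  fixes f :: "'a \<Rightarrow> 'b::banach" and g :: "'a \<Rightarrow> real"
  assumes g: "g summable_on A" "\<And>x. x \<in> A \<Longrightarrow> 0 \<le> g x"
    and dom: "\<And>F. finite F \<Longrightarrow> F \<subseteq> A \<Longrightarrow> (norm (sum f F))\<^sup>2 \<le> B * sum g F" and "0 < B"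
  shows "f summable_on A"
proof -
  have "\<exists>P. eventually P (finite_subsets_at_top A) \<and>
          (\<forall>F F'. P F \<and> P F' \<longrightarrow> dist (sum f F) (sum f F') < e)" if "e > 0" for e
  proof -
    define d where "d = (e / 2)\<^sup>2 / B"
    have "0 < d"
      using that \<open>0 < B\<close> by (simp add: d_def)
    obtain F0 where F0: "finite F0" "F0 \<subseteq> A" "dist (sum g F0) (infsum g A) \<le> d / 2"
      using infsum_finite_approximation[OF g(1), of "d / 2"] \<open>0 < d\<close> by auto
    have small: "norm (sum f F) < e / 2" if F: "finite F" "F \<subseteq> A" "F \<inter> F0 = {}" for F
    proof -
      have "sum g F + sum g F0 = sum g (F \<union> F0)"
        using F F0 by (simp add: sum.union_disjoint)
      also have "\<dots> \<le> infsum g A"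
        by (rule finite_sum_le_infsum) (use F F0 g in auto)
      finally have "sum g F < d"
        using F0(3) \<open>0 < d\<close> unfolding dist_real_def by linarith
      then have "B * sum g F < (e / 2)\<^sup>2"
        using \<open>0 < B\<close> by (simp add: d_def field_simps)
      with dom[OF F(1,2)] have "(norm (sum f F))\<^sup>2 < (e / 2)\<^sup>2"
        by linarith
      then show ?thesis
        using \<open>e > 0\<close> by (intro power2_less_imp_less[where x = "norm (sum f F)"]) auto
    qed
    have "dist (sum f F) (sum f F') < e"
      if F: "finite F" "F0 \<subseteq> F" "F \<subseteq> A" and F': "finite F'" "F0 \<subseteq> F'" "F' \<subseteq> A" for F F'
    proof -
      have "sum f F = sum f (F \<inter> F') + sum f (F - F')" "sum f F' = sum f (F \<inter> F') + sum f (F' - F)"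
        using F F' by (metis sum.Int_Diff Int_commute)+
      then have "dist (sum f F) (sum f F') \<le> norm (sum f (F - F')) + norm (sum f (F' - F))"
        by (simp add: dist_norm norm_triangle_ineq4)
      also have "\<dots> < e / 2 + e / 2"
        using F F' by (intro add_strict_mono small) auto
      finally show ?thesis by simp
    qed
    then show ?thesis
      using F0 by (intro exI[of _ "\<lambda>F. finite F \<and> F0 \<subseteq> F \<and> F \<subseteq> A"])
        (auto simp: eventually_finite_subsets_at_top)
  qed
  then have "cauchy_filter (filtermap (sum f) (finite_subsets_at_top A))"
    by (simp add: cauchy_filter_metric_filtermap)
  moreover have "complete (UNIV::'b set)"
    by (meson Cauchy_convergent UNIV_I complete_def convergent_def)
  ultimately obtain L where "(sum f \<longlongrightarrow> L) (finite_subsets_at_top A)"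
    using complete_uniform[where S = UNIV] by (force simp add: filterlim_def)
  then show ?thesis
    by (auto simp: summable_on_def has_sum_def)
qed

section \<open>Frames\<close>

locale hilbert_frame =
  fixes K :: "'i set" and \<psi> :: "'i \<Rightarrow> 'h::complex_hilbert_space"
  assumes is_frame: "is_frame K \<psi>"
begin

text \<open>Not the optimal frame bounds but some valid ones; fixing them makes
  \<open>radius\<close> below a constant of the frame.\<close>

definition lower_bound :: real where
  "lower_bound = (SOME A. 0 < A \<and> (\<forall>f. A * (norm f)\<^sup>2 \<le> (\<Sum>\<^sub>\<infinity>k\<in>K. (cmod (cinner f (\<psi> k)))\<^sup>2)))"

definition upper_bound :: real where
  "upper_bound = (SOME B. 0 < B \<and> (\<forall>f. (\<Sum>\<^sub>\<infinity>k\<in>K. (cmod (cinner f (\<psi> k)))\<^sup>2) \<le> B * (norm f)\<^sup>2))"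

lemma lower_bound:
  shows lower_bound_pos: "0 < lower_bound"
    and "lower_bound * (norm f)\<^sup>2 \<le> (\<Sum>\<^sub>\<infinity>k\<in>K. (cmod (cinner f (\<psi> k)))\<^sup>2)"
proof -
  have "\<exists>A. 0 < A \<and> (\<forall>f. A * (norm f)\<^sup>2 \<le> (\<Sum>\<^sub>\<infinity>k\<in>K. (cmod (cinner f (\<psi> k)))\<^sup>2))"
    using is_frame unfolding is_frame_def by blast
  from someI_ex[OF this, folded lower_bound_def]
  show "0 < lower_bound" "lower_bound * (norm f)\<^sup>2 \<le> (\<Sum>\<^sub>\<infinity>k\<in>K. (cmod (cinner f (\<psi> k)))\<^sup>2)"
    by auto
qed

lemma upper_bound:
  shows upper_bound_pos: "0 < upper_bound"
    and "(\<Sum>\<^sub>\<infinity>k\<in>K. (cmod (cinner f (\<psi> k)))\<^sup>2) \<le> upper_bound * (norm f)\<^sup>2"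
proof -
  have "\<exists>B. 0 < B \<and> (\<forall>f. (\<Sum>\<^sub>\<infinity>k\<in>K. (cmod (cinner f (\<psi> k)))\<^sup>2) \<le> B * (norm f)\<^sup>2)"
    using is_frame unfolding is_frame_def by blast
  from someI_ex[OF this, folded upper_bound_def]
  show "0 < upper_bound" "(\<Sum>\<^sub>\<infinity>k\<in>K. (cmod (cinner f (\<psi> k)))\<^sup>2) \<le> upper_bound * (norm f)\<^sup>2"
    by auto
qed

lemma analysis_summable: "(\<lambda>k. (cmod (cinner f (\<psi> k)))\<^sup>2) summable_on K"
  using is_frame unfolding is_frame_def by blast

text \<open>Duality: the squared norm of the sum g is the sum of c k times the inner product of
  \<psi> k and g. Cauchy-Schwarz over F and the upper frame bound applied to g itself leave one
  factor \<open>norm g\<close> to cancel.\<close>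

lemma norm_synthesis_finite_le:
  assumes "finite F" "F \<subseteq> K"
  shows "(norm (\<Sum>k\<in>F. scaleC (c k) (\<psi> k)))\<^sup>2 \<le> upper_bound * (\<Sum>k\<in>F. (cmod (c k))\<^sup>2)"
proof -
  define g where "g = (\<Sum>k\<in>F. scaleC (c k) (\<psi> k))"
  define s where "s = L2_set (\<lambda>k. cmod (c k)) F"
  have "0 \<le> s"
    unfolding s_def by (rule L2_set_nonneg)
  have "(norm g)\<^sup>2 = cmod (cinner g g)"
    by (simp add: cinner_self norm_power)
  also have "cinner g g = (\<Sum>k\<in>F. c k * cinner (\<psi> k) g)"
    by (simp add: g_def cinner_sum_left cinner_scaleC_left)
  also have "cmod \<dots> \<le> (\<Sum>k\<in>F. \<bar>cmod (c k)\<bar> * \<bar>cmod (cinner (\<psi> k) g)\<bar>)"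
    by (rule sum_norm_le) (simp add: norm_mult)
  also have "\<dots> \<le> s * L2_set (\<lambda>k. cmod (cinner (\<psi> k) g)) F"
    unfolding s_def by (rule L2_set_mult_ineq)
  also have "L2_set (\<lambda>k. cmod (cinner (\<psi> k) g)) F \<le> sqrt (upper_bound * (norm g)\<^sup>2)"
    unfolding L2_set_def
  proof (rule real_sqrt_le_mono)
    have "(\<Sum>k\<in>F. (cmod (cinner (\<psi> k) g))\<^sup>2) = (\<Sum>k\<in>F. (cmod (cinner g (\<psi> k)))\<^sup>2)"
      by (subst cinner_commute) simp
    also have "\<dots> \<le> (\<Sum>\<^sub>\<infinity>k\<in>K. (cmod (cinner g (\<psi> k)))\<^sup>2)"
      by (rule finite_sum_le_infsum[OF analysis_summable]) (use assms in auto)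
    also have "\<dots> \<le> upper_bound * (norm g)\<^sup>2"
      by (rule upper_bound)
    finally show "(\<Sum>k\<in>F. (cmod (cinner (\<psi> k) g))\<^sup>2) \<le> upper_bound * (norm g)\<^sup>2" .
  qed
  also have "sqrt (upper_bound * (norm g)\<^sup>2) = sqrt upper_bound * norm g"
    by (simp add: real_sqrt_mult)
  finally have *: "norm g * norm g \<le> (s * sqrt upper_bound) * norm g"
    using \<open>0 \<le> s\<close> by (simp add: power2_eq_square mult_left_mono mult.assoc)
  have "norm g \<le> s * sqrt upper_bound"
  proof (cases "g = 0")
    case True
    then show ?thesis
      using \<open>0 \<le> s\<close> upper_bound_pos by simp
  next
    case False
    with * show ?thesis by simp
  qed
  then have "(norm g)\<^sup>2 \<le> (s * sqrt upper_bound)\<^sup>2"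
    by (rule power_mono) simp
  also have "\<dots> = upper_bound * (\<Sum>k\<in>F. (cmod (c k))\<^sup>2)"
    using upper_bound_pos
    by (simp add: power_mult_distrib s_def L2_set_def sum_nonneg mult.commute)
  finally show ?thesis
    by (simp add: g_def)
qed

lemma has_sum_synthesis:
  assumes "(\<lambda>k. (cmod (c k))\<^sup>2) summable_on K"
  shows "((\<lambda>k. scaleC (c k) (\<psi> k)) has_sum synthesis_op K \<psi> c) K"
  unfolding synthesis_op_def
  by (rule has_sum_infsum,
      rule summable_on_if_square_dominated[OF assms _ norm_synthesis_finite_le upper_bound_pos]) auto

lemma norm_synthesis_le:
  assumes c: "(\<lambda>k. (cmod (c k))\<^sup>2) summable_on K"
  shows "(norm (synthesis_op K \<psi> c))\<^sup>2 \<le> upper_bound * (\<Sum>\<^sub>\<infinity>k\<in>K. (cmod (c k))\<^sup>2)"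
proof (rule tendsto_le)
  show "((\<lambda>F. upper_bound * (\<Sum>k\<in>F. (cmod (c k))\<^sup>2)) \<longlongrightarrow> upper_bound * (\<Sum>\<^sub>\<infinity>k\<in>K. (cmod (c k))\<^sup>2))
      (finite_subsets_at_top K)"
    using has_sum_infsum[OF c] unfolding has_sum_def by (intro tendsto_intros)
  show "((\<lambda>F. (norm (\<Sum>k\<in>F. scaleC (c k) (\<psi> k)))\<^sup>2) \<longlongrightarrow> (norm (synthesis_op K \<psi> c))\<^sup>2)
      (finite_subsets_at_top K)"
    using has_sum_synthesis[OF c] unfolding has_sum_def by (intro tendsto_intros)
  show "\<forall>\<^sub>F F in finite_subsets_at_top K.
      (norm (\<Sum>k\<in>F. scaleC (c k) (\<psi> k)))\<^sup>2 \<le> upper_bound * (\<Sum>k\<in>F. (cmod (c k))\<^sup>2)"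
    by (rule eventually_finite_subsets_at_top_weakI) (rule norm_synthesis_finite_le)
qed simp

section \<open>The frame operator and its inverse\<close>

abbreviation S where "S \<equiv> frame_op K \<psi>"

abbreviation R where "R \<equiv> inv (frame_op K \<psi>)"

lemma has_sum_S: "((\<lambda>k. scaleC (cinner f (\<psi> k)) (\<psi> k)) has_sum S f) K"
proof -
  have "(\<lambda>k. (cmod (analysis_op K \<psi> f k))\<^sup>2) summable_on K"
    using analysis_summable[of f] by (rule summable_on_cong[THEN iffD1, rotated]) (simp add: analysis_op_def)
  from has_sum_synthesis[OF this] show ?thesis
    unfolding frame_op_def o_apply by (rule has_sum_cong[THEN iffD1, rotated]) (simp add: analysis_op_def)
qed

lemma S_eqI: "((\<lambda>k. scaleC (cinner f (\<psi> k)) (\<psi> k)) has_sum g) K \<Longrightarrow> S f = g"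
  using has_sum_S has_sum_unique by blast

lemma norm_S_le: "norm (S f) \<le> upper_bound * norm f"
proof -
  have *: "(\<lambda>k. (cmod (analysis_op K \<psi> f k))\<^sup>2) summable_on K"
    using analysis_summable[of f] by (rule summable_on_cong[THEN iffD1, rotated]) (simp add: analysis_op_def)
  have "(norm (S f))\<^sup>2 \<le> upper_bound * (\<Sum>\<^sub>\<infinity>k\<in>K. (cmod (cinner f (\<psi> k)))\<^sup>2)"
    unfolding frame_op_def o_apply
    using norm_synthesis_le[OF *] by (simp add: analysis_op_def cong: infsum_cong)
  also have "\<dots> \<le> upper_bound * (upper_bound * (norm f)\<^sup>2)"
    using upper_bound upper_bound_pos by (intro mult_left_mono) auto
  also have "\<dots> = (upper_bound * norm f)\<^sup>2"
    by (simp add: power2_eq_square)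
  finally show ?thesis
    by (rule power2_le_imp_le) (use upper_bound_pos in simp)
qed

lemma S_scaleC: "S (scaleC a f) = scaleC a (S f)"
  using has_sum_bounded_linear[OF bounded_linear_scaleC has_sum_S[of f], of a]
  by (intro S_eqI) (simp add: cinner_scaleC_left scaleC_scaleC)

lemma bounded_clinear_S: "bounded_clinear S"
proof -
  have "bounded_linear S"
  proof (rule bounded_linear_intro[where K = upper_bound])
    show "S (f + g) = S f + S g" for f g
      using has_sum_add[OF has_sum_S[of f] has_sum_S[of g]]
      by (intro S_eqI) (simp add: cinner_add_left scaleC_add_left)
    show "S (r *\<^sub>R f) = r *\<^sub>R S f" for r f
      using S_scaleC[of "of_real r" f] by (simp add: scaleC_of_real)
    show "norm (S f) \<le> norm f * upper_bound" for f
      using norm_S_le[of f] by (simp add: mult.commute)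
  qed
  then show ?thesis
    by (simp add: bounded_clinear_def S_scaleC)
qed

lemma has_sum_cinner_S: "((\<lambda>k. cinner f (\<psi> k) * cinner (\<psi> k) g) has_sum cinner (S f) g) K"
  using has_sum_bounded_linear[OF bounded_linear_cinner_left has_sum_S[of f], of g]
  by (simp add: cinner_scaleC_left)

lemma cinner_S_commute: "cinner (S f) g = cinner f (S g)"
proof -
  have "((\<lambda>k. cinner (\<psi> k) g * cinner f (\<psi> k)) has_sum cinner f (S g)) K"
    using has_sum_bounded_linear[OF bounded_linear_cinner_right has_sum_S[of g], of f]
    by (simp add: cinner_scaleC_right cinner_commute[symmetric])
  then show ?thesis
    using has_sum_cinner_S[of f g] by (simp add: mult.commute has_sum_unique)
qed

text \<open>The quadratic form of \<open>S\<close> is the frame sum, so the lower frame bound is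
  precisely the coercivity that makes \<open>S\<close> invertible.\<close>

lemma coercive_S: "lower_bound * (norm f)\<^sup>2 \<le> Re (cinner (S f) f)"
proof -
  have "cinner f (\<psi> k) * cinner (\<psi> k) f = of_real ((cmod (cinner f (\<psi> k)))\<^sup>2)" for k
    by (metis cinner_commute complex_norm_square)
  then have "((\<lambda>k. of_real ((cmod (cinner f (\<psi> k)))\<^sup>2)) has_sum cinner (S f) f) K"
    using has_sum_cinner_S[of f f] by (simp only:)
  from has_sum_bounded_linear[OF bounded_linear_Re this]
  have "((\<lambda>k. (cmod (cinner f (\<psi> k)))\<^sup>2) has_sum Re (cinner (S f) f)) K"
    by simp
  then have "(\<Sum>\<^sub>\<infinity>k\<in>K. (cmod (cinner f (\<psi> k)))\<^sup>2) = Re (cinner (S f) f)"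
    by (rule infsumI)
  with lower_bound(2)[of f] show ?thesis by simp
qed

lemmas bounded_clinear_R = coercive_inv(1)[OF bounded_clinear_S lower_bound_pos coercive_S]
lemmas S_R [simp] = coercive_inv(2)[OF bounded_clinear_S lower_bound_pos coercive_S]
lemmas R_S [simp] = coercive_inv(3)[OF bounded_clinear_S lower_bound_pos coercive_S]

lemma R_scaleC: "R (scaleC a f) = scaleC a (R f)"
  using bounded_clinear_R by (simp add: bounded_clinear_def)

lemma cinner_R_commute: "cinner (R f) g = cinner f (R g)"
  using cinner_S_commute[of "R f" "R g"] by simp

lemma dual_frame_eq: "dual_frame K \<psi> k = R (\<psi> k)"
  by (simp add: dual_frame_def)

lemma cinner_dual: "cinner f (dual_frame K \<psi> k) = cinner (R f) (\<psi> k)"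
  by (simp add: dual_frame_eq cinner_R_commute)

text \<open>The first of the two reproducing formulas in weak form. It is the series of
  \<open>S\<close> at R f; the next one is the series of \<open>S\<close> tested against R g, with
  \<open>S\<close> moved across the inner product. Every cancellation of a frame against its dual
  rests on these two.\<close>

lemma has_sum_cinner_dual_left:
  "((\<lambda>k. cinner f (dual_frame K \<psi> k) * cinner (\<psi> k) g) has_sum cinner f g) K"
  using has_sum_cinner_S[of "R f" g] by (simp add: cinner_dual)

lemma has_sum_cinner_dual_right:
  "((\<lambda>k. cinner f (\<psi> k) * cinner (dual_frame K \<psi> k) g) has_sum cinner f g) K"
  using has_sum_cinner_S[of f "R g"] by (simp add: dual_frame_eq cinner_R_commute cinner_S_commute)

end

section \<open>Weighted sequence spaces\<close>

definition trunc :: "'i set \<Rightarrow> ('i \<Rightarrow> complex) \<Rightarrow> 'i \<Rightarrow> complex" where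
  "trunc J c = (\<lambda>k. if k \<in> J then c k else 0)"

text \<open>Convexity of the power at a + b = t (a / t) + (1 - t) (b / (1 - t)). Leaving t free
  allows it to be chosen later as a ratio of norms, which turns this termwise bound into Minkowski's
  inequality.\<close>

lemma powr_add_le_weighted:
  fixes a b t r :: real
  assumes "0 \<le> a" "0 \<le> b" "0 < t" "t < 1" "1 \<le> r"
  shows "(a + b) powr r \<le> t powr (1 - r) * a powr r + (1 - t) powr (1 - r) * b powr r"
proof -
  consider "a = 0" | "b = 0" | "0 < a" "0 < b"
    using assms by linarith
  then show ?thesis
  proof cases
    case 1
    have "1 \<le> (1 - t) powr (1 - r)"
      using assms powr_mono'[of "1 - r" 0 "1 - t"] by simp
    then show ?thesis
      using 1 mult_right_mono[of 1 "(1 - t) powr (1 - r)" "b powr r"] by simp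
  next
    case 2
    have "1 \<le> t powr (1 - r)"
      using assms powr_mono'[of "1 - r" 0 t] by simp
    then show ?thesis
      using 2 mult_right_mono[of 1 "t powr (1 - r)" "a powr r"] by simp
  next
    case 3
    have "(t *\<^sub>R (a / t) + (1 - t) *\<^sub>R (b / (1 - t))) powr r
        \<le> t * (a / t) powr r + (1 - t) * (b / (1 - t)) powr r"
      using convex_onD[OF powr_convex[OF assms(5)], of "1 - t" "a / t" "b / (1 - t)"] assms 3
      by (simp only: diff_diff_eq2 diff_add_cancel add_diff_cancel_left' greaterThan_iff
          divide_pos_pos diff_gt_0_iff_gt diff_ge_0_iff_ge less_imp_le diff_le_eq le_add_same_cancel1)
    moreover have "s * (x / s) powr r = s powr (1 - r) * x powr r" if "0 < s" "0 < x" for s x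
      using that by (simp add: powr_divide powr_diff)
    ultimately show ?thesis
      using 3 assms by simp
  qed
qed

lemma linf_space_iff:
  "c \<in> linf_space K w \<longleftrightarrow> (\<forall>k. k \<notin> K \<longrightarrow> c k = 0) \<and> (\<exists>B. \<forall>k\<in>K. w k * cmod (c k) \<le> B)"
  by (auto simp: linf_space_def bdd_above_def)

locale weighted_lp =
  fixes K :: "'i set" and w :: "'i \<Rightarrow> real" and p :: ennreal
  assumes weight_pos: "k \<in> K \<Longrightarrow> 0 < w k"
    and exponent: "p = 0 \<or> 1 \<le> p"
begin

abbreviation \<L> where "\<L> \<equiv> lp_space K p w"

abbreviation N where "N \<equiv> lp_norm K p w"

abbreviation r where "r \<equiv> enn2real p"

lemma exponent_cases [case_names zero infinity finite]:
  assumes "p = 0 \<Longrightarrow> thesis" "p = \<infinity> \<Longrightarrow> thesis"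
    and "p \<noteq> 0 \<Longrightarrow> p \<noteq> \<infinity> \<Longrightarrow> 1 \<le> r \<Longrightarrow> thesis"
  shows thesis
proof (cases "p = 0 \<or> p = \<infinity>")
  case False
  then have "1 \<le> r"
    using exponent enn2real_mono[of 1 p] by (auto simp: less_top)
  with False assms show ?thesis by blast
qed (use assms in blast)

lemma weight_nonneg: "k \<in> K \<Longrightarrow> 0 \<le> w k"
  using weight_pos less_imp_le by blast

lemma weighted_nonneg: "k \<in> K \<Longrightarrow> 0 \<le> w k * cmod (c k)"
  using weight_nonneg by simp

lemma norm_sup: "p = 0 \<or> p = \<infinity> \<Longrightarrow> N c = Sup (insert 0 ((\<lambda>k. w k * cmod (c k)) ` K))"
  by (auto simp: lp_norm_def)

lemma norm_fin:
  "p \<noteq> 0 \<Longrightarrow> p \<noteq> \<infinity> \<Longrightarrow> N c = (\<Sum>\<^sub>\<infinity>k\<in>K. (w k * cmod (c k)) powr r) powr (1 / r)"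
  by (auto simp: lp_norm_def)

lemma mem_fin:
  "p \<noteq> 0 \<Longrightarrow> p \<noteq> \<infinity> \<Longrightarrow> c \<in> \<L> \<longleftrightarrow>
    (\<forall>k. k \<notin> K \<longrightarrow> c k = 0) \<and> (\<lambda>k. (w k * cmod (c k)) powr r) summable_on K"
  by (auto simp: lp_space_def)

lemma mem_infinity: "p = \<infinity> \<Longrightarrow> \<L> = linf_space K w"
  by (auto simp: lp_space_def)

text \<open>The closure of the finite sequences consists of the sequences whose weighted entries
  vanish at infinity. This intrinsic form replaces approximants by finiteness of level sets in all
  later proofs.\<close>

lemma mem_zero_iff:
  assumes "p = 0"
  shows "c \<in> \<L> \<longleftrightarrow> (\<forall>k. k \<notin> K \<longrightarrow> c k = 0) \<and> (\<forall>\<epsilon>>0. finite {k \<in> K. \<epsilon> \<le> w k * cmod (c k)})"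
proof -
  have eq: "\<L> = {c \<in> linf_space K w. \<forall>\<epsilon>>0. \<exists>d\<in>fin_seqs K. lp_norm K \<infinity> w (\<lambda>k. c k - d k) < \<epsilon>}"
    unfolding lp_space_def using assms by simp
  show ?thesis
  proof
    assume c: "c \<in> \<L>"
    have "finite {k \<in> K. \<epsilon> \<le> w k * cmod (c k)}" if "0 < \<epsilon>" for \<epsilon>
    proof -
      obtain e where e: "e \<in> fin_seqs K" "lp_norm K \<infinity> w (\<lambda>k. c k - e k) < \<epsilon>"
        using c \<open>0 < \<epsilon>\<close> unfolding eq by blast
      have fin: "finite {k. e k \<noteq> 0}"
        using e by (simp add: fin_seqs_def)
      have "bdd_above ((\<lambda>k. w k * cmod (c k)) ` K)"
        using c unfolding eq by (simp add: linf_space_def)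
      \<comment> \<open>The supremum is meaningful only for a bounded set: off the finite support of
        \<open>e\<close> the difference is c, and on it there are finitely many values.\<close>
      then have "bdd_above ((\<lambda>k. w k * cmod (c k - e k)) ` {k. e k \<noteq> 0} \<union> (\<lambda>k. w k * cmod (c k)) ` K)"
        using fin by (simp add: bdd_above_Un)
      then have bdd: "bdd_above (insert 0 ((\<lambda>k. w k * cmod (c k - e k)) ` K))"
        unfolding bdd_above_insert by (rule bdd_above_mono) force
      have "e k \<noteq> 0" if "k \<in> K" "\<epsilon> \<le> w k * cmod (c k)" for k
      proof
        assume "e k = 0"
        have "w k * cmod (c k - e k) \<le> lp_norm K \<infinity> w (\<lambda>k. c k - e k)"
          unfolding lp_norm_def using bdd that by (auto intro!: cSup_upper)
        with \<open>e k = 0\<close> that e(2) show False by simp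
      qed
      then show ?thesis
        by (auto intro: finite_subset[OF _ fin])
    qed
    then show "(\<forall>k. k \<notin> K \<longrightarrow> c k = 0) \<and> (\<forall>\<epsilon>>0. finite {k \<in> K. \<epsilon> \<le> w k * cmod (c k)})"
      using c unfolding eq linf_space_def by blast
  next
    assume c: "(\<forall>k. k \<notin> K \<longrightarrow> c k = 0) \<and> (\<forall>\<epsilon>>0. finite {k \<in> K. \<epsilon> \<le> w k * cmod (c k)})"
    let ?J = "\<lambda>\<epsilon>. {k \<in> K. \<epsilon> \<le> w k * cmod (c k)}"
    have "bdd_above ((\<lambda>k. w k * cmod (c k)) ` ?J 1 \<union> {..1})"
      using c by (simp add: bdd_above_Un)
    then have "bdd_above ((\<lambda>k. w k * cmod (c k)) ` K)"
      by (rule bdd_above_mono) force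
    moreover have "\<exists>d\<in>fin_seqs K. lp_norm K \<infinity> w (\<lambda>k. c k - d k) < \<epsilon>" if "0 < \<epsilon>" for \<epsilon>
    proof (rule bexI)
      have "finite (?J (\<epsilon> / 2))"
        using c half_gt_zero[OF that] by blast
      then have "finite {k. trunc (?J (\<epsilon> / 2)) c k \<noteq> 0}"
        by (rule finite_subset[rotated]) (auto simp: trunc_def)
      then show "trunc (?J (\<epsilon> / 2)) c \<in> fin_seqs K"
        by (auto simp: fin_seqs_def trunc_def)
      have sup: "lp_norm K \<infinity> w d = Sup (insert 0 ((\<lambda>k. w k * cmod (d k)) ` K))" for d
        by (simp add: lp_norm_def)
      have "lp_norm K \<infinity> w (\<lambda>k. c k - trunc (?J (\<epsilon> / 2)) c k) \<le> \<epsilon> / 2"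
        unfolding sup by (rule cSup_least) (use that in \<open>auto simp: trunc_def\<close>)
      then show "lp_norm K \<infinity> w (\<lambda>k. c k - trunc (?J (\<epsilon> / 2)) c k) < \<epsilon>"
        using that by simp
    qed
    ultimately show "c \<in> \<L>"
      using c unfolding eq linf_space_def by blast
  qed
qed

lemma mem_zero_imp_linf:
  assumes "p = 0" "c \<in> \<L>"
  shows "c \<in> linf_space K w"
proof -
  have "\<L> \<subseteq> linf_space K w"
    unfolding lp_space_def using assms(1) by auto
  with assms(2) show ?thesis by blast
qed

lemma zero_outside: "c \<in> \<L> \<Longrightarrow> k \<notin> K \<Longrightarrow> c k = 0"
  by (rule exponent_cases) (auto simp: lp_space_def linf_space_def)

lemma norm_fin_powr:
  assumes "p \<noteq> 0" "p \<noteq> \<infinity>" "1 \<le> r"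
  shows "N c powr r = (\<Sum>\<^sub>\<infinity>k\<in>K. (w k * cmod (c k)) powr r)"
  using assms by (simp add: norm_fin powr_powr infsum_nonneg)

lemma linf_bdd:
  assumes "p = 0 \<or> p = \<infinity>" "c \<in> \<L>"
  shows "bdd_above (insert 0 ((\<lambda>k. w k * cmod (c k)) ` K))"
  using assms mem_infinity mem_zero_imp_linf unfolding linf_space_def by auto

lemma weighted_le_norm:
  assumes "c \<in> \<L>" "k \<in> K"
  shows "w k * cmod (c k) \<le> N c"
proof (rule exponent_cases)
  assume p: "p \<noteq> 0" "p \<noteq> \<infinity>" "1 \<le> r"
  have "(w k * cmod (c k)) powr r = (\<Sum>i\<in>{k}. (w i * cmod (c i)) powr r)"
    by simp
  also have "\<dots> \<le> N c powr r"
    unfolding norm_fin_powr[OF p]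
    by (rule finite_sum_le_infsum) (use assms mem_fin p in auto)
  finally have le: "(w k * cmod (c k)) powr r \<le> N c powr r" .
  have "0 \<le> N c"
    unfolding norm_fin[OF p(1,2)] by simp
  show ?thesis
  proof (rule ccontr)
    assume "\<not> ?thesis"
    then have "N c powr r < (w k * cmod (c k)) powr r"
      using \<open>0 \<le> N c\<close> p by (intro powr_less_mono2) auto
    with le show False by simp
  qed
next
  assume p: "p = 0"
  show ?thesis
    unfolding norm_sup[OF disjI1[OF p]] using assms linf_bdd[OF disjI1[OF p] assms(1)]
    by (intro cSup_upper) auto
next
  assume p: "p = \<infinity>"
  show ?thesis
    unfolding norm_sup[OF disjI2[OF p]] using assms linf_bdd[OF disjI2[OF p] assms(1)]
    by (intro cSup_upper) auto
qed

lemma norm_nonneg: "c \<in> \<L> \<Longrightarrow> 0 \<le> N c"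
  by (cases "p = 0 \<or> p = \<infinity>")
    (simp_all only: norm_sup norm_fin de_Morgan_disj not_False_eq_True powr_ge_zero
      cSup_upper linf_bdd insertI1)

lemma norm_le_sup:
  assumes "p = 0 \<or> p = \<infinity>" "\<And>k. k \<in> K \<Longrightarrow> w k * cmod (c k) \<le> B" "0 \<le> B"
  shows "N c \<le> B"
  unfolding norm_sup[OF assms(1)] by (rule cSup_least) (use assms in auto)

lemma mem_solid:
  assumes c: "c \<in> \<L>" and d: "\<And>k. k \<notin> K \<Longrightarrow> d k = 0" "\<And>k. k \<in> K \<Longrightarrow> cmod (d k) \<le> cmod (c k)"
  shows "d \<in> \<L>" "N d \<le> N c"
proof -
  have le: "w k * cmod (d k) \<le> w k * cmod (c k)" if "k \<in> K" for k
    using that d weight_nonneg by (intro mult_left_mono) auto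
  have linf: "c \<in> linf_space K w \<Longrightarrow> d \<in> linf_space K w"
  proof -
    assume "c \<in> linf_space K w"
    then obtain B where "\<And>k. k \<in> K \<Longrightarrow> w k * cmod (c k) \<le> B"
      unfolding linf_space_iff by auto
    then have "\<And>k. k \<in> K \<Longrightarrow> w k * cmod (d k) \<le> B"
      using le order_trans by blast
    then show "d \<in> linf_space K w"
      unfolding linf_space_iff using d(1) by auto
  qed
  have "d \<in> \<L> \<and> N d \<le> N c"
  proof (rule exponent_cases)
    assume p: "p = \<infinity>"
    have "N d \<le> N c"
      by (rule norm_le_sup) (use p weighted_le_norm[OF c] norm_nonneg[OF c] in \<open>auto intro: order_trans[OF le]\<close>)
    then show ?thesis
      using c linf mem_infinity[OF p] by blast
  next
    assume p: "p = 0"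
    have "finite {k \<in> K. \<epsilon> \<le> w k * cmod (d k)}" if "0 < \<epsilon>" for \<epsilon>
    proof (rule finite_subset)
      show "{k \<in> K. \<epsilon> \<le> w k * cmod (d k)} \<subseteq> {k \<in> K. \<epsilon> \<le> w k * cmod (c k)}"
        using le by force
      show "finite {k \<in> K. \<epsilon> \<le> w k * cmod (c k)}"
        using c that unfolding mem_zero_iff[OF p] by blast
    qed
    then have "d \<in> \<L>"
      using d(1) unfolding mem_zero_iff[OF p] by blast
    moreover have "N d \<le> N c"
      by (rule norm_le_sup) (use p weighted_le_norm[OF c] norm_nonneg[OF c] in \<open>auto intro: order_trans[OF le]\<close>)
    ultimately show ?thesis ..
  next
    assume p: "p \<noteq> 0" "p \<noteq> \<infinity>" "1 \<le> r"
    have le': "(w k * cmod (d k)) powr r \<le> (w k * cmod (c k)) powr r" if "k \<in> K" for k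
      using le[OF that] weighted_nonneg[OF that] p by (intro powr_mono2) auto
    have sum: "(\<lambda>k. (w k * cmod (c k)) powr r) summable_on K"
      using c mem_fin p by blast
    have sum': "(\<lambda>k. (w k * cmod (d k)) powr r) summable_on K"
      by (rule summable_on_comparison_test[OF sum]) (use le' in auto)
    then have "d \<in> \<L>"
      using mem_fin p d(1) by auto
    moreover have "N d \<le> N c"
      unfolding norm_fin[OF p(1,2)]
      using p by (intro powr_mono2 infsum_mono[OF sum' sum] le' infsum_nonneg) auto
    ultimately show ?thesis ..
  qed
  then show "d \<in> \<L>" "N d \<le> N c" by auto
qed

lemma mem_fin_seqs:
  assumes "c \<in> fin_seqs K"
  shows "c \<in> \<L>"
proof -
  have fin: "finite {k. c k \<noteq> 0}" "{k. c k \<noteq> 0} \<subseteq> K"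
    using assms by (auto simp: fin_seqs_def)
  have linf: "c \<in> linf_space K w"
  proof -
    have "bdd_above ((\<lambda>k. w k * cmod (c k)) ` K)"
    proof (rule bdd_aboveI2)
      fix k assume k: "k \<in> K"
      show "w k * cmod (c k) \<le> (\<Sum>i | c i \<noteq> 0. w i * cmod (c i))"
      proof (cases "c k = 0")
        case False
        then show ?thesis
          using fin weight_nonneg by (intro member_le_sum) auto
      qed (use fin weight_nonneg in \<open>auto intro!: sum_nonneg\<close>)
    qed
    then show ?thesis
      using fin by (auto simp: linf_space_def)
  qed
  show ?thesis
  proof (rule exponent_cases)
    assume p: "p = 0"
    have "{k \<in> K. \<epsilon> \<le> w k * cmod (c k)} \<subseteq> {k. c k \<noteq> 0}" if "0 < \<epsilon>" for \<epsilon>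
      using that by auto
    then show ?thesis
      using fin finite_subset unfolding mem_zero_iff[OF p] by blast
  next
    assume p: "p \<noteq> 0" "p \<noteq> \<infinity>" "1 \<le> r"
    have "(\<lambda>k. (w k * cmod (c k)) powr r) summable_on K"
      by (rule finite_nonzero_values_imp_summable_on)
        (use p in \<open>auto intro!: finite_subset[OF _ fin(1)]\<close>)
    then show ?thesis
      using p fin mem_fin by auto
  qed (use linf mem_infinity in blast)
qed

lemma mem_zero: "(\<lambda>k. 0) \<in> \<L>"
  by (rule mem_fin_seqs) (simp add: fin_seqs_def)

lemma norm_zero: "N (\<lambda>k. 0) = 0"
proof (cases "p = 0 \<or> p = \<infinity>")
  case True
  have "insert 0 ((\<lambda>k. w k * cmod 0) ` K) = {0}"
    by auto
  then show ?thesis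
    unfolding norm_sup[OF True] by (simp only: cSup_singleton)
qed (simp add: norm_fin)

lemma norm_eq_0D: "c \<in> \<L> \<Longrightarrow> N c = 0 \<Longrightarrow> c = (\<lambda>k. 0)"
proof
  fix k assume "c \<in> \<L>" "N c = 0"
  then show "c k = 0"
    using weighted_le_norm[of c k] weight_pos[of k] zero_outside[of c k]
    by (cases "k \<in> K") (auto simp: mult_le_0_iff)
qed

lemma mem_scale_norm:
  assumes "c \<in> \<L>"
  shows mem_scale: "(\<lambda>k. a * c k) \<in> \<L>" and norm_scale: "N (\<lambda>k. a * c k) = cmod a * N c"
proof -
  have out: "\<And>k. k \<notin> K \<Longrightarrow> a * c k = 0"
    using zero_outside assms by auto
  have eq: "w k * cmod (a * c k) = cmod a * (w k * cmod (c k))" for k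
    by (simp add: norm_mult)
  have linf: "(\<lambda>k. a * c k) \<in> linf_space K w" if "c \<in> linf_space K w"
  proof -
    obtain B where "\<And>k. k \<in> K \<Longrightarrow> w k * cmod (c k) \<le> B"
      using \<open>c \<in> linf_space K w\<close> unfolding linf_space_iff by auto
    then have "\<And>k. k \<in> K \<Longrightarrow> w k * cmod (a * c k) \<le> cmod a * B"
      unfolding eq by (intro mult_left_mono) auto
    then show ?thesis
      unfolding linf_space_iff using out by auto
  qed
  have fin_eq: "(\<lambda>k. (w k * cmod (a * c k)) powr r) summable_on K"
      "N (\<lambda>k. a * c k) = cmod a * N c"
    if p: "p \<noteq> 0" "p \<noteq> \<infinity>" "1 \<le> r"
  proof -
    have pw: "(w k * cmod (a * c k)) powr r = cmod a powr r * (w k * cmod (c k)) powr r"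
      if "k \<in> K" for k
      unfolding eq using weight_nonneg[OF that] by (simp add: powr_mult)
    have c': "(\<lambda>k. (w k * cmod (c k)) powr r) summable_on K"
      using assms p mem_fin by blast
    show "(\<lambda>k. (w k * cmod (a * c k)) powr r) summable_on K"
      using summable_on_cmult_right[OF c'] pw by (simp cong: summable_on_cong)
    have "(\<Sum>\<^sub>\<infinity>k\<in>K. (w k * cmod (a * c k)) powr r) = cmod a powr r * (\<Sum>\<^sub>\<infinity>k\<in>K. (w k * cmod (c k)) powr r)"
      using pw by (simp add: infsum_cmult_right' cong: infsum_cong)
    then show "N (\<lambda>k. a * c k) = cmod a * N c"
      unfolding norm_fin[OF p(1,2)] using p by (simp add: powr_mult powr_powr infsum_nonneg)
  qed
  show mem: "(\<lambda>k. a * c k) \<in> \<L>"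
  proof (rule exponent_cases)
    assume p: "p = 0"
    have "finite {k \<in> K. \<epsilon> \<le> w k * cmod (a * c k)}" if "0 < \<epsilon>" for \<epsilon>
    proof (cases "a = 0")
      case False
      then have "{k \<in> K. \<epsilon> \<le> w k * cmod (a * c k)} = {k \<in> K. \<epsilon> / cmod a \<le> w k * cmod (c k)}"
        unfolding eq by (auto simp: field_simps)
      then show ?thesis
        using assms \<open>0 < \<epsilon>\<close> False unfolding mem_zero_iff[OF p] by simp
    qed (use that in simp)
    then show ?thesis
      using out unfolding mem_zero_iff[OF p] by blast
  next
    assume "p = \<infinity>"
    then show ?thesis
      using linf assms mem_infinity by blast
  next
    assume p: "p \<noteq> 0" "p \<noteq> \<infinity>" "1 \<le> r"
    then show ?thesis
      using fin_eq(1) out mem_fin by blast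
  qed
  show "N (\<lambda>k. a * c k) = cmod a * N c"
  proof (cases "p = 0 \<or> p = \<infinity>")
    case True
    show ?thesis
    proof (rule antisym)
      show "N (\<lambda>k. a * c k) \<le> cmod a * N c"
        by (rule norm_le_sup[OF True])
          (auto simp: eq assms norm_nonneg weighted_le_norm intro!: mult_left_mono)
      show "cmod a * N c \<le> N (\<lambda>k. a * c k)"
      proof (cases "a = 0")
        case False
        have "N c \<le> N (\<lambda>k. a * c k) / cmod a"
          by (rule norm_le_sup[OF True])
            (use False weighted_le_norm[OF mem] norm_nonneg[OF mem] in \<open>auto simp: eq field_simps\<close>)
        then show ?thesis
          using False by (simp add: field_simps)
      qed (use norm_nonneg[OF mem] in auto)
    qed
  qed (use fin_eq(2) in \<open>metis exponent_cases\<close>)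
qed

lemma mem_add_norm:
  assumes c: "c \<in> \<L>" and d: "d \<in> \<L>"
  shows mem_add: "(\<lambda>k. c k + d k) \<in> \<L>" and norm_triangle: "N (\<lambda>k. c k + d k) \<le> N c + N d"
proof -
  have out: "c k + d k = 0" if "k \<notin> K" for k
    using zero_outside[OF c that] zero_outside[OF d that] by simp
  have le: "w k * cmod (c k + d k) \<le> w k * cmod (c k) + w k * cmod (d k)" if "k \<in> K" for k
    using weight_nonneg[OF that] norm_triangle_ineq[of "c k" "d k"]
    by (metis distrib_left mult_left_mono)
  have sup: "w k * cmod (c k + d k) \<le> N c + N d" if "k \<in> K" for k
    using le[OF that] weighted_le_norm[OF c that] weighted_le_norm[OF d that] by linarith
  then have linf: "(\<lambda>k. c k + d k) \<in> linf_space K w"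
    unfolding linf_space_iff using out by auto
  have "(\<lambda>k. c k + d k) \<in> \<L> \<and> N (\<lambda>k. c k + d k) \<le> N c + N d"
  proof (rule exponent_cases)
    assume p: "p = \<infinity>"
    have "N (\<lambda>k. c k + d k) \<le> N c + N d"
      by (rule norm_le_sup) (use p sup norm_nonneg[OF c] norm_nonneg[OF d] in auto)
    then show ?thesis
      using linf mem_infinity[OF p] by blast
  next
    assume p: "p = 0"
    have "finite {k \<in> K. \<epsilon> \<le> w k * cmod (c k + d k)}" if "0 < \<epsilon>" for \<epsilon>
    proof -
      have "{k \<in> K. \<epsilon> \<le> w k * cmod (c k + d k)} \<subseteq>
          {k \<in> K. \<epsilon> / 2 \<le> w k * cmod (c k)} \<union> {k \<in> K. \<epsilon> / 2 \<le> w k * cmod (d k)}"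
        using le by force
      moreover have "0 < \<epsilon> / 2"
        using that by simp
      ultimately show ?thesis
        using c d finite_subset finite_UnI unfolding mem_zero_iff[OF p] by blast
    qed
    then have "(\<lambda>k. c k + d k) \<in> \<L>"
      using out unfolding mem_zero_iff[OF p] by blast
    moreover have "N (\<lambda>k. c k + d k) \<le> N c + N d"
      by (rule norm_le_sup) (use p sup norm_nonneg[OF c] norm_nonneg[OF d] in auto)
    ultimately show ?thesis ..
  next
    assume p: "p \<noteq> 0" "p \<noteq> \<infinity>" "1 \<le> r"
    have sc: "(\<lambda>k. (w k * cmod (c k)) powr r) summable_on K"
      and sd: "(\<lambda>k. (w k * cmod (d k)) powr r) summable_on K"
      using c d mem_fin p by blast+
    have bound: "(w k * cmod (c k + d k)) powr r \<le>
        t powr (1 - r) * (w k * cmod (c k)) powr r + (1 - t) powr (1 - r) * (w k * cmod (d k)) powr r"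
      if "k \<in> K" "0 < t" "t < 1" for k t
    proof -
      have "(w k * cmod (c k + d k)) powr r \<le> (w k * cmod (c k) + w k * cmod (d k)) powr r"
        using le[OF that(1)] weighted_nonneg[OF that(1)] p by (intro powr_mono2) auto
      also have "\<dots> \<le> t powr (1 - r) * (w k * cmod (c k)) powr r + (1 - t) powr (1 - r) * (w k * cmod (d k)) powr r"
        using weighted_nonneg[OF that(1)] that p by (intro powr_add_le_weighted) auto
      finally show ?thesis .
    qed
    have rhs: "(\<lambda>k. t powr (1 - r) * (w k * cmod (c k)) powr r + (1 - t) powr (1 - r) * (w k * cmod (d k)) powr r)
        summable_on K" for t
      using sc sd by (intro summable_on_add summable_on_cmult_right)
    \<comment> \<open>Any fixed t gives summability; t is optimised only for the norm.\<close>
    have sum: "(\<lambda>k. (w k * cmod (c k + d k)) powr r) summable_on K"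
      by (rule summable_on_comparison_test[OF rhs[of "1/2"]]) (use bound[of _ "1/2"] in auto)
    have "N (\<lambda>k. c k + d k) \<le> N c + N d + \<epsilon>" if "0 < \<epsilon>" for \<epsilon>
    proof -
      \<comment> \<open>The added \<epsilon> / 2 keeps both numbers positive even for vanishing
        norms, so that the optimal ratio t below lies strictly between 0 and 1.\<close>
      define C D where "C = N c + \<epsilon> / 2" and "D = N d + \<epsilon> / 2"
      have pos: "0 < C" "0 < D"
        using norm_nonneg[OF c] norm_nonneg[OF d] that by (auto simp: C_def D_def)
      define t where "t = C / (C + D)"
      have t: "0 < t" "t < 1" "1 - t = D / (C + D)"
        using pos by (auto simp: t_def field_simps)
      have tr: "t powr (1 - r) * C powr r = t * (C + D) powr r"
        "(1 - t) powr (1 - r) * D powr r = (1 - t) * (C + D) powr r"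
        using pos unfolding t(3) by (simp_all add: t_def powr_diff powr_divide)
      have "N (\<lambda>k. c k + d k) powr r \<le> t powr (1 - r) * N c powr r + (1 - t) powr (1 - r) * N d powr r"
        unfolding norm_fin_powr[OF p]
        using infsum_mono[OF sum rhs[of t] bound[OF _ t(1,2)]] sc sd
        by (simp add: infsum_add infsum_cmult_right' summable_on_cmult_right)
      also have "\<dots> \<le> t powr (1 - r) * C powr r + (1 - t) powr (1 - r) * D powr r"
        using norm_nonneg[OF c] norm_nonneg[OF d] that p
        by (intro add_mono mult_left_mono powr_mono2) (auto simp: C_def D_def)
      also have "\<dots> = (C + D) powr r"
        unfolding tr by (simp add: algebra_simps)
      finally have le': "N (\<lambda>k. c k + d k) powr r \<le> (C + D) powr r" .
      have "N (\<lambda>k. c k + d k) \<le> C + D"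
      proof (rule ccontr)
        assume "\<not> ?thesis"
        then have "(C + D) powr r < N (\<lambda>k. c k + d k) powr r"
          using pos p by (intro powr_less_mono2) auto
        with le' show False by simp
      qed
      then show ?thesis
        by (simp add: C_def D_def)
    qed
    then show ?thesis
      using sum out p mem_fin by (auto intro: field_le_epsilon)
  qed
  then show "(\<lambda>k. c k + d k) \<in> \<L>" "N (\<lambda>k. c k + d k) \<le> N c + N d"
    by auto
qed

lemma mem_diff:
  assumes "c \<in> \<L>" "d \<in> \<L>"
  shows "(\<lambda>k. c k - d k) \<in> \<L>"
  using mem_add[OF assms(1) mem_scale[OF assms(2), of "-1"]] by simp

lemma norm_diff_triangle:
  assumes "c \<in> \<L>" "d \<in> \<L>" "e \<in> \<L>"
  shows "N (\<lambda>k. c k - e k) \<le> N (\<lambda>k. c k - d k) + N (\<lambda>k. d k - e k)"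
  using norm_triangle[OF mem_diff[OF assms(1,2)] mem_diff[OF assms(2,3)]] by simp

lemma norm_diff_commute:
  assumes "c \<in> \<L>" "d \<in> \<L>"
  shows "N (\<lambda>k. c k - d k) = N (\<lambda>k. d k - c k)"
  using norm_scale[OF mem_diff[OF assms], of "-1"] by simp

lemma mem_sum_norm:
  assumes "finite I" "\<And>i. i \<in> I \<Longrightarrow> c i \<in> \<L>"
  shows mem_sum: "(\<lambda>k. \<Sum>i\<in>I. c i k) \<in> \<L>"
    and norm_sum_le: "N (\<lambda>k. \<Sum>i\<in>I. c i k) \<le> (\<Sum>i\<in>I. N (c i))"
proof -
  have "(\<lambda>k. \<Sum>i\<in>I. c i k) \<in> \<L> \<and> N (\<lambda>k. \<Sum>i\<in>I. c i k) \<le> (\<Sum>i\<in>I. N (c i))"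
    using assms
  proof (induction I rule: finite_induct)
    case (insert i I)
    then show ?case
      using mem_add[of "c i" "\<lambda>k. \<Sum>i\<in>I. c i k"] norm_triangle[of "c i" "\<lambda>k. \<Sum>i\<in>I. c i k"] by force
  qed (simp add: mem_zero norm_zero)
  then show "(\<lambda>k. \<Sum>i\<in>I. c i k) \<in> \<L>" "N (\<lambda>k. \<Sum>i\<in>I. c i k) \<le> (\<Sum>i\<in>I. N (c i))"
    by auto
qed

section \<open>Truncations and the density of finite sequences\<close>

lemma mem_trunc: "c \<in> \<L> \<Longrightarrow> trunc J c \<in> \<L>"
  by (rule mem_solid(1)[of c]) (auto simp: trunc_def zero_outside)

lemma norm_trunc_le: "c \<in> \<L> \<Longrightarrow> N (trunc J c) \<le> N c"
  by (rule mem_solid(2)[of c]) (auto simp: trunc_def zero_outside)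

lemma trunc_fin_seqs: "finite J \<Longrightarrow> J \<subseteq> K \<Longrightarrow> trunc J c \<in> fin_seqs K"
  by (auto simp: fin_seqs_def trunc_def elim: finite_subset[rotated])

text \<open>Lets all matrix algebra take place in the weighted
  \<open>\<ell>\<^sup>\<infinity>\<close> space, where \<open>row_bounded\<close> gives absolute
  convergence; the exponent then matters only for norms and limits.\<close>

lemma mem_linf: "c \<in> \<L> \<Longrightarrow> c \<in> lp_space K \<infinity> w"
  using zero_outside[of c] weighted_le_norm[of c]
  unfolding lp_space_def[of _ \<infinity>] by (simp add: linf_space_iff) blast

text \<open>Closedness under uniform approximation. The bounds are coordinatewise, so the supremum
  of a set not yet known to be bounded never appears.\<close>

lemma mem_zero_closed:
  assumes p: "p = 0" and c: "\<And>k. k \<notin> K \<Longrightarrow> c k = 0"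
    and approx: "\<And>\<epsilon>. 0 < \<epsilon> \<Longrightarrow> \<exists>d\<in>\<L>. \<forall>k\<in>K. w k * cmod (c k - d k) \<le> \<epsilon>"
  shows "c \<in> \<L>"
proof -
  have "finite {k \<in> K. \<epsilon> \<le> w k * cmod (c k)}" if "0 < \<epsilon>" for \<epsilon>
  proof -
    have half: "0 < \<epsilon> / 2"
      using that by simp
    then obtain d where d: "d \<in> \<L>" "\<And>k. k \<in> K \<Longrightarrow> w k * cmod (c k - d k) \<le> \<epsilon> / 2"
      using approx by blast
    have "w k * cmod (c k) \<le> w k * cmod (c k - d k) + w k * cmod (d k)" if "k \<in> K" for k
      using weight_nonneg[OF that] norm_triangle_ineq[of "c k - d k" "d k"]
      by (simp add: distrib_left[symmetric] mult_left_mono)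
    then have "{k \<in> K. \<epsilon> \<le> w k * cmod (c k)} \<subseteq> {k \<in> K. \<epsilon> / 2 \<le> w k * cmod (d k)}"
      using d(2) by force
    then show ?thesis
      using d(1) half finite_subset unfolding mem_zero_iff[OF p] by blast
  qed
  then show ?thesis
    using c unfolding mem_zero_iff[OF p] by blast
qed

text \<open>Norm density of finite sequences in the form used for all norm limits. For p =
  \<infinity> this fails, and the weak-star topology takes its place.\<close>

lemma tendsto_trunc:
  assumes c: "c \<in> \<L>" and "p \<noteq> \<infinity>"
  shows "((\<lambda>J. N (\<lambda>k. c k - trunc J c k)) \<longlongrightarrow> 0) (finite_subsets_at_top K)"
proof (rule exponent_cases)
  assume p: "p = 0"
  show ?thesis
  proof (rule tendstoI)
    fix \<epsilon> :: real assume "0 < \<epsilon>"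
    define I where "I = {k \<in> K. \<epsilon> / 2 \<le> w k * cmod (c k)}"
    have I: "finite I" "I \<subseteq> K"
      using c half_gt_zero[OF \<open>0 < \<epsilon>\<close>] unfolding mem_zero_iff[OF p] I_def by blast+
    have "dist (N (\<lambda>k. c k - trunc J c k)) 0 < \<epsilon>" if "I \<subseteq> J" for J
    proof -
      have "N (\<lambda>k. c k - trunc J c k) \<le> \<epsilon> / 2"
        by (rule norm_le_sup) (use p that \<open>0 < \<epsilon>\<close> in \<open>auto simp: I_def trunc_def\<close>)
      then show ?thesis
        using norm_nonneg[OF mem_diff[OF c mem_trunc[OF c]], of J] \<open>0 < \<epsilon>\<close> by simp
    qed
    then show "\<forall>\<^sub>F J in finite_subsets_at_top K. dist (N (\<lambda>k. c k - trunc J c k)) 0 < \<epsilon>"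
      unfolding eventually_finite_subsets_at_top using I by (intro exI[of _ I]) auto
  qed
next
  assume p: "p \<noteq> 0" "p \<noteq> \<infinity>" "1 \<le> r"
  define g where "g k = (w k * cmod (c k)) powr r" for k
  have g: "g summable_on K"
    using c mem_fin p unfolding g_def by blast
  have eq: "N (\<lambda>k. c k - trunc J c k) = (infsum g K - sum g J) powr (1 / r)"
    if J: "finite J" "J \<subseteq> K" for J
  proof -
    have "(\<Sum>\<^sub>\<infinity>k\<in>K. (w k * cmod (c k - trunc J c k)) powr r) = infsum g (K - J)"
      by (rule infsum_cong_neutral) (auto simp: trunc_def g_def)
    also have "\<dots> = infsum g K - sum g J"
      using J g by (simp add: infsum_Diff)
    finally show ?thesis
      unfolding norm_fin[OF p(1,2)] by simp
  qed
  have "((\<lambda>J. (infsum g K - sum g J) powr (1 / r)) \<longlongrightarrow> 0) (finite_subsets_at_top K)"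
  proof -
    have "((\<lambda>J. infsum g K - sum g J) \<longlongrightarrow> infsum g K - infsum g K) (finite_subsets_at_top K)"
      using infsum_tendsto[OF g] by (intro tendsto_intros)
    then have "((\<lambda>J. infsum g K - sum g J) \<longlongrightarrow> 0) (finite_subsets_at_top K)"
      by simp
    \<comment> \<open>At the limit point 0 continuity of the power is used along nonnegative
      arguments, hence the side condition that partial sums stay below the total.\<close>
    then have "((\<lambda>J. (infsum g K - sum g J) powr (1 / r)) \<longlongrightarrow> 0 powr (1 / r)) (finite_subsets_at_top K)"
    proof (rule tendsto_powr')
      show "((0::real) \<noteq> 0) \<or> (0 < 1 / r \<and> (\<forall>\<^sub>F J in finite_subsets_at_top K. 0 \<le> infsum g K - sum g J))"
      proof -
        have "0 \<le> infsum g K - sum g J" if "finite J" "J \<subseteq> K" for J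
          using finite_sum_le_infsum[OF g that] by (simp add: g_def)
        then show ?thesis
          using p by (auto intro!: eventually_finite_subsets_at_top_weakI)
      qed
    qed simp
    then show ?thesis
      using p by simp
  qed
  then show ?thesis
    by (rule Lim_transform_eventually)
      (auto intro!: eventually_finite_subsets_at_top_weakI simp: eq)
qed (use assms in auto)

end

lemma lp_space_1_iff:
  assumes "\<And>k. k \<in> K \<Longrightarrow> 0 < w k"
  shows "c \<in> lp_space K 1 w \<longleftrightarrow> (\<forall>k. k \<notin> K \<longrightarrow> c k = 0) \<and> (\<lambda>k. w k * cmod (c k)) summable_on K"
proof -
  have "(\<lambda>k. (w k * cmod (c k)) powr 1) summable_on K \<longleftrightarrow> (\<lambda>k. w k * cmod (c k)) summable_on K"
    by (rule summable_on_cong) (simp add: assms less_imp_le)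
  then show ?thesis
    by (simp add: lp_space_def)
qed

lemma lp_norm_1:
  assumes "\<And>k. k \<in> K \<Longrightarrow> 0 < w k"
  shows "lp_norm K 1 w c = (\<Sum>\<^sub>\<infinity>k\<in>K. w k * cmod (c k))"
proof -
  have nonneg: "0 \<le> w k * cmod (c k)" if "k \<in> K" for k
    using assms[OF that] by simp
  then have "(\<Sum>\<^sub>\<infinity>k\<in>K. (w k * cmod (c k)) powr 1) = (\<Sum>\<^sub>\<infinity>k\<in>K. w k * cmod (c k))"
    by (intro infsum_cong) simp
  then show ?thesis
    using nonneg by (simp add: lp_norm_def infsum_nonneg)
qed

lemma lp_space_2_iff:
  "c \<in> lp_space K 2 (\<lambda>_. 1) \<longleftrightarrow> (\<forall>k. k \<notin> K \<longrightarrow> c k = 0) \<and> (\<lambda>k. (cmod (c k))\<^sup>2) summable_on K"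
  by (auto simp: lp_space_def)

lemma lp_norm_2: "lp_norm K 2 (\<lambda>_. 1) c = sqrt (\<Sum>\<^sub>\<infinity>k\<in>K. (cmod (c k))\<^sup>2)"
  by (simp add: lp_norm_def powr_half_sqrt infsum_nonneg)

section \<open>The dual Gram matrix of a localized frame\<close>

context solid_spectral_matrix_algebra
begin

section \<open>Elementary estimates in the algebra norm\<close>

lemma diff_closed: "A \<in> \<A> \<Longrightarrow> B \<in> \<A> \<Longrightarrow> (\<lambda>k l. A k l - B k l) \<in> \<A>"
  using add_closed[of A "\<lambda>k l. -1 * B k l"] scale_closed[of B "-1"] by simp

lemma nrm_diff_commute:
  assumes "A \<in> \<A>" "B \<in> \<A>"
  shows "nrm (\<lambda>k l. A k l - B k l) = nrm (\<lambda>k l. B k l - A k l)"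
  using nrm_scale[OF diff_closed[OF assms], of "-1"] by simp

lemma nrm_diff_le: "A \<in> \<A> \<Longrightarrow> B \<in> \<A> \<Longrightarrow> nrm (\<lambda>k l. A k l - B k l) \<le> nrm A + nrm B"
  using nrm_triangle[of A "\<lambda>k l. -1 * B k l"] scale_closed[of B "-1"] nrm_scale[of B "-1"] by simp

lemma nrm_le_diff: "A \<in> \<A> \<Longrightarrow> B \<in> \<A> \<Longrightarrow> nrm A \<le> nrm B + nrm (\<lambda>k l. A k l - B k l)"
  using nrm_triangle[of B "\<lambda>k l. A k l - B k l"] diff_closed[of A B] by simp

lemma nrm_diff_triangle:
  "A \<in> \<A> \<Longrightarrow> B \<in> \<A> \<Longrightarrow> C \<in> \<A> \<Longrightarrow>
    nrm (\<lambda>k l. A k l - C k l) \<le> nrm (\<lambda>k l. A k l - B k l) + nrm (\<lambda>k l. B k l - C k l)"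
  using nrm_triangle[of "\<lambda>k l. A k l - B k l" "\<lambda>k l. B k l - C k l"]
    diff_closed[of A B] diff_closed[of B C] by simp

lemma abs_closed: "A \<in> \<A> \<Longrightarrow> (\<lambda>k l. complex_of_real (cmod (A k l))) \<in> \<A>"
  using solid[of A "\<lambda>k l. complex_of_real (cmod (A k l))"] by simp

text \<open>The norm of \<A> is not given as dominating anything on \<open>\<ell>\<^sup>2\<close>.
  Solidity helps: if some member has a nonzero entry at (k, l), then the matrix unit E at that place
  belongs to \<A>, and B k l times E is dominated by B. Limits in \<A> can therefore be identified
  entrywise.\<close>

lemma entry_bounded: "\<exists>C. \<forall>B\<in>\<A>. cmod (B k l) \<le> C * nrm B"
proof (cases "\<exists>B\<in>\<A>. B k l \<noteq> 0")
  case True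
  then obtain B0 where B0: "B0 \<in> \<A>" "B0 k l \<noteq> 0" by blast
  define E :: "'i matrix" where "E = (\<lambda>i j. if i = k \<and> j = l then 1 else 0)"
  have E: "E \<in> \<A>"
    using solid[OF scale_closed[OF B0(1), of "1 / B0 k l"], of E] B0(2)
    by (simp add: E_def norm_divide)
  have "E \<noteq> (\<lambda>k l. 0)"
    unfolding E_def by (metis zero_neq_one)
  then have "0 < nrm E"
    using nrm_eq_0[OF E] nrm_nonneg[OF E] by simp
  have "cmod (B k l) \<le> 1 / nrm E * nrm B" if "B \<in> \<A>" for B
  proof -
    have "nrm (\<lambda>i j. B k l * E i j) \<le> nrm B"
      by (rule conjunct2[OF solid[OF that]]) (simp add: E_def)
    then show ?thesis
      using \<open>0 < nrm E\<close> by (simp add: nrm_scale[OF E] field_simps)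
  qed
  then show ?thesis by blast
next
  case False
  then show ?thesis
    by (intro exI[of _ 0]) auto
qed

end

locale localized_frame = solid_spectral_matrix_algebra K \<A> nrm + hilbert_frame K \<psi>
  for K :: "'i set" and \<A> nrm and \<psi> :: "'i \<Rightarrow> 'h::complex_hilbert_space" +
  assumes localized: "localized_rel K \<A> \<psi> \<psi>"
begin

interpretation l2: weighted_lp K "\<lambda>_. 1" 2
  by unfold_locales auto

text \<open>The matrix \<open>C\<^sub>\<psi> X D\<^sub>\<psi>\<close>; since \<open>D\<^sub>\<psi> C\<^sub>\<psi> = S\<close>, products satisfy
  \<open>frame_matrix X \<cdot> frame_matrix Y = frame_matrix (X S Y)\<close>.\<close>

definition frame_matrix :: "('h \<Rightarrow> 'h) \<Rightarrow> 'i matrix" where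
  "frame_matrix X = cross_gram K \<psi> (\<lambda>l. X (\<psi> l))"

lemma frame_matrix_apply:
  "frame_matrix X k l = (if k \<in> K \<and> l \<in> K then cinner (X (\<psi> l)) (\<psi> k) else 0)"
  by (simp add: frame_matrix_def cross_gram_def)

lemma frame_matrix_id: "frame_matrix (\<lambda>f. f) \<in> \<A>"
  using localized by (simp add: frame_matrix_def localized_rel_def)

lemma frame_matrix_diff:
  "frame_matrix X \<in> \<A> \<Longrightarrow> frame_matrix Y \<in> \<A> \<Longrightarrow> frame_matrix (\<lambda>f. X f - Y f) \<in> \<A>"
  using diff_closed[of "frame_matrix X" "frame_matrix Y"]
  by (rule back_subst[where P = "\<lambda>A. A \<in> \<A>"])
    (auto simp: frame_matrix_apply cinner_diff_left intro!: ext)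

lemma frame_matrix_scaleC:
  "frame_matrix X \<in> \<A> \<Longrightarrow> frame_matrix (\<lambda>f. scaleC a (X f)) \<in> \<A>"
  using scale_closed[of "frame_matrix X" a]
  by (rule back_subst[where P = "\<lambda>A. A \<in> \<A>"])
    (auto simp: frame_matrix_apply cinner_scaleC_left intro!: ext)

lemma mat_mult_frame_matrix:
  assumes "bounded_clinear X"
  shows "mat_mult K (frame_matrix X) (frame_matrix Y) = frame_matrix (\<lambda>f. X (S (Y f)))"
proof (intro ext)
  fix k l
  have X: "bounded_linear X" "\<And>a f. X (scaleC a f) = scaleC a (X f)"
    using assms by (auto simp: bounded_clinear_def)
  show "mat_mult K (frame_matrix X) (frame_matrix Y) k l = frame_matrix (\<lambda>f. X (S (Y f))) k l"
  proof (cases "k \<in> K \<and> l \<in> K")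
    case True
    have "((\<lambda>m. cinner (Y (\<psi> l)) (\<psi> m) * cinner (X (\<psi> m)) (\<psi> k)) has_sum
        cinner (X (S (Y (\<psi> l)))) (\<psi> k)) K"
      using has_sum_bounded_linear[OF bounded_linear_compose[OF bounded_linear_cinner_left X(1)]
          has_sum_S[of "Y (\<psi> l)"], of "\<psi> k"]
      by (simp add: X(2) cinner_scaleC_left)
    then have "((\<lambda>m. frame_matrix X k m * frame_matrix Y m l) has_sum
        cinner (X (S (Y (\<psi> l)))) (\<psi> k)) K"
      by (rule has_sum_cong[THEN iffD1, rotated]) (use True in \<open>simp add: frame_matrix_apply\<close>)
    then show ?thesis
      using True by (simp add: mat_mult_def frame_matrix_apply infsumI)
  next
    case False
    then have "frame_matrix X k m * frame_matrix Y m l = 0" for m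
      by (auto simp: frame_matrix_apply)
    then show ?thesis
      using False by (simp add: mat_mult_def) (auto simp: frame_matrix_apply)
  qed
qed

lemma mat_app_frame_matrix:
  assumes "bounded_clinear X" "c \<in> l2.\<L>"
  shows "\<And>k. (\<lambda>l. frame_matrix X k l * c l) summable_on K"
    and "mat_app K (frame_matrix X) c = analysis_op K \<psi> (X (synthesis_op K \<psi> c))"
proof -
  have X: "bounded_linear X" "\<And>a f. X (scaleC a f) = scaleC a (X f)"
    using assms by (auto simp: bounded_clinear_def)
  have c: "(\<lambda>k. (cmod (c k))\<^sup>2) summable_on K"
    using assms(2) lp_space_2_iff by blast
  have *: "((\<lambda>l. frame_matrix X k l * c l) has_sum analysis_op K \<psi> (X (synthesis_op K \<psi> c)) k) K" for k
  proof (cases "k \<in> K")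
    case True
    have "((\<lambda>l. c l * cinner (X (\<psi> l)) (\<psi> k)) has_sum cinner (X (synthesis_op K \<psi> c)) (\<psi> k)) K"
      using has_sum_bounded_linear[OF bounded_linear_compose[OF bounded_linear_cinner_left X(1)]
          has_sum_synthesis[OF c], of "\<psi> k"]
      by (simp add: X(2) cinner_scaleC_left)
    then have "((\<lambda>l. frame_matrix X k l * c l) has_sum cinner (X (synthesis_op K \<psi> c)) (\<psi> k)) K"
      by (rule has_sum_cong[THEN iffD1, rotated]) (use True in \<open>simp add: frame_matrix_apply\<close>)
    then show ?thesis
      using True by (simp add: analysis_op_def)
  next
    case False
    then show ?thesis by (simp add: frame_matrix_apply analysis_op_def)
  qed
  show "(\<lambda>l. frame_matrix X k l * c l) summable_on K" for k
    using * by (rule has_sum_imp_summable)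
  show "mat_app K (frame_matrix X) c = analysis_op K \<psi> (X (synthesis_op K \<psi> c))"
    using * by (auto simp: mat_app_def infsumI)
qed

lemma analysis_mem_l2: "analysis_op K \<psi> f \<in> l2.\<L>"
  using analysis_summable[of f]
  by (auto simp: lp_space_2_iff analysis_op_def cong: summable_on_cong)

lemma norm_analysis_le: "l2.N (analysis_op K \<psi> f) \<le> sqrt upper_bound * norm f"
proof -
  have "l2.N (analysis_op K \<psi> f) = sqrt (\<Sum>\<^sub>\<infinity>k\<in>K. (cmod (cinner f (\<psi> k)))\<^sup>2)"
    by (simp add: lp_norm_2 analysis_op_def cong: infsum_cong)
  also have "\<dots> \<le> sqrt (upper_bound * (norm f)\<^sup>2)"
    using upper_bound(2) by (rule real_sqrt_le_mono)
  finally show ?thesis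
    by (simp add: real_sqrt_mult)
qed

lemma norm_synthesis_le_l2:
  assumes "c \<in> l2.\<L>"
  shows "norm (synthesis_op K \<psi> c) \<le> sqrt upper_bound * l2.N c"
proof -
  have "(\<lambda>k. (cmod (c k))\<^sup>2) summable_on K"
    using assms lp_space_2_iff by blast
  from real_sqrt_le_mono[OF norm_synthesis_le[OF this]] show ?thesis
    by (simp add: real_sqrt_mult lp_norm_2)
qed

lemma synthesis_add:
  assumes "c \<in> l2.\<L>" "d \<in> l2.\<L>"
  shows "synthesis_op K \<psi> (\<lambda>k. c k + d k) = synthesis_op K \<psi> c + synthesis_op K \<psi> d"
proof -
  have *: "((\<lambda>k. scaleC (x k) (\<psi> k)) has_sum synthesis_op K \<psi> x) K" if "x \<in> l2.\<L>" for x
    using that by (intro has_sum_synthesis) (simp add: lp_space_2_iff)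
  show ?thesis
    using has_sum_add[OF *[OF assms(1)] *[OF assms(2)]] *[OF l2.mem_add[OF assms]]
    by (simp add: scaleC_add_left has_sum_unique)
qed

text \<open>For a redundant frame synthesis has a kernel, so \<open>frame_matrix X\<close> is never
  invertible on \<open>\<ell>\<^sup>2\<close>. Adding the identity produces matrices to which
  \<open>inverse_closed\<close> can apply.\<close>

definition unital_matrix :: "('h \<Rightarrow> 'h) \<Rightarrow> 'i matrix" where
  "unital_matrix X = (\<lambda>k l. mat_id K k l + frame_matrix X k l)"

lemma mat_app_unital_matrix:
  assumes "bounded_clinear X" "c \<in> l2.\<L>"
  shows "\<And>k. (\<lambda>l. unital_matrix X k l * c l) summable_on K"
    and "mat_app K (unital_matrix X) c = (\<lambda>k. c k + analysis_op K \<psi> (X (synthesis_op K \<psi> c)) k)"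
    and "mat_app K (unital_matrix X) c \<in> l2.\<L>"
proof -
  have id: "((\<lambda>l. mat_id K k l * c l) has_sum c k) K" for k
  proof (cases "k \<in> K")
    case True
    then show ?thesis
      by (intro has_sum_finite_neutralI[of "{k}"]) (auto simp: mat_id_def)
  next
    case False
    then show ?thesis
      using l2.zero_outside[OF assms(2)] by (simp add: mat_id_def)
  qed
  note sum = summable_on_add[OF has_sum_imp_summable[OF id] mat_app_frame_matrix(1)[OF assms]]
  show "(\<lambda>l. unital_matrix X k l * c l) summable_on K" for k
    using sum[of k k] by (simp add: unital_matrix_def distrib_right)
  show *: "mat_app K (unital_matrix X) c = (\<lambda>k. c k + analysis_op K \<psi> (X (synthesis_op K \<psi> c)) k)"
    unfolding mat_app_frame_matrix(2)[OF assms, symmetric]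
    using infsum_add[OF has_sum_imp_summable[OF id] mat_app_frame_matrix(1)[OF assms]] infsumI[OF id]
    by (simp add: mat_app_def unital_matrix_def distrib_right)
  show "mat_app K (unital_matrix X) c \<in> l2.\<L>"
    unfolding * by (rule l2.mem_add[OF assms(2) analysis_mem_l2])
qed

lemma mat_bounded_unital_matrix:
  assumes "bounded_clinear X"
  shows "mat_bounded K 2 (\<lambda>_. 1) 2 (\<lambda>_. 1) (unital_matrix X)"
proof -
  obtain b where b: "0 < b" "\<And>f. norm (X f) \<le> norm f * b"
    using assms bounded_linear.pos_bounded unfolding bounded_clinear_def by blast
  have "l2.N (mat_app K (unital_matrix X) c) \<le> (1 + upper_bound * b) * l2.N c" if c: "c \<in> l2.\<L>" for c
  proof -
    have "l2.N (mat_app K (unital_matrix X) c) \<le> l2.N c + l2.N (analysis_op K \<psi> (X (synthesis_op K \<psi> c)))"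
      unfolding mat_app_unital_matrix(2)[OF assms c] by (rule l2.norm_triangle[OF c analysis_mem_l2])
    also have "l2.N (analysis_op K \<psi> (X (synthesis_op K \<psi> c))) \<le> sqrt upper_bound * (norm (synthesis_op K \<psi> c) * b)"
      using norm_analysis_le b(2) upper_bound_pos by (meson mult_left_mono order_trans real_sqrt_ge_zero less_imp_le)
    also have "\<dots> \<le> sqrt upper_bound * ((sqrt upper_bound * l2.N c) * b)"
      using norm_synthesis_le_l2[OF c] b(1) upper_bound_pos by (intro mult_left_mono mult_right_mono) auto
    also have "\<dots> = sqrt upper_bound * sqrt upper_bound * b * l2.N c"
      by (simp only: mult_ac)
    finally show ?thesis
      using upper_bound_pos by (simp add: algebra_simps)
  qed
  moreover have "unital_matrix X \<in> matrices K"
    by (auto simp: unital_matrix_def matrices_def mat_id_def frame_matrix_apply)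
  ultimately show ?thesis
    unfolding mat_bounded_def using mat_app_unital_matrix[OF assms] by blast
qed

text \<open>With synthesis D and analysis C, D C = S gives (1 + C Y D) (1 + C X D) = 1 + C (X + Y +
  Y S X) D, so the hypothesis kills everything but the identity.\<close>

lemma mat_app_unital_matrix_inverse:
  assumes X: "bounded_clinear X" and Y: "bounded_clinear Y" and c: "c \<in> l2.\<L>"
    and inverse: "\<And>f. X f + Y f + Y (S (X f)) = 0"
  shows "mat_app K (unital_matrix Y) (mat_app K (unital_matrix X) c) = c"
proof -
  define f where "f = synthesis_op K \<psi> c"
  have "synthesis_op K \<psi> (analysis_op K \<psi> g) = S g" for g
    by (simp add: frame_op_def)
  then have synth: "synthesis_op K \<psi> (mat_app K (unital_matrix X) c) = f + S (X f)"
    unfolding mat_app_unital_matrix(2)[OF X c]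
    by (simp add: synthesis_add[OF c analysis_mem_l2] f_def)
  have "Y (f + S (X f)) = - X f"
  proof -
    interpret Y: bounded_linear Y
      using Y by (simp add: bounded_clinear_def)
    have "Y (f + S (X f)) = (X f + Y f + Y (S (X f))) - X f"
      by (simp add: Y.add)
    then show ?thesis
      by (simp add: inverse)
  qed
  then show ?thesis
    unfolding mat_app_unital_matrix(2)[OF Y mat_app_unital_matrix(3)[OF X c]] synth
    unfolding mat_app_unital_matrix(2)[OF X c] f_def[symmetric]
    by (auto simp: analysis_op_def cinner_minus_left)
qed

text \<open>Under the hypotheses, \<open>1 + C\<^sub>\<psi> X D\<^sub>\<psi>\<close> and \<open>1 + C\<^sub>\<psi> Y D\<^sub>\<psi>\<close> are inverse to each other.\<close>

lemma frame_matrix_quasi_inverse: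
  assumes X: "bounded_clinear X" and Y: "bounded_clinear Y"
    and "\<And>f. X f + Y f + Y (S (X f)) = 0" "\<And>f. X f + Y f + X (S (Y f)) = 0"
    and mem: "frame_matrix X \<in> \<A>"
  shows "frame_matrix Y \<in> \<A>"
proof -
  have "unital_matrix X \<in> \<A>"
    unfolding unital_matrix_def by (rule add_closed[OF id_mem mem])
  moreover have "\<And>f. Y f + X f + X (S (Y f)) = 0"
    using assms(4) by (simp add: add.commute)
  ultimately have "unital_matrix Y \<in> \<A>"
    using assms mat_app_unital_matrix_inverse
    by (intro inverse_closed[OF _ mat_bounded_unital_matrix[OF Y]]) auto
  from diff_closed[OF this id_mem] show ?thesis
    by (simp add: unital_matrix_def)
qed

section \<open>Resolvents of the frame operator on a small circle\<close>

text \<open>Half the lower frame bound serves twice: S - z stays coercive with constant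
  \<open>radius\<close> on the closed disc of that radius, and \<open>radius\<close> times R has
  norm at most 1/2.\<close>

definition radius :: real where "radius = lower_bound / 2"

lemma radius_pos: "0 < radius"
  using lower_bound_pos by (simp add: radius_def)

definition resolvent :: "complex \<Rightarrow> 'h \<Rightarrow> 'h" where
  "resolvent z = inv (\<lambda>f. S f - scaleC z f)"

lemma resolvent:
  assumes z: "cmod z \<le> radius"
  shows bounded_clinear_resolvent: "bounded_clinear (resolvent z)"
    and S_resolvent: "S (resolvent z f) = f + scaleC z (resolvent z f)"
    and resolvent_S: "resolvent z (S f) = f + scaleC z (resolvent z f)"
proof -
  have lin: "bounded_clinear (\<lambda>f. S f - scaleC z f)"
    by (intro bounded_clinear_diff bounded_clinear_S bounded_clinear_scaleC bounded_clinear_id)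
  have "radius * (norm f)\<^sup>2 \<le> Re (cinner (S f - scaleC z f) f)" for f
  proof -
    have "Re (cinner (scaleC z f) f) \<le> cmod z * (norm f)\<^sup>2"
      using order_trans[OF complex_Re_le_cmod Cauchy_Schwarz_cinner, of "scaleC z f" f]
      by (simp add: norm_scaleC power2_eq_square mult.assoc)
    also have "\<dots> \<le> radius * (norm f)\<^sup>2"
      using z by (rule mult_right_mono) simp
    finally show ?thesis
      using coercive_S[of f] by (simp add: cinner_diff_left radius_def)
  qed
  note * = coercive_inv[OF lin radius_pos this, folded resolvent_def]
  show bl: "bounded_clinear (resolvent z)" by (rule *)
  show "S (resolvent z f) = f + scaleC z (resolvent z f)"
    using *(2)[of f] by (simp add: algebra_simps)
  have "resolvent z (S f - scaleC z f) = resolvent z (S f) - scaleC z (resolvent z f)"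
    using bl unfolding bounded_clinear_def by (simp add: bounded_linear.linear linear_diff)
  then show "resolvent z (S f) = f + scaleC z (resolvent z f)"
    using *(3)[of f] by (simp add: algebra_simps)
qed

text \<open>With G the Gram matrix of \<psi>, the inverse of 1 - G / z is 1 minus the matrix of the
  resolvent, the Woodbury identity for G = C D and S = D C. In the notation of the quasi-inverse, X
  is multiplication by -1 / z and Y is the negative resolvent.\<close>

lemma frame_matrix_resolvent:
  assumes "cmod z = radius"
  shows "frame_matrix (resolvent z) \<in> \<A>"
proof -
  have z: "cmod z \<le> radius" "z \<noteq> 0"
    using assms radius_pos by auto
  note Q = bounded_clinear_resolvent[OF z(1)]
  define a where "a = - 1 / z"
  have a: "a * z = - 1"
    using z(2) by (simp add: a_def)
  have "frame_matrix (\<lambda>f. - resolvent z f) \<in> \<A>"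
  proof (rule frame_matrix_quasi_inverse)
    show "bounded_clinear (\<lambda>f. scaleC a f)"
      by (intro bounded_clinear_scaleC bounded_clinear_id)
    show "bounded_clinear (\<lambda>f. - resolvent z f)"
      by (rule bounded_clinear_minus[OF Q])
    show "frame_matrix (\<lambda>f. scaleC a f) \<in> \<A>"
      by (rule frame_matrix_scaleC[OF frame_matrix_id])
    have scaleC: "resolvent z (scaleC b f) = scaleC b (resolvent z f)" for b f
      using Q by (simp add: bounded_clinear_def)
    have minus: "S (- f) = - S f" for f
      using S_scaleC[of "-1" f] by (simp add: scaleC_minus_left)
    show "scaleC a f + - resolvent z f + - resolvent z (S (scaleC a f)) = 0" for f
      by (simp add: S_scaleC scaleC resolvent_S[OF z(1)] scaleC_add_right scaleC_scaleC a
          scaleC_minus_left)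
    show "scaleC a f + - resolvent z f + scaleC a (S (- resolvent z f)) = 0" for f
      by (simp add: minus S_resolvent[OF z(1)] scaleC_add_right scaleC_diff_right scaleC_minus_right
          scaleC_scaleC a scaleC_minus_left)
  qed
  from frame_matrix_scaleC[OF this, of "-1"] show ?thesis
    by (simp add: scaleC_minus_left)
qed

text \<open>The usual right-hand side is (z - v) times the product of the two resolvents, whose
  frame matrix is not visibly a product in \<A>. Inserting \<open>S\<close> between the factors
  makes it one, since \<open>mat_mult_frame_matrix\<close> reads the inserted \<open>S\<close> as a
  matrix product; the correction term and the divisor v come from S (S - v)^(-1) = 1 + v (S -
  v)^(-1).\<close>

lemma resolvent_identity:
  assumes z: "cmod z \<le> radius" and v: "cmod v \<le> radius" "v \<noteq> 0"
  shows "resolvent z f - resolvent v f =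
    scaleC ((z - v) / v) (resolvent z (S (resolvent v f)) - resolvent z f)"
proof -
  have Q: "bounded_linear (resolvent z)" "\<And>a f. resolvent z (scaleC a f) = scaleC a (resolvent z f)"
    using bounded_clinear_resolvent[OF z] by (auto simp: bounded_clinear_def)
  interpret Q: bounded_linear "resolvent z" by fact
  have 1: "resolvent z (S (resolvent v f)) = resolvent z f + scaleC v (resolvent z (resolvent v f))"
    by (simp add: S_resolvent[OF v(1)] Q.add Q(2))
  have 2: "resolvent z (S (resolvent v f)) = resolvent v f + scaleC z (resolvent z (resolvent v f))"
    by (rule resolvent_S[OF z])
  have "resolvent z f - resolvent v f = scaleC (z - v) (resolvent z (resolvent v f))"
    using 1 2 by (simp add: scaleC_diff_left algebra_simps)
  also have "\<dots> = scaleC ((z - v) / v) (resolvent z (S (resolvent v f)) - resolvent z f)"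
    using v(2) by (simp add: 1 scaleC_scaleC)
  finally show ?thesis .
qed

text \<open>No uniform bound is known yet, so the norms at both points stay on the right; the next
  lemma absorbs one of them.\<close>

lemma nrm_resolvent_diff_le:
  assumes z: "cmod z = radius" and v: "cmod v = radius"
  defines "b \<equiv> \<lambda>z. nrm (frame_matrix (resolvent z))"
  shows "nrm (\<lambda>k l. frame_matrix (resolvent z) k l - frame_matrix (resolvent v) k l)
    \<le> cmod (z - v) / radius * (b z * b v + b z)"
proof -
  let ?P = "mat_mult K (frame_matrix (resolvent z)) (frame_matrix (resolvent v))"
  let ?Q = "frame_matrix (resolvent z)"
  have mem: "?P \<in> \<A>" "?Q \<in> \<A>"
    using frame_matrix_resolvent[OF z] frame_matrix_resolvent[OF v] mult_closed by auto
  have v': "cmod v \<le> radius" "v \<noteq> 0" and z': "cmod z \<le> radius"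
    using v z radius_pos by auto
  have "(\<lambda>k l. frame_matrix (resolvent z) k l - frame_matrix (resolvent v) k l) =
      (\<lambda>k l. (z - v) / v * (?P k l - ?Q k l))"
    unfolding mat_mult_frame_matrix[OF bounded_clinear_resolvent[OF z']]
    using resolvent_identity[OF z' v']
    by (intro ext) (simp add: frame_matrix_apply cinner_diff_left[symmetric]
        cinner_scaleC_left[symmetric] del: times_divide_eq_left)
  then have "nrm (\<lambda>k l. frame_matrix (resolvent z) k l - frame_matrix (resolvent v) k l) =
      cmod (z - v) / radius * nrm (\<lambda>k l. ?P k l - ?Q k l)"
    using nrm_scale[OF diff_closed[OF mem], of "(z - v) / v"] by (simp add: norm_divide v)
  also have "\<dots> \<le> cmod (z - v) / radius * (b z * b v + b z)"
    using nrm_diff_le[OF mem] nrm_mult[OF frame_matrix_resolvent[OF z] frame_matrix_resolvent[OF v]]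
      radius_pos
    unfolding b_def by (intro mult_left_mono) auto
  finally show ?thesis .
qed

text \<open>Compactness of the circle. If the norms blow up along z n, pass to a subsequence with
  limit v. Once z n is so close to v that \<delta> (b v + 1) < 1/2, the difference estimate contains
  at most half of b (z n), which is absorbed on the left; the norms near v are thus at most 2 b v +
  1.\<close>

lemma nrm_resolvent_bounded: "\<exists>B. \<forall>z. cmod z = radius \<longrightarrow> nrm (frame_matrix (resolvent z)) \<le> B"
proof (rule ccontr)
  define b where "b z = nrm (frame_matrix (resolvent z))" for z
  assume "\<not> ?thesis"
  then have "\<exists>z. cmod z = radius \<and> real n < b z" for n
    unfolding b_def by (meson not_le)
  then obtain z where z: "\<And>n. cmod (z n) = radius" "\<And>n. real n < b (z n)"
    by metis
  have "seq_compact (sphere (0::complex) radius)"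
    by (intro compact_imp_seq_compact compact_sphere)
  then obtain v s where v: "v \<in> sphere 0 radius" "strict_mono s" "(z \<circ> s) \<longlonglongrightarrow> v"
    using z(1) by (elim seq_compactE[where f = z]) auto
  have vr: "cmod v = radius"
    using v(1) by simp
  have nonneg: "0 \<le> b y" if "cmod y = radius" for y
    unfolding b_def by (intro nrm_nonneg frame_matrix_resolvent that)
  have "(\<lambda>n. cmod (v - (z \<circ> s) n) / radius * (b v + 1)) \<longlonglongrightarrow> cmod (v - v) / radius * (b v + 1)"
    by (intro tendsto_intros v(3)) (use radius_pos in auto)
  then have "\<forall>\<^sub>F n in sequentially. cmod (v - (z \<circ> s) n) / radius * (b v + 1) < 1/2"
    by (rule order_tendstoD) simp
  moreover have "b (z (s n)) \<le> 2 * b v + 1" if small: "cmod (v - (z \<circ> s) n) / radius * (b v + 1) < 1/2" for n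
  proof -
    define \<delta> where "\<delta> = cmod (v - z (s n)) / radius"
    have "b (z (s n)) \<le> b v + nrm (\<lambda>k l. frame_matrix (resolvent (z (s n))) k l - frame_matrix (resolvent v) k l)"
      unfolding b_def by (intro nrm_le_diff frame_matrix_resolvent z vr)
    also have "\<dots> \<le> b v + \<delta> * (b v * b (z (s n)) + b v)"
      using nrm_resolvent_diff_le[OF vr z(1), of "s n"]
      by (simp add: nrm_diff_commute[OF frame_matrix_resolvent[OF z(1)] frame_matrix_resolvent[OF vr]] b_def \<delta>_def)
    also have "\<dots> \<le> b v + (1/2 * b (z (s n)) + 1/2)"
    proof -
      have "0 \<le> \<delta>"
        using radius_pos by (simp add: \<delta>_def)
      then have "\<delta> * b v \<le> 1/2"
        using small unfolding \<delta>_def[symmetric] o_apply by (simp add: distrib_left)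
      then have "\<delta> * b v * b (z (s n)) \<le> 1/2 * b (z (s n))"
        using nonneg[OF z(1)] by (intro mult_right_mono) auto
      with \<open>\<delta> * b v \<le> 1/2\<close> show ?thesis
        by (simp add: distrib_left mult.assoc)
    qed
    finally show ?thesis by simp
  qed
  ultimately have "\<forall>\<^sub>F n in sequentially. b (z (s n)) \<le> 2 * b v + 1"
    by (auto elim: eventually_mono)
  then obtain N where N: "\<And>n. N \<le> n \<Longrightarrow> b (z (s n)) \<le> 2 * b v + 1"
    by (auto simp: eventually_sequentially)
  \<comment> \<open>A strictly increasing s satisfies n \<le> s n, so the norms along the
    subsequence exceed every n.\<close>
  obtain n0 where "2 * b v + 1 < real n0"
    using reals_Archimedean2 by blast
  moreover have "real (max N n0) \<le> real (s (max N n0))"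
    using seq_suble[OF v(2)] by simp
  ultimately show False
    using N[of "max N n0"] z(2)[of "s (max N n0)"] by simp
qed

section \<open>Dyadic averages of the resolvent and their limit\<close>

text \<open>The average of the resolvent over \<open>2\<^sup>m\<close> equidistant points of the circle of radius
  \<open>radius\<close>, rotated by \<open>\<theta> / 2\<^sup>m\<close>. It converges to the value \<open>R\<close> of the resolvent at \<open>0\<close>.\<close>

primrec average :: "nat \<Rightarrow> real \<Rightarrow> 'h \<Rightarrow> 'h" where
  "average 0 = (\<lambda>\<theta>. resolvent (of_real radius * cis \<theta>))"
| "average (Suc m) = (\<lambda>\<theta> f. scaleC (1/2) (average m (\<theta> / 2) f + average m (\<theta> / 2 + pi) f))"

lemma frame_matrix_average_Suc:
  "frame_matrix (average (Suc m) \<theta>) =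
    (\<lambda>k l. 1/2 * (frame_matrix (average m (\<theta> / 2)) k l + frame_matrix (average m (\<theta> / 2 + pi)) k l))"
  by (intro ext) (simp add: frame_matrix_apply cinner_scaleC_left cinner_add_left)

lemma frame_matrix_average: "frame_matrix (average m \<theta>) \<in> \<A>"
proof (induction m arbitrary: \<theta>)
  case 0
  show ?case
    using radius_pos by (simp add: frame_matrix_resolvent norm_mult)
next
  case (Suc m)
  show ?case
    unfolding frame_matrix_average_Suc by (intro scale_closed add_closed Suc)
qed

lemma cmod_cis_diff_le: "cmod (cis s - cis t) \<le> \<bar>s - t\<bar>"
proof -
  have "cis s - cis t = cis t * (cis (s - t) - 1)"
    by (simp add: right_diff_distrib cis_mult)
  then have "cmod (cis s - cis t) = cmod (cis (s - t) - 1)"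
    by (simp add: norm_mult)
  also have "\<dots> = 2 * \<bar>sin ((s - t) / 2)\<bar>"
    using dist_exp_i_1[of "s - t"] by (simp add: cis_conv_exp)
  also have "\<dots> \<le> \<bar>s - t\<bar>"
    using abs_sin_x_le_abs_x[of "(s - t) / 2"] by simp
  finally show ?thesis .
qed

text \<open>At level m the parameter \<theta> turns the nodes by \<theta> / 2^m only, so each level
  halves the Lipschitz constant in \<theta>. This halving makes the averages Cauchy in the algebra
  norm.\<close>

lemma average_Lipschitz:
  obtains L where "0 \<le> L"
    "\<And>m s t. nrm (\<lambda>k l. frame_matrix (average m s) k l - frame_matrix (average m t) k l) \<le> L / 2 ^ m * \<bar>s - t\<bar>"
proof -
  obtain B where B: "\<And>z. cmod z = radius \<Longrightarrow> nrm (frame_matrix (resolvent z)) \<le> B"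
    using nrm_resolvent_bounded by blast
  have nonneg: "0 \<le> nrm (frame_matrix (resolvent z))" if "cmod z = radius" for z
    by (intro nrm_nonneg frame_matrix_resolvent that)
  have "0 \<le> B"
    using order_trans[OF nonneg B, of "of_real radius"] radius_pos by simp
  \<comment> \<open>The bracket of \<open>nrm_resolvent_diff_le\<close> with both norms replaced by
    B; the division by \<open>radius\<close> there is cancelled by the modulus of the nodes.\<close>
  define L where "L = B * B + B"
  have "0 \<le> L"
    using \<open>0 \<le> B\<close> by (simp add: L_def)
  moreover have "nrm (\<lambda>k l. frame_matrix (average m s) k l - frame_matrix (average m t) k l) \<le> L / 2 ^ m * \<bar>s - t\<bar>" for m s t
  proof (induction m arbitrary: s t)
    case 0
    define z where "z s = complex_of_real radius * cis s" for s
    have z: "cmod (z s) = radius" for s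
      using radius_pos by (simp add: z_def norm_mult)
    have "nrm (\<lambda>k l. frame_matrix (resolvent (z s)) k l - frame_matrix (resolvent (z t)) k l)
        \<le> cmod (z s - z t) / radius *
          (nrm (frame_matrix (resolvent (z s))) * nrm (frame_matrix (resolvent (z t))) + nrm (frame_matrix (resolvent (z s))))"
      by (rule nrm_resolvent_diff_le[OF z z])
    also have "\<dots> \<le> cmod (z s - z t) / radius * L"
      unfolding L_def using B[OF z] nonneg[OF z] radius_pos \<open>0 \<le> B\<close>
      by (intro mult_left_mono add_mono mult_mono) auto
    also have "cmod (z s - z t) / radius = cmod (cis s - cis t)"
      using radius_pos by (simp add: z_def right_diff_distrib[symmetric] norm_mult)
    also have "cmod (cis s - cis t) * L \<le> \<bar>s - t\<bar> * L"
      using cmod_cis_diff_le \<open>0 \<le> L\<close> by (rule mult_right_mono)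
    finally show ?case
      by (simp add: z_def mult.commute)
  next
    case (Suc m)
    let ?A = "\<lambda>t. frame_matrix (average m t)"
    have "(\<lambda>k l. frame_matrix (average (Suc m) s) k l - frame_matrix (average (Suc m) t) k l) =
        (\<lambda>k l. 1/2 * ((?A (s / 2) k l - ?A (t / 2) k l) + (?A (s / 2 + pi) k l - ?A (t / 2 + pi) k l)))"
      unfolding frame_matrix_average_Suc by (intro ext) (simp add: algebra_simps)
    then have "nrm (\<lambda>k l. frame_matrix (average (Suc m) s) k l - frame_matrix (average (Suc m) t) k l) =
        1/2 * nrm (\<lambda>k l. (?A (s / 2) k l - ?A (t / 2) k l) + (?A (s / 2 + pi) k l - ?A (t / 2 + pi) k l))"
      using nrm_scale[OF add_closed[OF diff_closed diff_closed, OF frame_matrix_average frame_matrix_average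
            frame_matrix_average frame_matrix_average], of "1/2"] by simp
    also have "\<dots> \<le> 1/2 * (nrm (\<lambda>k l. ?A (s / 2) k l - ?A (t / 2) k l)
        + nrm (\<lambda>k l. ?A (s / 2 + pi) k l - ?A (t / 2 + pi) k l))"
      by (intro mult_left_mono nrm_triangle diff_closed frame_matrix_average) auto
    also have "\<dots> \<le> 1/2 * (L / 2 ^ m * \<bar>s / 2 - t / 2\<bar> + L / 2 ^ m * \<bar>(s / 2 + pi) - (t / 2 + pi)\<bar>)"
      by (intro mult_left_mono add_mono Suc.IH) auto
    also have "\<bar>(s / 2 + pi) - (t / 2 + pi)\<bar> = \<bar>s - t\<bar> / 2"
      by (simp add: diff_divide_distrib[symmetric])
    also have "\<bar>s / 2 - t / 2\<bar> = \<bar>s - t\<bar> / 2"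
      by (simp add: diff_divide_distrib[symmetric])
    finally show ?case
      by (simp add: field_simps)
  qed
  ultimately show thesis by (rule that)
qed

lemma bounded_clinear_funpow: "bounded_clinear T \<Longrightarrow> bounded_clinear (T ^^ n)"
  by (induction n) (auto simp: bounded_clinear_id bounded_clinear_compose id_def o_def)

definition scaled_inverse :: "'h \<Rightarrow> 'h" where
  "scaled_inverse f = scaleC (of_real radius) (R f)"

lemma bounded_clinear_scaled_inverse: "bounded_clinear (scaled_inverse ^^ n)"
proof -
  have "bounded_clinear scaled_inverse"
    unfolding scaled_inverse_def by (intro bounded_clinear_scaleC bounded_clinear_R)
  then show ?thesis by (rule bounded_clinear_funpow)
qed

lemma norm_scaled_inverse_le: "norm ((scaled_inverse ^^ n) f) \<le> (1/2) ^ n * norm f"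
proof (induction n)
  case (Suc n)
  have "norm (scaled_inverse g) \<le> 1/2 * norm g" for g
  proof -
    have "norm (R g) \<le> norm (S (R g)) / lower_bound"
      using bounded_clinear_S lower_bound_pos coercive_S
      by (intro coercive_bij(2)) (auto simp: bounded_clinear_def)
    then show ?thesis
      using lower_bound_pos by (simp add: scaled_inverse_def norm_scaleC radius_def field_simps)
  qed
  from order_trans[OF this mult_left_mono[OF Suc]] show ?case
    by simp
qed simp

text \<open>With N = 2^m nodes whose N-th powers have direction \<open>cis\<close> \<theta>, the
  average solves y = R f + cis \<theta> (radius R)^N y. This is the partial fraction identity for a
  geometric series, written implicitly so that nothing has to be inverted. In the induction step the
  two halves satisfy the equation with the square roots \<zeta> and -\<zeta> of \<open>cis\<close>
  \<theta>; each is substituted into itself once, and on averaging the terms linear in \<zeta>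
  cancel.\<close>

lemma average_eq:
  "average m \<theta> f = R f + scaleC (cis \<theta>) ((scaled_inverse ^^ (2 ^ m)) (average m \<theta> f))"
proof (induction m arbitrary: \<theta>)
  case 0
  define z where "z = complex_of_real radius * cis \<theta>"
  have z: "cmod z \<le> radius"
    using radius_pos by (simp add: z_def norm_mult)
  interpret R: bounded_linear R
    using bounded_clinear_R by (simp add: bounded_clinear_def)
  have "resolvent z f = R (S (resolvent z f))"
    by simp
  also have "\<dots> = R f + scaleC z (R (resolvent z f))"
    unfolding S_resolvent[OF z] by (simp add: R.add R_scaleC)
  finally show ?case
    by (simp add: scaled_inverse_def scaleC_scaleC z_def mult.commute)
next
  case (Suc m)
  define W where "W = scaled_inverse ^^ (2 ^ m)"
  have W: "bounded_linear W" "\<And>a x. W (scaleC a x) = scaleC a (W x)"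
    using bounded_clinear_scaled_inverse[of "2 ^ m"] unfolding W_def bounded_clinear_def by auto
  interpret W: bounded_linear W by fact
  define \<zeta> where "\<zeta> = cis (\<theta> / 2)"
  define u v where "u = average m (\<theta> / 2) f" and "v = average m (\<theta> / 2 + pi) f"
  have \<zeta>2: "cis (\<theta> / 2 + pi) = - \<zeta>" "cis \<theta> = \<zeta> * \<zeta>"
    by (auto simp: \<zeta>_def cis_mult complex_eq_iff)
  have u: "u = R f + scaleC \<zeta> (W u)"
    unfolding u_def W_def \<zeta>_def by (rule Suc)
  have "v = R f + scaleC (- \<zeta>) (W v)"
    unfolding v_def W_def \<zeta>2(1)[symmetric] by (rule Suc)
  then have v: "v = R f - scaleC \<zeta> (W v)"
    unfolding scaleC_minus_left diff_conv_add_uminus .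
  have "W u = W (R f) + scaleC \<zeta> (W (W u))"
    using arg_cong[OF u, of W] unfolding W.add W(2) .
  from trans[OF u arg_cong[OF this, of "\<lambda>x. R f + scaleC \<zeta> x"]]
  have u': "u = R f + scaleC \<zeta> (W (R f)) + scaleC (\<zeta> * \<zeta>) (W (W u))"
    unfolding scaleC_add_right scaleC_scaleC add.assoc .
  have "W v = W (R f) - scaleC \<zeta> (W (W v))"
    using arg_cong[OF v, of W] unfolding W.diff W(2) .
  from trans[OF v arg_cong[OF this, of "\<lambda>x. R f - scaleC \<zeta> x"]]
  have v': "v = R f - scaleC \<zeta> (W (R f)) + scaleC (\<zeta> * \<zeta>) (W (W v))"
    unfolding scaleC_diff_right scaleC_scaleC diff_diff_eq2 diff_add_eq .
  have half: "scaleC (1/2) (x + x) = x" for x :: 'h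
    using scaleC_add_left[of "1/2" "1/2" x] by (simp add: scaleC_add_right)
  define y where "y = average (Suc m) \<theta> f"
  have y: "y = scaleC (1/2) (u + v)"
    by (simp add: y_def u_def v_def)
  have "u + v = (R f + scaleC \<zeta> (W (R f)) + scaleC (\<zeta> * \<zeta>) (W (W u))) +
      (R f - scaleC \<zeta> (W (R f)) + scaleC (\<zeta> * \<zeta>) (W (W v)))"
    by (rule arg_cong2[OF u' v'])
  also have "\<dots> = (R f + R f) + scaleC (\<zeta> * \<zeta>) (W (W (u + v)))"
    by (simp add: W.add scaleC_add_right)
  finally have uv: "u + v = (R f + R f) + scaleC (\<zeta> * \<zeta>) (W (W (u + v)))" .
  have "y = scaleC (1/2) ((R f + R f) + scaleC (\<zeta> * \<zeta>) (W (W (u + v))))"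
    unfolding y by (rule arg_cong[OF uv])
  also have "\<dots> = R f + scaleC (\<zeta> * \<zeta>) (W (W y))"
    unfolding y by (simp add: scaleC_add_right[of "1/2" "R f + R f"] half W(2) scaleC_scaleC mult.commute)
  also have "W (W y) = (scaled_inverse ^^ (2 ^ Suc m)) y"
    by (simp add: W_def mult_2 funpow_add)
  finally show ?case
    unfolding y_def[symmetric] \<zeta>2(2) .
qed

text \<open>The implicit equation is used twice. With 2^m \<ge> 1 it shows that the averages have
  norm at most 2 \<open>norm (R f)\<close>, uniformly in m; with 2^m \<ge> m it then gives the rate
  (1/2)^m.\<close>

lemma average_tendsto: "(\<lambda>m. average m \<theta> f) \<longlonglongrightarrow> R f"
proof -
  have "norm (average m \<theta> f - R f) \<le> (1/2) ^ m * (2 * norm (R f))" for m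
  proof -
    let ?y = "average m \<theta> f"
    have "?y - R f = scaleC (cis \<theta>) ((scaled_inverse ^^ (2 ^ m)) ?y)"
      using average_eq[of m \<theta> f] by (metis add_diff_cancel_left')
    then have "norm (?y - R f) = norm ((scaled_inverse ^^ (2 ^ m)) ?y)"
      by (simp add: norm_scaleC)
    also have "\<dots> \<le> (1/2) ^ (2 ^ m) * norm ?y"
      by (rule norm_scaled_inverse_le)
    finally have 1: "norm (?y - R f) \<le> (1/2) ^ (2 ^ m) * norm ?y" .
    have "((1/2) ^ (2 ^ m) :: real) \<le> (1/2) ^ 1"
      by (intro power_decreasing) auto
    then have "(1/2) ^ (2 ^ m) * norm ?y \<le> 1/2 * norm ?y"
      by (intro mult_right_mono) auto
    with 1 have "norm (?y - R f) \<le> 1/2 * norm ?y"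
      by linarith
    moreover have "norm ?y \<le> norm (R f) + norm (?y - R f)"
      by (rule norm_triangle_sub)
    ultimately have "norm ?y \<le> 2 * norm (R f)"
      by linarith
    moreover have "((1/2) ^ (2 ^ m) :: real) \<le> (1/2) ^ m"
      by (intro power_decreasing) (auto simp: less_imp_le)
    ultimately have "(1/2) ^ (2 ^ m) * norm ?y \<le> (1/2) ^ m * (2 * norm (R f))"
      by (intro mult_mono) auto
    with 1 show ?thesis by linarith
  qed
  moreover have "(\<lambda>m. (1/2) ^ m * (2 * norm (R f))) \<longlonglongrightarrow> 0"
    by (intro tendsto_mult_left_zero LIMSEQ_power_zero) simp
  ultimately have "(\<lambda>m. average m \<theta> f - R f) \<longlonglongrightarrow> 0"
    by (rule Lim_null_comparison[OF always_eventually[OF allI]])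
  then show ?thesis
    by (simp add: Lim_null[symmetric])
qed

text \<open>For \<theta> = 0 the step from level m to m + 1 is half the difference of the level m
  averages at pi and at 0, hence at most L pi / 2^(m + 1) by \<open>average_Lipschitz\<close>. The
  limit in \<A> has the entries of \<open>frame_matrix R\<close>: \<open>entry_bounded\<close> turns
  norm limits into entrywise ones, and \<open>average_tendsto\<close> computes these.\<close>

lemma frame_matrix_R: "frame_matrix R \<in> \<A>"
proof -
  obtain L where L: "0 \<le> L"
    "\<And>m s t. nrm (\<lambda>k l. frame_matrix (average m s) k l - frame_matrix (average m t) k l) \<le> L / 2 ^ m * \<bar>s - t\<bar>"
    using average_Lipschitz by blast
  define X where "X m = frame_matrix (average m 0)" for m
  have X: "X m \<in> \<A>" for m
    by (simp add: X_def frame_matrix_average)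
  have step: "nrm (\<lambda>k l. X (Suc m) k l - X m k l) \<le> L * pi / 2 ^ m * (1/2)" for m
  proof -
    have "(\<lambda>k l. X (Suc m) k l - X m k l) =
        (\<lambda>k l. 1/2 * (frame_matrix (average m pi) k l - frame_matrix (average m 0) k l))"
      unfolding X_def frame_matrix_average_Suc by (intro ext) (simp add: algebra_simps)
    then have "nrm (\<lambda>k l. X (Suc m) k l - X m k l) =
        1/2 * nrm (\<lambda>k l. frame_matrix (average m pi) k l - frame_matrix (average m 0) k l)"
      using nrm_scale[OF diff_closed[OF frame_matrix_average frame_matrix_average], of "1/2"] by simp
    also have "\<dots> \<le> 1/2 * (L / 2 ^ m * \<bar>pi - 0\<bar>)"
      by (intro mult_left_mono L(2)) auto
    finally show ?thesis by (simp add: mult_ac)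
  qed
  \<comment> \<open>The factor 1 - 1 / 2^j is the exact partial geometric sum, which makes the
    induction close with equality.\<close>
  have tail: "nrm (\<lambda>k l. X (m + j) k l - X m k l) \<le> L * pi / 2 ^ m * (1 - 1 / 2 ^ j)" for m j
  proof (induction j)
    case 0
    show ?case
      using nrm_scale[OF X[of m], of 0] by simp
  next
    case (Suc j)
    have "nrm (\<lambda>k l. X (m + Suc j) k l - X m k l) \<le>
        nrm (\<lambda>k l. X (Suc (m + j)) k l - X (m + j) k l) + nrm (\<lambda>k l. X (m + j) k l - X m k l)"
      using nrm_diff_triangle[OF X X X] by simp
    also have "\<dots> \<le> L * pi / 2 ^ (m + j) * (1/2) + L * pi / 2 ^ m * (1 - 1 / 2 ^ j)"
      by (intro add_mono step Suc)
    also have "\<dots> = L * pi / 2 ^ m * (1 - 1 / 2 ^ Suc j)"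
      by (simp add: power_add field_simps)
    finally show ?case .
  qed
  have "\<exists>A\<in>\<A>. (\<lambda>n. nrm (\<lambda>k l. X n k l - A k l)) \<longlonglongrightarrow> 0"
  proof (rule complete[OF X], intro allI impI)
    fix \<epsilon> :: real assume "0 < \<epsilon>"
    have "(\<lambda>m. L * pi * (1/2) ^ m) \<longlonglongrightarrow> 0"
      by (intro tendsto_mult_right_zero LIMSEQ_power_zero) simp
    then have "\<forall>\<^sub>F m in sequentially. L * pi * (1/2) ^ m < \<epsilon> / 2"
      using \<open>0 < \<epsilon>\<close> by (intro order_tendstoD) auto
    then obtain M where M: "L * pi * (1/2) ^ M < \<epsilon> / 2"
      by (auto simp: eventually_sequentially)
    have close: "nrm (\<lambda>k l. X m k l - X M k l) < \<epsilon> / 2" if "M \<le> m" for m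
    proof -
      have "nrm (\<lambda>k l. X m k l - X M k l) \<le> L * pi / 2 ^ M * (1 - 1 / 2 ^ (m - M))"
        using tail[of M "m - M"] that by simp
      also have "\<dots> \<le> L * pi / 2 ^ M * 1"
        using L(1) by (intro mult_left_mono) auto
      also have "\<dots> = L * pi * (1/2) ^ M"
        by (simp add: power_divide)
      finally show ?thesis
        using M by (rule le_less_trans)
    qed
    have "nrm (\<lambda>k l. X m k l - X n k l) < \<epsilon>" if "M \<le> m" "M \<le> n" for m n
      using nrm_diff_triangle[OF X X X, of m n M] close[OF that(1)] close[OF that(2)]
        nrm_diff_commute[OF X X, of M n] by linarith
    then show "\<exists>N. \<forall>m\<ge>N. \<forall>n\<ge>N. nrm (\<lambda>k l. X m k l - X n k l) < \<epsilon>"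
      by blast
  qed
  then obtain A where A: "A \<in> \<A>" "(\<lambda>n. nrm (\<lambda>k l. X n k l - A k l)) \<longlonglongrightarrow> 0"
    by blast
  have "A k l = frame_matrix R k l" for k l
  proof -
    obtain C where C: "\<And>B. B \<in> \<A> \<Longrightarrow> cmod (B k l) \<le> C * nrm B"
      using entry_bounded by blast
    have "(\<lambda>n. X n k l - A k l) \<longlonglongrightarrow> 0"
    proof (rule Lim_null_comparison)
      show "\<forall>\<^sub>F n in sequentially. cmod (X n k l - A k l) \<le> C * nrm (\<lambda>k l. X n k l - A k l)"
        using C[OF diff_closed[OF X A(1)]] by simp
      show "(\<lambda>n. C * nrm (\<lambda>k l. X n k l - A k l)) \<longlonglongrightarrow> 0"
        using A(2) by (rule tendsto_mult_right_zero)
    qed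
    then have "(\<lambda>n. X n k l) \<longlonglongrightarrow> A k l"
      by (simp add: Lim_null[symmetric])
    moreover have "(\<lambda>n. X n k l) \<longlonglongrightarrow> frame_matrix R k l"
      unfolding X_def frame_matrix_apply
      using bounded_linear.tendsto[OF bounded_linear_cinner_left average_tendsto]
      by (cases "k \<in> K \<and> l \<in> K") (simp_all only: if_True if_False simp_thms tendsto_const)
    ultimately show ?thesis
      by (rule LIMSEQ_unique)
  qed
  then have "A = frame_matrix R"
    by blast
  with A(1) show ?thesis by simp
qed

text \<open>P = \<open>frame_matrix R\<close> is the orthogonal projection onto the range of
  analysis. Hence 1 + G - P acts as the Gram matrix G on that range and as 1 on its complement, so
  it is invertible, with inverse 1 + G' - P where G' is the pseudo-inverse of G. This G' is the
  matrix sought, the Gram matrix of the dual frame.\<close>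

lemma frame_matrix_R2: "frame_matrix (\<lambda>f. R (R f)) \<in> \<A>"
proof -
  interpret R: bounded_linear R
    using bounded_clinear_R by (simp add: bounded_clinear_def)
  interpret S: bounded_linear S
    using bounded_clinear_S by (simp add: bounded_clinear_def)
  have RR: "bounded_clinear (\<lambda>f. R (R f))"
    by (rule bounded_clinear_compose[OF bounded_clinear_R bounded_clinear_R])
  have "frame_matrix (\<lambda>f. R (R f) - R f) \<in> \<A>"
  proof (rule frame_matrix_quasi_inverse)
    show "bounded_clinear (\<lambda>f. f - R f)"
      by (intro bounded_clinear_diff bounded_clinear_R bounded_clinear_id)
    show "bounded_clinear (\<lambda>f. R (R f) - R f)"
      by (intro bounded_clinear_diff bounded_clinear_R RR)
    show "frame_matrix (\<lambda>f. f - R f) \<in> \<A>"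
      by (intro frame_matrix_diff frame_matrix_id frame_matrix_R)
  qed (simp_all add: S.diff R.diff)
  from frame_matrix_diff[OF this, of "\<lambda>f. scaleC (-1) (R f)"] frame_matrix_scaleC[OF frame_matrix_R, of "-1"]
  show ?thesis
    by (simp add: scaleC_minus_left)
qed

lemma cross_gram_dual_left: "cross_gram K (dual_frame K \<psi>) \<psi> \<in> \<A>"
  using frame_matrix_R by (simp add: frame_matrix_def cross_gram_def dual_frame_eq cinner_R_commute cong: if_cong)

lemma cross_gram_dual_right: "cross_gram K \<psi> (dual_frame K \<psi>) \<in> \<A>"
  using frame_matrix_R by (simp add: frame_matrix_def cross_gram_def dual_frame_eq cong: if_cong)

lemma cross_gram_dual_dual: "cross_gram K (dual_frame K \<psi>) (dual_frame K \<psi>) \<in> \<A>"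
  using frame_matrix_R2 by (simp add: frame_matrix_def cross_gram_def dual_frame_eq cinner_R_commute cong: if_cong)

end

no_notation Infinite_Set_Sum.abs_summable_on (infix "abs'_summable'_on" 50)

section \<open>Matrices acting on weighted sequence spaces\<close>

text \<open>The matrix of absolute values maps the extremal sequence 1 / w to at most C / w, that
  is, it is bounded on the weighted \<open>\<ell>\<^sup>\<infinity>\<close> space. Passing to
  absolute values makes interchanges of summation legitimate.\<close>

definition row_bounded :: "'i set \<Rightarrow> ('i \<Rightarrow> real) \<Rightarrow> 'i matrix \<Rightarrow> bool" where
  "row_bounded K w A \<longleftrightarrow> A \<in> matrices K \<and>
     (\<exists>C\<ge>0. \<forall>k\<in>K. (\<lambda>l. cmod (A k l) / w l) summable_on K \<and> (\<Sum>\<^sub>\<infinity>l\<in>K. cmod (A k l) / w l) \<le> C / w k)"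

text \<open>The action on row vectors. On \<open>\<ell>\<^sup>1\<close> with weight 1 / w it is the
  preadjoint of \<open>mat_app K A\<close> for the bilinear pairing, without conjugation.\<close>

definition vec_mat :: "'i set \<Rightarrow> ('i \<Rightarrow> complex) \<Rightarrow> 'i matrix \<Rightarrow> 'i \<Rightarrow> complex" where
  "vec_mat K e A = (\<lambda>l. \<Sum>\<^sub>\<infinity>k\<in>K. e k * A k l)"

lemma mat_mult_eq_vec_mat: "mat_mult K A B k = vec_mat K (A k) B"
  by (simp add: mat_mult_def vec_mat_def)

lemma matrices_outside: "A \<in> matrices K \<Longrightarrow> k \<notin> K \<or> l \<notin> K \<Longrightarrow> A k l = 0"
  unfolding matrices_def by blast

lemma mat_app_outside: "A \<in> matrices K \<Longrightarrow> k \<notin> K \<Longrightarrow> mat_app K A c k = 0"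
  by (simp add: mat_app_def matrices_outside)

lemma vec_mat_outside: "A \<in> matrices K \<Longrightarrow> l \<notin> K \<Longrightarrow> vec_mat K e A l = 0"
  by (simp add: vec_mat_def matrices_outside)

lemma infsum_diff:
  fixes f g :: "'i \<Rightarrow> complex"
  assumes "f summable_on K" "g summable_on K"
  shows "(\<Sum>\<^sub>\<infinity>k\<in>K. f k - g k) = infsum f K - infsum g K"
  using infsum_add[OF assms(1), of "\<lambda>k. - g k"] assms(2) by (simp add: infsum_uminus summable_on_uminus)

text \<open>Dominated convergence along sequences. It carries the reproducing formula from Hilbert
  space vectors to their classes, and conversely builds a class from a sequence fixed by
  \<open>proj\<close>.\<close>

lemma tendsto_infsum_dominated:
  fixes x :: "nat \<Rightarrow> 'i \<Rightarrow> complex"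
  assumes g: "g summable_on K" and dom: "\<And>n l. l \<in> K \<Longrightarrow> cmod (x n l) \<le> g l"
    and lim: "\<And>l. l \<in> K \<Longrightarrow> (\<lambda>n. x n l) \<longlonglongrightarrow> y l"
  shows "y summable_on K" "(\<lambda>n. infsum (x n) K) \<longlonglongrightarrow> infsum y K"
proof -
  have dom_y: "cmod (y l) \<le> g l" if "l \<in> K" for l
    using tendsto_norm[OF lim[OF that]] dom[OF that] by (intro LIMSEQ_le_const2) auto
  have g_nonneg: "0 \<le> g l" if "l \<in> K" for l
    using dom[OF that, of 0] norm_ge_zero order_trans by blast
  have abs: "z abs_summable_on K" if "\<And>l. l \<in> K \<Longrightarrow> cmod (z l) \<le> g l" for z :: "'i \<Rightarrow> complex"
    by (rule summable_on_comparison_test[OF g]) (use that in auto)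
  have sx: "x n summable_on K" for n
    using abs[OF dom] by (rule abs_summable_summable)
  show sy: "y summable_on K"
    using abs[OF dom_y] by (rule abs_summable_summable)
  show "(\<lambda>n. infsum (x n) K) \<longlonglongrightarrow> infsum y K"
  proof (rule LIMSEQ_I)
    fix \<epsilon> :: real assume "0 < \<epsilon>"
    obtain F where F: "finite F" "F \<subseteq> K" "dist (sum g F) (infsum g K) \<le> \<epsilon> / 8"
      using infsum_finite_approximation[OF g, of "\<epsilon> / 8"] \<open>0 < \<epsilon>\<close> by auto
    have gF: "infsum g (K - F) \<le> \<epsilon> / 8"
    proof -
      have "infsum g (K - F) = infsum g K - sum g F"
        using F g by (simp add: infsum_Diff)
      then show ?thesis
        using F(3) unfolding dist_real_def by linarith
    qed
    have "(\<lambda>n. \<Sum>l\<in>F. x n l) \<longlonglongrightarrow> (\<Sum>l\<in>F. y l)"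
      using F lim by (intro tendsto_sum) auto
    then obtain n0 where n0: "\<And>n. n0 \<le> n \<Longrightarrow> cmod ((\<Sum>l\<in>F. x n l) - (\<Sum>l\<in>F. y l)) < \<epsilon> / 2"
      using LIMSEQ_D[of _ _ "\<epsilon> / 2"] \<open>0 < \<epsilon>\<close> by fastforce
    have tail: "cmod (infsum z (K - F)) \<le> \<epsilon> / 8"
      if z: "\<And>l. l \<in> K \<Longrightarrow> cmod (z l) \<le> g l" for z :: "'i \<Rightarrow> complex"
    proof -
      have "z abs_summable_on (K - F)"
        using abs[OF z] by (rule summable_on_subset_banach) auto
      then have "cmod (infsum z (K - F)) \<le> (\<Sum>\<^sub>\<infinity>l\<in>K - F. cmod (z l))"
        by (rule norm_infsum_bound)
      also have "\<dots> \<le> infsum g (K - F)"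
        using z summable_on_subset_banach[OF g, of "K - F"] summable_on_subset_banach[OF abs[OF z], of "K - F"]
        by (intro infsum_mono) auto
      finally show ?thesis using gF by simp
    qed
    have split: "infsum z K = sum z F + infsum z (K - F)" if "z summable_on K" for z :: "'i \<Rightarrow> complex"
      using F that by (simp add: infsum_Diff)
    have "cmod (infsum (x n) K - infsum y K) < \<epsilon>" if "n0 \<le> n" for n
    proof -
      have "infsum (x n) K - infsum y K =
          (sum (x n) F - sum y F) + (infsum (x n) (K - F) - infsum y (K - F))"
        unfolding split[OF sx] split[OF sy] by simp
      also have "cmod \<dots> \<le> cmod (sum (x n) F - sum y F) +
          (cmod (infsum (x n) (K - F)) + cmod (infsum y (K - F)))"
        using norm_triangle_ineq norm_triangle_ineq4 add_left_mono order_trans by blast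
      also have "\<dots> < \<epsilon> / 2 + (\<epsilon> / 8 + \<epsilon> / 8)"
        using n0[OF that] tail[of "x n", OF dom] tail[of y, OF dom_y] by linarith
      finally show ?thesis
        using \<open>0 < \<epsilon>\<close> by simp
    qed
    then show "\<exists>n0. \<forall>n\<ge>n0. cmod (infsum (x n) K - infsum y K) < \<epsilon>"
      by blast
  qed
qed

text \<open>Carries the weighted \<open>\<ell>\<^sup>\<infinity>\<close> space \<open>inf\<close>
  together with its predual \<open>dual\<close>, the \<open>\<ell>\<^sup>1\<close> space of the
  reciprocal weight.\<close>

locale weight =
  fixes K :: "'i set" and w :: "'i \<Rightarrow> real"
  assumes pos: "k \<in> K \<Longrightarrow> 0 < w k"
begin

sublocale inf: weighted_lp K w \<infinity>
  by unfold_locales (auto simp: pos)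

sublocale dual: weighted_lp K "\<lambda>k. 1 / w k" 1
  by unfold_locales (auto simp: pos)

lemma cmod_le_linf: "c \<in> inf.\<L> \<Longrightarrow> k \<in> K \<Longrightarrow> cmod (c k) \<le> inf.N c / w k"
  using inf.weighted_le_norm[of c k] pos[of k] by (simp add: field_simps)

lemma mem_dual_iff: "e \<in> dual.\<L> \<longleftrightarrow> (\<forall>k. k \<notin> K \<longrightarrow> e k = 0) \<and> (\<lambda>k. cmod (e k) / w k) summable_on K"
  using lp_space_1_iff[of K "\<lambda>k. 1 / w k" e] pos by simp

lemma norm_dual: "dual.N e = (\<Sum>\<^sub>\<infinity>k\<in>K. cmod (e k) / w k)"
  using lp_norm_1[of K "\<lambda>k. 1 / w k" e] pos by simp

lemma row_mem_dual: "row_bounded K w A \<Longrightarrow> k \<in> K \<Longrightarrow> A k \<in> dual.\<L>"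
  unfolding mem_dual_iff row_bounded_def matrices_def by blast

lemma pairing_abs_summable:
  assumes c: "c \<in> inf.\<L>" and e: "e \<in> dual.\<L>"
  shows "(\<lambda>k. c k * e k) abs_summable_on K"
proof (rule summable_on_comparison_test)
  show "(\<lambda>k. inf.N c * (cmod (e k) / w k)) summable_on K"
    using e by (intro summable_on_cmult_right) (simp add: mem_dual_iff)
  show "cmod (c k * e k) \<le> inf.N c * (cmod (e k) / w k)" if "k \<in> K" for k
    using mult_right_mono[OF cmod_le_linf[OF c that], of "cmod (e k)"] by (simp add: norm_mult)
qed auto

text \<open>The largest sequence of the unit ball: applied to it, a matrix of absolute values
  displays its weighted absolute row sums.\<close>

lemma inverse_weight_mem: "(\<lambda>k. if k \<in> K then complex_of_real (1 / w k) else 0) \<in> inf.\<L>"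
  and inverse_weight_norm: "inf.N (\<lambda>k. if k \<in> K then complex_of_real (1 / w k) else 0) \<le> 1"
proof -
  have le: "w k * cmod (if k \<in> K then complex_of_real (1 / w k) else 0) \<le> 1" if "k \<in> K" for k
    using pos[OF that] that by (simp add: norm_divide)
  then show "(\<lambda>k. if k \<in> K then complex_of_real (1 / w k) else 0) \<in> inf.\<L>"
    unfolding inf.mem_infinity[OF refl] linf_space_iff by auto
  show "inf.N (\<lambda>k. if k \<in> K then complex_of_real (1 / w k) else 0) \<le> 1"
    by (rule inf.norm_le_sup) (use le in auto)
qed

text \<open>The inner absolute sum over l is at most a constant times the norm of c divided by w k,
  and what remains is the norm series of e. All associativity statements below are Fubini's theorem
  for this family.\<close>

lemma triple_abs_summable:
  assumes A: "row_bounded K w A" and c: "c \<in> inf.\<L>" and e: "e \<in> dual.\<L>"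
  shows "(\<lambda>(k, l). e k * A k l * c l) abs_summable_on K \<times> K"
proof -
  obtain C where C: "0 \<le> C" "\<And>k. k \<in> K \<Longrightarrow> (\<lambda>l. cmod (A k l) / w l) summable_on K"
    "\<And>k. k \<in> K \<Longrightarrow> (\<Sum>\<^sub>\<infinity>l\<in>K. cmod (A k l) / w l) \<le> C / w k"
    using A unfolding row_bounded_def by blast
  define N where "N = inf.N c"
  have "0 \<le> N"
    using inf.norm_nonneg[OF c] by (simp add: N_def)
  have le: "cmod (e k * A k l * c l) \<le> cmod (e k) * N * (cmod (A k l) / w l)" if "l \<in> K" for k l
    using mult_left_mono[OF cmod_le_linf[OF c that], of "cmod (e k) * cmod (A k l)"]
    by (simp add: norm_mult N_def mult_ac)
  have dom: "(\<lambda>l. cmod (e k) * N * (cmod (A k l) / w l)) summable_on K" if "k \<in> K" for k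
    by (intro summable_on_cmult_right C that)
  have inner: "(\<lambda>l. e k * A k l * c l) abs_summable_on K" if "k \<in> K" for k
    by (rule summable_on_comparison_test[OF dom[OF that]]) (use le in auto)
  have "(\<Sum>\<^sub>\<infinity>l\<in>K. cmod (e k * A k l * c l)) \<le> N * C * (cmod (e k) / w k)" if "k \<in> K" for k
  proof -
    have "(\<Sum>\<^sub>\<infinity>l\<in>K. cmod (e k * A k l * c l)) \<le> (\<Sum>\<^sub>\<infinity>l\<in>K. cmod (e k) * N * (cmod (A k l) / w l))"
      by (intro infsum_mono inner dom le that)
    also have "\<dots> = cmod (e k) * N * (\<Sum>\<^sub>\<infinity>l\<in>K. cmod (A k l) / w l)"
      by (rule infsum_cmult_right')
    also have "\<dots> \<le> cmod (e k) * N * (C / w k)"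
      using C(3)[OF that] \<open>0 \<le> N\<close> by (intro mult_left_mono) auto
    finally show ?thesis by (simp add: mult_ac)
  qed
  note bound = this
  have "(\<lambda>k. N * C * (cmod (e k) / w k)) summable_on K"
    using e by (intro summable_on_cmult_right) (simp add: mem_dual_iff)
  then have "(\<lambda>k. \<Sum>\<^sub>\<infinity>l\<in>K. cmod (e k * A k l * c l)) summable_on K"
    by (rule summable_on_comparison_test) (use bound in \<open>auto simp: infsum_nonneg\<close>)
  then show ?thesis
    unfolding Infinite_Sum.abs_summable_on_Sigma_iff using inner by (simp add: infsum_nonneg)
qed

lemma vec_mat_dual:
  assumes A: "row_bounded K w A"
  shows vec_mat_summable: "e \<in> dual.\<L> \<Longrightarrow> (\<lambda>k. e k * A k l) summable_on K"
    and vec_mat_mem_dual: "e \<in> dual.\<L> \<Longrightarrow> vec_mat K e A \<in> dual.\<L>"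
    and norm_vec_mat_le: "\<exists>C. \<forall>e\<in>dual.\<L>. dual.N (vec_mat K e A) \<le> C * dual.N e"
proof -
  obtain C where C: "0 \<le> C" "\<And>k. k \<in> K \<Longrightarrow> (\<lambda>l. cmod (A k l) / w l) summable_on K"
    "\<And>k. k \<in> K \<Longrightarrow> (\<Sum>\<^sub>\<infinity>l\<in>K. cmod (A k l) / w l) \<le> C / w k"
    using A unfolding row_bounded_def by blast
  have *: "(\<lambda>k. e k * A k l) summable_on K \<and> vec_mat K e A \<in> dual.\<L> \<and>
      dual.N (vec_mat K e A) \<le> C * dual.N e" if e: "e \<in> dual.\<L>" for e l
  proof (intro conjI)
    \<comment> \<open>For this extremal sequence the family of \<open>triple_abs_summable\<close>
      has absolute values \<open>?f k l\<close>. Exchanging the order of summation gives column sums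
      and the \<open>\<ell>\<^sup>1\<close> bound together.\<close>
    let ?c = "\<lambda>k. if k \<in> K then complex_of_real (1 / w k) else 0"
    let ?f = "\<lambda>k l. cmod (e k) * (cmod (A k l) / w l)"
    have "(\<lambda>(k, l). e k * A k l * ?c l) abs_summable_on K \<times> K"
      by (rule triple_abs_summable[OF A inverse_weight_mem e])
    moreover have "cmod ((\<lambda>(k, l). e k * A k l * ?c l) x) = (\<lambda>(k, l). ?f k l) x" if "x \<in> K \<times> K" for x
      using that pos by (auto simp: norm_mult norm_divide abs_of_pos)
    ultimately have f: "(\<lambda>(k, l). ?f k l) summable_on K \<times> K"
      by (rule summable_on_cong[THEN iffD1, rotated])
    then have f': "(\<lambda>(l, k). ?f k l) summable_on K \<times> K"
      by (subst (asm) summable_on_swap) (simp add: case_prod_unfold)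
    have abs: "(\<lambda>k. e k * A k l) abs_summable_on K" if "l \<in> K" for l
    proof -
      have "(\<lambda>k. w l * ?f k l) summable_on K"
        using summable_on_SigmaD1[OF f' that] by (intro summable_on_cmult_right) simp
      then show ?thesis
        using pos[OF that] by (simp add: norm_mult)
    qed
    show "(\<lambda>k. e k * A k l) summable_on K"
    proof (cases "l \<in> K")
      case True
      show ?thesis
        by (rule abs_summable_summable[OF abs[OF True]])
    next
      case False
      then show ?thesis
        using A matrices_outside[of A K] by (simp add: row_bounded_def)
    qed
    have le: "cmod (vec_mat K e A l) / w l \<le> (\<Sum>\<^sub>\<infinity>k\<in>K. ?f k l)" if "l \<in> K" for l
    proof -
      have "cmod (vec_mat K e A l) / w l \<le> (\<Sum>\<^sub>\<infinity>k\<in>K. cmod (e k * A k l)) / w l"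
        unfolding vec_mat_def using norm_infsum_bound[OF abs[OF that]] pos[OF that]
        by (simp add: divide_right_mono)
      also have "\<dots> = (\<Sum>\<^sub>\<infinity>k\<in>K. cmod (e k * A k l) * (1 / w l))"
        by (simp only: infsum_cmult_left' divide_inverse mult_1_left)
      also have "\<dots> = (\<Sum>\<^sub>\<infinity>k\<in>K. ?f k l)"
        by (simp add: norm_mult)
      finally show ?thesis .
    qed
    note outer = summable_on_Sigma_banach[OF f']
    have "(\<lambda>l. cmod (vec_mat K e A l) / w l) summable_on K"
      by (rule summable_on_comparison_test[OF outer]) (use le pos in \<open>auto simp: less_imp_le\<close>)
    then show mem: "vec_mat K e A \<in> dual.\<L>"
      using A by (simp add: mem_dual_iff vec_mat_outside row_bounded_def)
    have "dual.N (vec_mat K e A) \<le> (\<Sum>\<^sub>\<infinity>l\<in>K. \<Sum>\<^sub>\<infinity>k\<in>K. ?f k l)"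
      unfolding norm_dual using mem outer le by (intro infsum_mono) (auto simp: mem_dual_iff)
    also have "\<dots> = (\<Sum>\<^sub>\<infinity>k\<in>K. \<Sum>\<^sub>\<infinity>l\<in>K. ?f k l)"
      by (rule infsum_swap_banach[OF f'])
    also have "\<dots> \<le> (\<Sum>\<^sub>\<infinity>k\<in>K. C * (cmod (e k) / w k))"
    proof (rule infsum_mono)
      show "(\<lambda>k. \<Sum>\<^sub>\<infinity>l\<in>K. ?f k l) summable_on K"
        by (rule summable_on_Sigma_banach[OF f])
      show "(\<lambda>k. C * (cmod (e k) / w k)) summable_on K"
        using e by (intro summable_on_cmult_right) (simp add: mem_dual_iff)
      show "(\<Sum>\<^sub>\<infinity>l\<in>K. ?f k l) \<le> C * (cmod (e k) / w k)" if "k \<in> K" for k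
      proof -
        have "(\<Sum>\<^sub>\<infinity>l\<in>K. ?f k l) = cmod (e k) * (\<Sum>\<^sub>\<infinity>l\<in>K. cmod (A k l) / w l)"
          by (rule infsum_cmult_right')
        also have "\<dots> \<le> cmod (e k) * (C / w k)"
          by (intro mult_left_mono C(3)[OF that]) simp
        finally show ?thesis by (simp add: mult_ac)
      qed
    qed
    also have "\<dots> = C * dual.N e"
      unfolding norm_dual by (rule infsum_cmult_right')
    finally show "dual.N (vec_mat K e A) \<le> C * dual.N e" .
  qed
  then show "e \<in> dual.\<L> \<Longrightarrow> (\<lambda>k. e k * A k l) summable_on K"
    "e \<in> dual.\<L> \<Longrightarrow> vec_mat K e A \<in> dual.\<L>"
    "\<exists>C. \<forall>e\<in>dual.\<L>. dual.N (vec_mat K e A) \<le> C * dual.N e"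
    by blast+
qed

lemma mat_app_abs_summable:
  "row_bounded K w A \<Longrightarrow> c \<in> inf.\<L> \<Longrightarrow> k \<in> K \<Longrightarrow> (\<lambda>l. A k l * c l) abs_summable_on K"
  using pairing_abs_summable[OF _ row_mem_dual, of c A k] by (simp add: mult.commute)

lemma mat_app_summable:
  assumes A: "row_bounded K w A" and c: "c \<in> inf.\<L>"
  shows "(\<lambda>l. A k l * c l) summable_on K"
proof (cases "k \<in> K")
  case True
  show ?thesis
    by (rule abs_summable_summable[OF mat_app_abs_summable[OF A c True]])
next
  case False
  then show ?thesis
    using A matrices_outside[of A K] by (simp add: row_bounded_def)
qed

lemma mat_bounded_linf:
  assumes A: "row_bounded K w A"
  shows "mat_bounded K \<infinity> w \<infinity> w A"
proof -
  obtain C where C: "0 \<le> C" "\<And>k. k \<in> K \<Longrightarrow> (\<lambda>l. cmod (A k l) / w l) summable_on K"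
    "\<And>k. k \<in> K \<Longrightarrow> (\<Sum>\<^sub>\<infinity>l\<in>K. cmod (A k l) / w l) \<le> C / w k"
    using A unfolding row_bounded_def by blast
  have mat: "A \<in> matrices K"
    using A by (simp add: row_bounded_def)
  have le: "w k * cmod (mat_app K A c k) \<le> C * inf.N c" if k: "k \<in> K" and c: "c \<in> inf.\<L>" for k c
  proof -
    have "cmod (mat_app K A c k) \<le> (\<Sum>\<^sub>\<infinity>l\<in>K. cmod (A k l * c l))"
      unfolding mat_app_def by (rule norm_infsum_bound[OF mat_app_abs_summable[OF A c k]])
    also have "\<dots> \<le> (\<Sum>\<^sub>\<infinity>l\<in>K. inf.N c * (cmod (A k l) / w l))"
    proof (rule infsum_mono)
      show "(\<lambda>l. inf.N c * (cmod (A k l) / w l)) summable_on K"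
        by (intro summable_on_cmult_right C k)
      show "cmod (A k l * c l) \<le> inf.N c * (cmod (A k l) / w l)" if "l \<in> K" for l
        using mult_left_mono[OF cmod_le_linf[OF c that], of "cmod (A k l)"]
        by (simp add: norm_mult mult_ac)
    qed (rule mat_app_abs_summable[OF A c k])
    also have "\<dots> = inf.N c * (\<Sum>\<^sub>\<infinity>l\<in>K. cmod (A k l) / w l)"
      by (rule infsum_cmult_right')
    also have "\<dots> \<le> inf.N c * (C / w k)"
      by (intro mult_left_mono C(3)[OF k] inf.norm_nonneg[OF c])
    finally show ?thesis
      using pos[OF k] by (simp add: field_simps)
  qed
  have "mat_app K A c \<in> inf.\<L>" if "c \<in> inf.\<L>" for c
    unfolding inf.mem_infinity[OF refl] linf_space_iff using le[OF _ that] mat_app_outside[OF mat] by blast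
  moreover have "inf.N (mat_app K A c) \<le> C * inf.N c" if "c \<in> inf.\<L>" for c
    by (rule inf.norm_le_sup) (use le[OF _ that] C(1) inf.norm_nonneg[OF that] in auto)
  ultimately show ?thesis
    unfolding mat_bounded_def using mat mat_app_summable[OF A] by blast
qed

lemma mat_app_mem_linf: "row_bounded K w A \<Longrightarrow> c \<in> inf.\<L> \<Longrightarrow> mat_app K A c \<in> inf.\<L>"
  using mat_bounded_linf unfolding mat_bounded_def by blast

lemma mat_app_swap:
  assumes A: "row_bounded K w A" and c: "c \<in> inf.\<L>" and e: "e \<in> dual.\<L>"
  shows "(\<Sum>\<^sub>\<infinity>k\<in>K. e k * mat_app K A c k) = (\<Sum>\<^sub>\<infinity>l\<in>K. vec_mat K e A l * c l)"
proof -
  have sum: "(\<lambda>(k, l). e k * A k l * c l) summable_on K \<times> K"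
    using triple_abs_summable[OF A c e] by (rule abs_summable_summable)
  have "(\<Sum>\<^sub>\<infinity>k\<in>K. e k * mat_app K A c k) = (\<Sum>\<^sub>\<infinity>k\<in>K. \<Sum>\<^sub>\<infinity>l\<in>K. e k * A k l * c l)"
    unfolding mat_app_def by (simp add: infsum_cmult_right'[symmetric] mult.assoc)
  also have "\<dots> = (\<Sum>\<^sub>\<infinity>l\<in>K. \<Sum>\<^sub>\<infinity>k\<in>K. e k * A k l * c l)"
    by (rule infsum_swap_banach[OF sum])
  also have "\<dots> = (\<Sum>\<^sub>\<infinity>l\<in>K. vec_mat K e A l * c l)"
    unfolding vec_mat_def by (simp add: infsum_cmult_left'[symmetric])
  finally show ?thesis .
qed

text \<open>Each row of A is an element of the predual, so this is \<open>mat_app_swap\<close> with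
  e = A k, row by row.\<close>

lemma mat_app_mat_app:
  assumes A: "row_bounded K w A" and B: "row_bounded K w B" and c: "c \<in> inf.\<L>"
  shows "mat_app K A (mat_app K B c) = mat_app K (mat_mult K A B) c"
proof
  fix k
  have mat: "A \<in> matrices K" "B \<in> matrices K"
    using A B by (auto simp: row_bounded_def)
  show "mat_app K A (mat_app K B c) k = mat_app K (mat_mult K A B) c k"
  proof (cases "k \<in> K")
    case True
    show ?thesis
      using mat_app_swap[OF B c row_mem_dual[OF A True]]
      by (simp add: mat_app_def[of K A] mat_app_def[of K "mat_mult K A B"] mat_mult_eq_vec_mat)
  next
    case False
    then show ?thesis
      using matrices_outside[OF mat(1)] by (simp add: mat_app_def mat_mult_def)
  qed
qed

end

text \<open>The action of A on columns is the action of its transpose on rows. Taken for the weight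
  1 / w, the predual in \<open>vec_mat_dual\<close> is \<open>\<ell>\<^sup>1\<close> with weight
  w.\<close>

lemma mat_bounded_l1:
  assumes pos: "\<And>k. k \<in> K \<Longrightarrow> 0 < w k" and A: "row_bounded K (\<lambda>k. 1 / w k) (\<lambda>k l. A l k)"
  shows "mat_bounded K 1 w 1 w A"
proof -
  interpret weight K "\<lambda>k. 1 / w k"
    by unfold_locales (simp add: pos)
  have eq: "mat_app K A c = vec_mat K c (\<lambda>k l. A l k)" for c
    by (simp add: mat_app_def vec_mat_def mult.commute)
  obtain C where C: "\<And>e. e \<in> dual.\<L> \<Longrightarrow> dual.N (vec_mat K e (\<lambda>k l. A l k)) \<le> C * dual.N e"
    using norm_vec_mat_le[OF A] by blast
  have mat: "A \<in> matrices K"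
    using A by (auto simp: row_bounded_def matrices_def)
  show ?thesis
    unfolding mat_bounded_def
    using C vec_mat_mem_dual[OF A] vec_mat_summable[OF A] mat
    by (auto simp: eq mult.commute)
qed

text \<open>Admissibility is silent about p = 0. Finite sequences lie in
  \<open>\<ell>\<^sup>1\<close>, which A preserves and which is contained in
  \<open>\<ell>\<^sup>0\<close>; the \<open>\<ell>\<^sup>\<infinity>\<close> bound carries this to
  uniform limits.\<close>

lemma mat_bounded_l0:
  assumes pos: "\<And>k. k \<in> K \<Longrightarrow> 0 < w k" and A: "row_bounded K w A"
    and A': "row_bounded K (\<lambda>k. 1 / w k) (\<lambda>k l. A l k)"
  shows "mat_bounded K 0 w 0 w A"
proof -
  interpret weight K w by unfold_locales (rule pos)
  interpret l0: weighted_lp K w 0 by unfold_locales (auto simp: pos)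
  interpret l1: weighted_lp K w 1 by unfold_locales (auto simp: pos)
  have norm_eq: "l0.N = inf.N"
    by (auto simp: lp_norm_def)
  have l1_l0: "c \<in> l0.\<L>" if c: "c \<in> l1.\<L>" for c
  proof (rule l0.mem_zero_closed[OF refl])
    show "c k = 0" if "k \<notin> K" for k
      by (rule l1.zero_outside[OF c that])
    fix \<epsilon> :: real assume "0 < \<epsilon>"
    have "\<forall>\<^sub>F J in finite_subsets_at_top K. l1.N (\<lambda>k. c k - trunc J c k) < \<epsilon>"
      using l1.tendsto_trunc[OF c] \<open>0 < \<epsilon>\<close> by (intro order_tendstoD) auto
    then obtain J where J: "finite J" "J \<subseteq> K" "l1.N (\<lambda>k. c k - trunc J c k) < \<epsilon>"
      unfolding eventually_finite_subsets_at_top by blast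
    show "\<exists>d\<in>l0.\<L>. \<forall>k\<in>K. w k * cmod (c k - d k) \<le> \<epsilon>"
    proof (intro bexI[of _ "trunc J c"] ballI)
      show "w k * cmod (c k - trunc J c k) \<le> \<epsilon>" if "k \<in> K" for k
        using l1.weighted_le_norm[OF l1.mem_diff[OF c l1.mem_trunc[OF c]] that, of J] J(3) by linarith
      show "trunc J c \<in> l0.\<L>"
        by (intro l0.mem_fin_seqs l0.trunc_fin_seqs J)
    qed
  qed
  obtain C where C: "\<And>c. c \<in> inf.\<L> \<Longrightarrow> inf.N (mat_app K A c) \<le> C * inf.N c"
    using mat_bounded_linf[OF A] unfolding mat_bounded_def by blast
  \<comment> \<open>The maximum with 1 makes division by D legitimate.\<close>
  define D where "D = max C 1"
  have D: "0 < D" "inf.N (mat_app K A c) \<le> D * inf.N c" if "c \<in> inf.\<L>" for c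
    using C[OF that] mult_right_mono[of C D, OF _ inf.norm_nonneg[OF that]] by (auto simp: D_def)
  have mem: "mat_app K A c \<in> l0.\<L>" if c: "c \<in> l0.\<L>" for c
  proof (rule l0.mem_zero_closed[OF refl])
    have c': "c \<in> inf.\<L>"
      by (rule l0.mem_linf[OF c])
    show "mat_app K A c k = 0" if "k \<notin> K" for k
      using A that by (simp add: row_bounded_def mat_app_outside)
    fix \<epsilon> :: real assume "0 < \<epsilon>"
    then have "0 < \<epsilon> / D"
      using D(1)[OF c'] by simp
    then have "\<forall>\<^sub>F J in finite_subsets_at_top K. l0.N (\<lambda>k. c k - trunc J c k) < \<epsilon> / D"
      using l0.tendsto_trunc[OF c] by (intro order_tendstoD) auto
    then obtain J where J: "finite J" "J \<subseteq> K" "l0.N (\<lambda>k. c k - trunc J c k) < \<epsilon> / D"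
      unfolding eventually_finite_subsets_at_top by blast
    let ?d = "trunc J c"
    have d: "?d \<in> fin_seqs K"
      using J by (intro l0.trunc_fin_seqs)
    have d': "?d \<in> inf.\<L>"
      by (rule inf.mem_fin_seqs[OF d])
    have "mat_app K A ?d \<in> l0.\<L>"
      using mat_bounded_l1[OF pos A'] l1.mem_fin_seqs[OF d] l1_l0 unfolding mat_bounded_def by blast
    moreover have "w k * cmod (mat_app K A c k - mat_app K A ?d k) \<le> \<epsilon>" if "k \<in> K" for k
    proof -
      have "(\<Sum>\<^sub>\<infinity>l\<in>K. A k l * (c l - ?d l)) = mat_app K A c k - mat_app K A ?d k"
        using infsum_diff[OF mat_app_summable[OF A c', of k] mat_app_summable[OF A d', of k]]
        by (simp add: mat_app_def right_diff_distrib)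
      then have "mat_app K A (\<lambda>l. c l - ?d l) k = mat_app K A c k - mat_app K A ?d k"
        by (simp add: mat_app_def)
      then have "w k * cmod (mat_app K A c k - mat_app K A ?d k) \<le> inf.N (mat_app K A (\<lambda>l. c l - ?d l))"
        using inf.weighted_le_norm[OF mat_app_mem_linf[OF A inf.mem_diff[OF c' d']] that] by simp
      also have "\<dots> \<le> D * inf.N (\<lambda>l. c l - ?d l)"
        by (rule D(2)[OF inf.mem_diff[OF c' d']])
      also have "\<dots> \<le> \<epsilon>"
        using J(3) D(1)[OF c'] by (simp add: norm_eq field_simps)
      finally show ?thesis .
    qed
    ultimately show "\<exists>d\<in>l0.\<L>. \<forall>k\<in>K. w k * cmod (mat_app K A c k - d k) \<le> \<epsilon>"
      by blast
  qed
  have mat: "A \<in> matrices K"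
    using A by (simp add: row_bounded_def)
  show ?thesis
    unfolding mat_bounded_def norm_eq
    using mat mem mat_app_summable[OF A l0.mem_linf] C[OF l0.mem_linf] by blast
qed

section \<open>Weights for which the algebra has bounded absolute row sums\<close>

text \<open>The part of admissibility that passes to 1 / w by mere symmetry. It yields boundedness
  for the exponents 0, 1 and \<infinity>, which covers the test space of the weak-star
  topology.\<close>

definition good_weight :: "'i set \<Rightarrow> 'i matrix set \<Rightarrow> ('i \<Rightarrow> real) \<Rightarrow> bool" where
  "good_weight K \<A> w \<longleftrightarrow> (\<forall>k\<in>K. 0 < w k) \<and>
     (\<forall>A\<in>\<A>. row_bounded K w A \<and> row_bounded K (\<lambda>k. 1 / w k) A)"

lemma good_weight_inverse: "good_weight K \<A> w \<Longrightarrow> good_weight K \<A> (\<lambda>k. 1 / w k)"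
  by (simp add: good_weight_def)

lemma good_weight_weight: "good_weight K \<A> w \<Longrightarrow> weight K w"
  by unfold_locales (simp add: good_weight_def)

context solid_spectral_matrix_algebra
begin

lemma row_bounded_transpose:
  assumes "A \<in> \<A>" "\<And>B. B \<in> \<A> \<Longrightarrow> row_bounded K w B"
  shows "row_bounded K w (\<lambda>k l. A l k)"
  using assms(2)[OF adj_closed[OF assms(1)]]
  by (simp add: row_bounded_def mat_adj_def matrices_def)

text \<open>Boundedness of \<open>\<bar>A\<bar>\<close> on \<open>\<ell>\<^sup>\<infinity>\<^sub>w\<close>, tested on the sequence \<open>1 / w\<close>, and of \<open>\<bar>A\<^sup>*\<bar>\<close> on
  \<open>\<ell>\<^sup>1\<^sub>w\<close>, tested on unit sequences.\<close>

lemma admissible_good_weight: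
  assumes "admissible_weight K \<A> w"
  shows "good_weight K \<A> w"
proof -
  have pos: "\<And>k. k \<in> K \<Longrightarrow> 0 < w k" and adm: "\<And>A p. A \<in> \<A> \<Longrightarrow> 1 \<le> p \<Longrightarrow> mat_bounded K p w p w A"
    using assms by (auto simp: admissible_weight_def)
  interpret weight K w by unfold_locales (rule pos)
  interpret l1: weighted_lp K w 1 by unfold_locales (auto simp: pos)
  have "row_bounded K w A" if A: "A \<in> \<A>" for A
  proof -
    define B where "B = (\<lambda>k l. complex_of_real (cmod (A k l)))"
    define c where "c = (\<lambda>k. if k \<in> K then complex_of_real (1 / w k) else 0)"
    have B: "mat_bounded K \<infinity> w \<infinity> w B"
      unfolding B_def by (intro adm abs_closed A) simp
    have c: "c \<in> inf.\<L>" "inf.N c \<le> 1"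
      using inverse_weight_mem inverse_weight_norm by (auto simp: c_def)
    obtain C where C: "\<And>d. d \<in> inf.\<L> \<Longrightarrow> inf.N (mat_app K B d) \<le> C * inf.N d"
      using B unfolding mat_bounded_def by blast
    have Bc: "mat_app K B c \<in> inf.\<L>" "\<And>k. k \<in> K \<Longrightarrow> (\<lambda>l. B k l * c l) summable_on K"
      using B c(1) unfolding mat_bounded_def by auto
    have eq: "B k l * c l = complex_of_real (cmod (A k l) / w l)" if "l \<in> K" for k l
      using that by (simp add: B_def c_def)
    have "inf.N (mat_app K B c) \<le> max C 0"
    proof -
      have "C * inf.N c \<le> max C 0 * 1"
        using c(2) inf.norm_nonneg[OF c(1)] by (intro mult_mono) auto
      then show ?thesis
        using C[OF c(1)] by simp
    qed
    moreover have "(\<lambda>l. cmod (A k l) / w l) summable_on K \<and>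
        (\<Sum>\<^sub>\<infinity>l\<in>K. cmod (A k l) / w l) \<le> inf.N (mat_app K B c) / w k" if k: "k \<in> K" for k
    proof -
      have "(\<lambda>l. complex_of_real (cmod (A k l) / w l)) summable_on K"
        using Bc(2)[OF k] eq by (simp cong: summable_on_cong)
      from summable_on_Re[OF this] have sum: "(\<lambda>l. cmod (A k l) / w l) summable_on K"
        by simp
      have "mat_app K B c k = (\<Sum>\<^sub>\<infinity>l\<in>K. complex_of_real (cmod (A k l) / w l))"
        unfolding mat_app_def using eq by (simp cong: infsum_cong)
      also have "\<dots> = complex_of_real (\<Sum>\<^sub>\<infinity>l\<in>K. cmod (A k l) / w l)"
        using has_sum_infsum[OF sum] has_sum_of_real infsumI by blast
      finally have abs: "cmod (mat_app K B c k) = \<bar>\<Sum>\<^sub>\<infinity>l\<in>K. cmod (A k l) / w l\<bar>"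
        by simp
      have "(\<Sum>\<^sub>\<infinity>l\<in>K. cmod (A k l) / w l) \<le> inf.N (mat_app K B c) / w k"
        using order_trans[OF mult_left_mono[OF abs_ge_self less_imp_le[OF pos[OF k]]]
            inf.weighted_le_norm[OF Bc(1) k, unfolded abs]] pos[OF k]
        by (simp add: pos_le_divide_eq mult.commute)
      with sum show ?thesis ..
    qed
    ultimately have "\<forall>k\<in>K. (\<lambda>l. cmod (A k l) / w l) summable_on K \<and>
        (\<Sum>\<^sub>\<infinity>l\<in>K. cmod (A k l) / w l) \<le> max C 0 / w k"
      using pos by (meson divide_right_mono less_imp_le order_trans)
    then show ?thesis
      unfolding row_bounded_def using A matrices by (intro conjI exI[of _ "max C 0"]) auto
  qed
  moreover have "row_bounded K (\<lambda>k. 1 / w k) A" if A: "A \<in> \<A>" for A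
  proof -
    define B where "B = mat_adj A"
    have B: "mat_bounded K 1 w 1 w B"
      unfolding B_def by (intro adm adj_closed A) simp
    obtain C where C: "\<And>d. d \<in> l1.\<L> \<Longrightarrow> l1.N (mat_app K B d) \<le> C * l1.N d"
      using B unfolding mat_bounded_def by blast
    have "(\<lambda>l. cmod (A k l) * w l) summable_on K \<and> (\<Sum>\<^sub>\<infinity>l\<in>K. cmod (A k l) * w l) \<le> max C 0 * w k"
      if k: "k \<in> K" for k
    proof -
      define e where "e = (\<lambda>l. if l = k then 1 else 0 :: complex)"
      have e: "e \<in> l1.\<L>"
        by (rule l1.mem_fin_seqs) (use k in \<open>auto simp: fin_seqs_def e_def\<close>)
      have "((\<lambda>l. w l * cmod (e l)) has_sum w k) K"
        by (rule has_sum_finite_neutralI[of "{k}"]) (use k in \<open>auto simp: e_def\<close>)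
      then have Ne: "l1.N e = w k"
        using pos by (simp add: lp_norm_1 infsumI)
      have "((\<lambda>l. B i l * e l) has_sum B i k) K" for i
        by (rule has_sum_finite_neutralI[of "{k}"]) (use k in \<open>auto simp: e_def\<close>)
      then have Be: "mat_app K B e i = cnj (A k i)" for i
        by (simp add: mat_app_def infsumI B_def mat_adj_def)
      have "mat_app K B e \<in> l1.\<L>"
        using B e unfolding mat_bounded_def by blast
      then have sum: "(\<lambda>l. cmod (A k l) * w l) summable_on K"
        using pos by (simp add: lp_space_1_iff Be mult.commute)
      have "l1.N (mat_app K B e) = (\<Sum>\<^sub>\<infinity>l\<in>K. cmod (A k l) * w l)"
        using pos by (simp add: lp_norm_1 Be mult.commute)
      then have "(\<Sum>\<^sub>\<infinity>l\<in>K. cmod (A k l) * w l) \<le> C * w k"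
        using C[OF e] Ne by simp
      also have "\<dots> \<le> max C 0 * w k"
        using pos[OF k] by (intro mult_right_mono) auto
      finally show ?thesis
        using sum by blast
    qed
    then show ?thesis
      unfolding row_bounded_def using A matrices by (intro conjI exI[of _ "max C 0"]) auto
  qed
  ultimately show ?thesis
    using pos by (simp add: good_weight_def)
qed

lemma good_weight_row_bounded:
  assumes "good_weight K \<A> w" "A \<in> \<A>"
  shows "row_bounded K w A" "row_bounded K (\<lambda>k. 1 / w k) A"
    "row_bounded K w (\<lambda>k l. A l k)" "row_bounded K (\<lambda>k. 1 / w k) (\<lambda>k l. A l k)"
  using assms row_bounded_transpose by (auto simp: good_weight_def)

lemma good_weight_mat_bounded:
  assumes w: "good_weight K \<A> w" and A: "A \<in> \<A>" and p: "p \<in> {0, 1, \<infinity>}"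
  shows "mat_bounded K p w p w A"
proof -
  interpret weight K w
    using w by (rule good_weight_weight)
  show ?thesis
    using p good_weight_row_bounded[OF w A] mat_bounded_l0[OF pos] mat_bounded_l1[OF pos] mat_bounded_linf
    by auto
qed

lemma admissible_mat_bounded:
  assumes "admissible_weight K \<A> w" "A \<in> \<A>" "p = 0 \<or> 1 \<le> p"
  shows "mat_bounded K p w p w A"
  using assms good_weight_mat_bounded[OF admissible_good_weight[OF assms(1)] assms(2), of 0]
  by (auto simp: admissible_weight_def)

end

declare infinity_ennreal_def [simp del]

section \<open>Coorbit spaces\<close>

locale coorbit_frame = localized_frame K \<A> nrm \<psi>
  for K :: "'i set" and \<A> nrm and \<psi> :: "'i \<Rightarrow> 'h::complex_hilbert_space" +
  assumes countable: "countable K"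
begin

abbreviation dual_vec :: "'i \<Rightarrow> 'h" where "dual_vec \<equiv> dual_frame K \<psi>"

abbreviation coefs :: "'h \<Rightarrow> 'i \<Rightarrow> complex" where "coefs \<equiv> analysis_op K dual_vec"

abbreviation coeff :: "'h coorb \<Rightarrow> 'i \<Rightarrow> complex" where "coeff \<equiv> coorbit_coeff K \<psi>"

abbreviation proj :: "'i matrix" where "proj \<equiv> cross_gram K dual_vec \<psi>"

lemma cross_gram_matrices: "cross_gram K \<xi> \<eta> \<in> matrices K"
  by (simp add: cross_gram_def matrices_def)

text \<open>With \<xi> = \<open>dual_vec\<close>, coefficient sequences of Hilbert space vectors are
  fixed by \<open>proj\<close>; with \<xi> = \<psi>, the Gram matrix converts dual coefficients into
  those with respect to \<psi>, as the pairing requires.\<close>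

lemma mat_app_cross_gram_coefs: "mat_app K (cross_gram K \<xi> \<psi>) (coefs f) = analysis_op K \<xi> f"
proof
  fix k
  show "mat_app K (cross_gram K \<xi> \<psi>) (coefs f) k = analysis_op K \<xi> f k"
  proof (cases "k \<in> K")
    case True
    have "((\<lambda>l. cross_gram K \<xi> \<psi> k l * coefs f l) has_sum cinner f (\<xi> k)) K"
      using has_sum_cinner_dual_left[of f "\<xi> k"]
      by (rule has_sum_cong[THEN iffD1, rotated])
        (use True in \<open>simp add: cross_gram_def analysis_op_def mult.commute\<close>)
    then show ?thesis
      using True by (simp add: mat_app_def analysis_op_def infsumI)
  next
    case False
    then show ?thesis
      by (simp add: mat_app_outside[OF cross_gram_matrices] analysis_op_def)
  qed
qed

lemma analysis_synthesis_fin: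
  assumes "c \<in> fin_seqs K"
  shows "analysis_op K \<xi> (synthesis_op K \<psi> c) = mat_app K (cross_gram K \<xi> \<psi>) c"
proof
  fix k
  define J where "J = {k. c k \<noteq> 0}"
  have J: "finite J" "J \<subseteq> K"
    using assms by (auto simp: J_def fin_seqs_def)
  have "((\<lambda>l. scaleC (c l) (\<psi> l)) has_sum (\<Sum>l\<in>J. scaleC (c l) (\<psi> l))) K"
    by (rule has_sum_finite_neutralI[OF J]) (auto simp: J_def)
  then have synth: "synthesis_op K \<psi> c = (\<Sum>l\<in>J. scaleC (c l) (\<psi> l))"
    by (simp add: synthesis_op_def infsumI)
  show "analysis_op K \<xi> (synthesis_op K \<psi> c) k = mat_app K (cross_gram K \<xi> \<psi>) c k"
  proof (cases "k \<in> K")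
    case True
    have "((\<lambda>l. cross_gram K \<xi> \<psi> k l * c l) has_sum (\<Sum>l\<in>J. cross_gram K \<xi> \<psi> k l * c l)) K"
      by (rule has_sum_finite_neutralI[OF J]) (auto simp: J_def)
    moreover have "(\<Sum>l\<in>J. cross_gram K \<xi> \<psi> k l * c l) = (\<Sum>l\<in>J. c l * cinner (\<psi> l) (\<xi> k))"
      by (rule sum.cong) (use J True in \<open>auto simp: cross_gram_def\<close>)
    ultimately show ?thesis
      using True by (simp add: synth mat_app_def infsumI analysis_op_def cinner_sum_left cinner_scaleC_left)
  next
    case False
    then show ?thesis
      by (simp add: mat_app_outside[OF cross_gram_matrices] analysis_op_def)
  qed
qed

lemma coeff_outside: "k \<notin> K \<Longrightarrow> coeff F k = 0"
  by (simp add: coorbit_coeff_def)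

end

locale coorbit_space = coorbit_frame K \<A> nrm \<psi>
  for K :: "'i set" and \<A> nrm and \<psi> :: "'i \<Rightarrow> 'h::complex_hilbert_space" +
  fixes w :: "'i \<Rightarrow> real"
  assumes good: "good_weight K \<A> w"
begin

sublocale weight K w
  using good by (rule good_weight_weight)

lemmas row_bounded = good_weight_row_bounded[OF good]

abbreviation seqs where "seqs \<equiv> coorbit_seqs K \<psi> w"

abbreviation rel where "rel \<equiv> coorbit_rel K \<psi> w"

abbreviation cls where "cls \<equiv> coorbit_class K \<psi> w"

abbreviation \<H> where "\<H> \<equiv> coorbit K \<psi> \<infinity> w"

section \<open>Equivalence classes of sequences and their coefficients\<close>

lemma seqs_iff:
  "f \<in> seqs \<longleftrightarrow> (\<forall>k\<in>K. convergent (\<lambda>n. cinner (f n) (dual_vec k))) \<and>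
     (\<exists>B. \<forall>n. \<forall>k\<in>K. w k * cmod (cinner (f n) (dual_vec k)) \<le> B)"
proof -
  have "(\<forall>n. coefs (f n) \<in> inf.\<L>) \<and> bdd_above (range (\<lambda>n. inf.N (coefs (f n)))) \<longleftrightarrow>
      (\<exists>B. \<forall>n. \<forall>k\<in>K. w k * cmod (cinner (f n) (dual_vec k)) \<le> B)"
  proof
    assume *: "(\<forall>n. coefs (f n) \<in> inf.\<L>) \<and> bdd_above (range (\<lambda>n. inf.N (coefs (f n))))"
    then obtain B where B: "\<And>n. inf.N (coefs (f n)) \<le> B"
      unfolding bdd_above_def by auto
    have "w k * cmod (cinner (f n) (dual_vec k)) \<le> B" if "k \<in> K" for n k
      using inf.weighted_le_norm[of "coefs (f n)", OF _ that] * B[of n] that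
      by (auto simp: analysis_op_def intro: order_trans)
    then show "\<exists>B. \<forall>n. \<forall>k\<in>K. w k * cmod (cinner (f n) (dual_vec k)) \<le> B"
      by blast
  next
    assume "\<exists>B. \<forall>n. \<forall>k\<in>K. w k * cmod (cinner (f n) (dual_vec k)) \<le> B"
    then obtain B where B: "\<And>n k. k \<in> K \<Longrightarrow> w k * cmod (cinner (f n) (dual_vec k)) \<le> B"
      by blast
    have "coefs (f n) \<in> inf.\<L>" for n
      unfolding inf.mem_infinity[OF refl] linf_space_iff using B by (auto simp: analysis_op_def)
    moreover have "inf.N (coefs (f n)) \<le> max B 0" for n
      by (rule inf.norm_le_sup) (auto simp: analysis_op_def intro: order_trans[OF B])
    ultimately show "(\<forall>n. coefs (f n) \<in> inf.\<L>) \<and> bdd_above (range (\<lambda>n. inf.N (coefs (f n))))"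
      unfolding bdd_above_def by blast
  qed
  then show ?thesis
    unfolding coorbit_seqs_def by simp
qed

lemma seqs_zero: "(\<lambda>n. 0) \<in> seqs"
  unfolding seqs_iff by (auto intro!: exI[of _ 0] convergent_const)

lemma seqs_add:
  assumes "f \<in> seqs" "g \<in> seqs"
  shows "(\<lambda>n. f n + g n) \<in> seqs"
proof -
  obtain B where B: "\<And>n k. k \<in> K \<Longrightarrow> w k * cmod (cinner (f n) (dual_vec k)) \<le> B"
    using assms(1) unfolding seqs_iff by blast
  obtain C where C: "\<And>n k. k \<in> K \<Longrightarrow> w k * cmod (cinner (g n) (dual_vec k)) \<le> C"
    using assms(2) unfolding seqs_iff by blast
  have "w k * cmod (cinner (f n + g n) (dual_vec k)) \<le> B + C" if "k \<in> K" for n k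
  proof -
    have "w k * cmod (cinner (f n + g n) (dual_vec k)) \<le>
        w k * cmod (cinner (f n) (dual_vec k)) + w k * cmod (cinner (g n) (dual_vec k))"
      unfolding cinner_add_left distrib_left[symmetric]
      by (rule mult_left_mono[OF norm_triangle_ineq less_imp_le[OF pos[OF that]]])
    then show ?thesis
      using B[OF that, of n] C[OF that, of n] by linarith
  qed
  moreover have "convergent (\<lambda>n. cinner (f n + g n) (dual_vec k))" if "k \<in> K" for k
    using assms that unfolding seqs_iff cinner_add_left by (intro convergent_add) auto
  ultimately show ?thesis
    unfolding seqs_iff by blast
qed

lemma seqs_scaleC:
  assumes "f \<in> seqs"
  shows "(\<lambda>n. scaleC a (f n)) \<in> seqs"
proof -
  obtain B where B: "\<And>n k. k \<in> K \<Longrightarrow> w k * cmod (cinner (f n) (dual_vec k)) \<le> B"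
    using assms(1) unfolding seqs_iff by blast
  have "w k * cmod (cinner (scaleC a (f n)) (dual_vec k)) \<le> cmod a * B" if "k \<in> K" for n k
    using mult_left_mono[OF B[OF that, of n], of "cmod a"]
    by (simp add: cinner_scaleC_left norm_mult mult_ac)
  moreover have "convergent (\<lambda>n. cinner (scaleC a (f n)) (dual_vec k))" if "k \<in> K" for k
    using assms that unfolding seqs_iff cinner_scaleC_left
    by (intro convergent_mult convergent_const) auto
  ultimately show ?thesis
    unfolding seqs_iff by blast
qed

lemma seqs_sum: "(\<And>i. i \<in> I \<Longrightarrow> f i \<in> seqs) \<Longrightarrow> (\<lambda>n. \<Sum>i\<in>I. f i n) \<in> seqs"
  by (induction I rule: infinite_finite_induct) (auto simp: seqs_zero intro: seqs_add)

lemma rel_iff: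
  "(f, g) \<in> rel \<longleftrightarrow> f \<in> seqs \<and> g \<in> seqs \<and>
    (\<forall>k\<in>K. (\<lambda>n. cinner (f n) (dual_vec k) - cinner (g n) (dual_vec k)) \<longlonglongrightarrow> 0)"
  by (simp add: coorbit_rel_def cinner_diff_left)

lemma rel_if_same_limits:
  assumes "f \<in> seqs" "g \<in> seqs"
    and "\<And>k. k \<in> K \<Longrightarrow> \<exists>a. (\<lambda>n. cinner (f n) (dual_vec k)) \<longlonglongrightarrow> a \<and> (\<lambda>n. cinner (g n) (dual_vec k)) \<longlonglongrightarrow> a"
  shows "(f, g) \<in> rel"
  unfolding rel_iff
proof (intro conjI ballI assms(1,2))
  fix k assume "k \<in> K"
  then obtain a where "(\<lambda>n. cinner (f n) (dual_vec k)) \<longlonglongrightarrow> a" "(\<lambda>n. cinner (g n) (dual_vec k)) \<longlonglongrightarrow> a"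
    using assms(3) by blast
  from tendsto_diff[OF this]
  show "(\<lambda>n. cinner (f n) (dual_vec k) - cinner (g n) (dual_vec k)) \<longlonglongrightarrow> 0"
    by simp
qed

lemma rel_limit:
  assumes "(f, g) \<in> rel" "k \<in> K" "(\<lambda>n. cinner (f n) (dual_vec k)) \<longlonglongrightarrow> a"
  shows "(\<lambda>n. cinner (g n) (dual_vec k)) \<longlonglongrightarrow> a"
proof -
  have "(\<lambda>n. cinner (f n) (dual_vec k) - cinner (g n) (dual_vec k)) \<longlonglongrightarrow> 0"
    using assms by (simp add: rel_iff)
  from tendsto_diff[OF assms(3) this] show ?thesis by simp
qed

lemma seqs_limit: "f \<in> seqs \<Longrightarrow> k \<in> K \<Longrightarrow> \<exists>a. (\<lambda>n. cinner (f n) (dual_vec k)) \<longlonglongrightarrow> a"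
  unfolding seqs_iff convergent_def by blast

lemma equiv_rel: "equiv seqs rel"
proof (rule equivI)
  show "rel \<subseteq> seqs \<times> seqs"
    by (auto simp: coorbit_rel_def)
  show "refl_on seqs rel"
    by (auto simp: refl_on_def coorbit_rel_def)
  show "sym rel"
  proof (rule symI)
    fix f g assume fg: "(f, g) \<in> rel"
    then have "f \<in> seqs" "g \<in> seqs" by (auto simp: rel_iff)
    then show "(g, f) \<in> rel"
      using rel_limit[OF fg] seqs_limit[of f] by (intro rel_if_same_limits) blast+
  qed
  show "trans rel"
  proof (rule transI)
    fix f g h assume fg: "(f, g) \<in> rel" "(g, h) \<in> rel"
    then have "f \<in> seqs" "h \<in> seqs" by (auto simp: rel_iff)
    then show "(f, h) \<in> rel"
      using rel_limit[OF fg(2) _ rel_limit[OF fg(1)]] seqs_limit[of f]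
      by (intro rel_if_same_limits) blast+
  qed
qed

lemma \<H>_eq: "\<H> = seqs // rel"
  by (simp add: coorbit_def)

lemma cls_mem: "f \<in> seqs \<Longrightarrow> cls f \<in> \<H>"
  unfolding \<H>_eq coorbit_class_def by (rule quotientI)

lemma rep_mem:
  assumes "F \<in> \<H>"
  shows "coorbit_rep F \<in> F" "coorbit_rep F \<in> seqs" "cls (coorbit_rep F) = F"
proof -
  have F: "F \<in> seqs // rel"
    using assms by (simp add: \<H>_eq)
  then have "F \<noteq> {}"
    using equiv_rel in_quotient_imp_non_empty by blast
  then show *: "coorbit_rep F \<in> F"
    unfolding coorbit_rep_def by (simp add: some_in_eq)
  then show "coorbit_rep F \<in> seqs"
    using F equiv_rel in_quotient_imp_subset by blast
  obtain f where f: "F = rel `` {f}"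
    using F by (rule quotientE)
  with * have "(f, coorbit_rep F) \<in> rel"
    by simp
  from equiv_class_eq[OF equiv_rel this] show "cls (coorbit_rep F) = F"
    unfolding coorbit_class_def f[symmetric] by simp
qed

lemma coeff_lim:
  assumes "F \<in> \<H>" "k \<in> K"
  shows "(\<lambda>n. cinner (coorbit_rep F n) (dual_vec k)) \<longlonglongrightarrow> coeff F k"
  using seqs_limit[OF rep_mem(2)[OF assms(1)] assms(2)] assms(2) limI
  by (auto simp: coorbit_coeff_def)

lemma coeff_cls:
  assumes "f \<in> seqs" "k \<in> K" "(\<lambda>n. cinner (f n) (dual_vec k)) \<longlonglongrightarrow> a"
  shows "coeff (cls f) k = a"
proof -
  have "(f, coorbit_rep (cls f)) \<in> rel"
    using rep_mem(1)[OF cls_mem[OF assms(1)]] by (simp add: coorbit_class_def)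
  from LIMSEQ_unique[OF coeff_lim[OF cls_mem[OF assms(1)] assms(2)] rel_limit[OF this assms(2,3)]]
  show ?thesis .
qed

text \<open>Injectivity of the coefficient map; from here on, equations between classes are verified
  on coefficients.\<close>

lemma coeff_eqI:
  assumes "F \<in> \<H>" "G \<in> \<H>" "coeff F = coeff G"
  shows "F = G"
proof -
  have "(coorbit_rep F, coorbit_rep G) \<in> rel"
    using rep_mem(2) coeff_lim[OF assms(1)] coeff_lim[OF assms(2)] assms by (intro rel_if_same_limits) auto
  then have "cls (coorbit_rep F) = cls (coorbit_rep G)"
    unfolding coorbit_class_def by (rule equiv_class_eq[OF equiv_rel])
  then show ?thesis
    using rep_mem(3) assms by simp
qed

lemma coeff_mem_inf:
  assumes "F \<in> \<H>"
  shows "coeff F \<in> inf.\<L>"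
proof -
  obtain B where B: "\<And>n k. k \<in> K \<Longrightarrow> w k * cmod (cinner (coorbit_rep F n) (dual_vec k)) \<le> B"
    using rep_mem(2)[OF assms] unfolding seqs_iff by blast
  have "w k * cmod (coeff F k) \<le> B" if "k \<in> K" for k
    using B[OF that] coeff_lim[OF assms that]
    by (intro LIMSEQ_le_const2[of "\<lambda>n. w k * cmod (cinner (coorbit_rep F n) (dual_vec k))"] tendsto_intros) auto
  then show ?thesis
    unfolding inf.mem_infinity[OF refl] linf_space_iff using coeff_outside by blast
qed

text \<open>Every member of a representing sequence is a Hilbert space vector, so its coefficients
  are fixed by \<open>proj\<close>. They are bounded by B / w, and a row of \<open>proj\<close> is
  summable against 1 / w, so dominated convergence passes the equation to the limit.\<close>

lemma proj_coeff:
  assumes F: "F \<in> \<H>"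
  shows "mat_app K proj (coeff F) = coeff F"
proof
  fix k
  show "mat_app K proj (coeff F) k = coeff F k"
  proof (cases "k \<in> K")
    case True
    obtain B where B: "\<And>n k. k \<in> K \<Longrightarrow> w k * cmod (cinner (coorbit_rep F n) (dual_vec k)) \<le> B"
      using rep_mem(2)[OF assms] unfolding seqs_iff by blast
    have "(\<lambda>n. infsum (\<lambda>l. proj k l * coefs (coorbit_rep F n) l) K) \<longlonglongrightarrow>
        infsum (\<lambda>l. proj k l * coeff F l) K"
    proof (rule tendsto_infsum_dominated(2))
      show "(\<lambda>l. B * (cmod (proj k l) / w l)) summable_on K"
        using row_mem_dual[OF row_bounded(1)[OF cross_gram_dual_left] True]
        by (intro summable_on_cmult_right) (simp add: mem_dual_iff)
      show "cmod (proj k l * coefs (coorbit_rep F n) l) \<le> B * (cmod (proj k l) / w l)" if l: "l \<in> K" for n l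
      proof -
        have "cmod (coefs (coorbit_rep F n) l) \<le> B / w l"
          using B[OF l, of n] pos[OF l] l by (simp add: analysis_op_def field_simps)
        from mult_left_mono[OF this, of "cmod (proj k l)"] show ?thesis
          by (simp add: norm_mult mult_ac)
      qed
      show "(\<lambda>n. proj k l * coefs (coorbit_rep F n) l) \<longlonglongrightarrow> proj k l * coeff F l" if "l \<in> K" for l
        using coeff_lim[OF F that] that by (auto simp: analysis_op_def intro!: tendsto_intros)
    qed
    moreover have "infsum (\<lambda>l. proj k l * coefs f l) K = cinner f (dual_vec k)" for f
      using fun_cong[OF mat_app_cross_gram_coefs[of dual_vec f], of k] True
      by (simp add: mat_app_def analysis_op_def)
    ultimately show ?thesis
      using LIMSEQ_unique[OF _ coeff_lim[OF F True]] by (simp add: mat_app_def)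
  next
    case False
    then show ?thesis
      by (simp add: mat_app_outside[OF cross_gram_matrices] coeff_outside)
  qed
qed

text \<open>Converse of \<open>proj_coeff\<close>. Truncations of \<alpha> along an exhaustion of K
  are synthesised to vectors; their coefficients are \<open>proj\<close> applied to the truncations,
  hence bounded and coordinatewise convergent to \<open>proj\<close> \<alpha> = \<alpha>.
  Countability of K enters because representatives are sequences.\<close>

lemma coorbit_exists:
  assumes \<alpha>: "\<alpha> \<in> inf.\<L>" and proj: "mat_app K proj \<alpha> = \<alpha>"
  obtains F where "F \<in> \<H>" "coeff F = \<alpha>"
proof -
  \<comment> \<open>For empty K the value of \<open>from_nat_into\<close> is arbitrary and would
    leave K.\<close>
  define J where "J n = (if K = {} then {} else from_nat_into K ` {..<n})" for n
  have J: "finite (J n)" "J n \<subseteq> K" for n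
    using from_nat_into[of K] by (auto simp: J_def)
  have J_ev: "\<exists>N. \<forall>n\<ge>N. l \<in> J n" if l: "l \<in> K" for l
  proof -
    obtain m where "from_nat_into K m = l"
      using from_nat_into_surj[OF countable l] by blast
    then have "\<forall>n\<ge>Suc m. l \<in> J n"
      using l by (auto simp: J_def)
    then show ?thesis ..
  qed
  define f where "f n = synthesis_op K \<psi> (trunc (J n) \<alpha>)" for n
  have coefs_f: "coefs (f n) = mat_app K proj (trunc (J n) \<alpha>)" for n
    unfolding f_def by (rule analysis_synthesis_fin[OF inf.trunc_fin_seqs[OF J]])
  note rb = row_bounded(1)[OF cross_gram_dual_left]
  obtain C where C: "\<And>c. c \<in> inf.\<L> \<Longrightarrow> inf.N (mat_app K proj c) \<le> C * inf.N c"
    using mat_bounded_linf[OF rb] unfolding mat_bounded_def by blast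
  have lim: "(\<lambda>n. cinner (f n) (dual_vec k)) \<longlonglongrightarrow> \<alpha> k" if k: "k \<in> K" for k
  proof -
    have "(\<lambda>n. infsum (\<lambda>l. proj k l * trunc (J n) \<alpha> l) K) \<longlonglongrightarrow> infsum (\<lambda>l. proj k l * \<alpha> l) K"
    proof (rule tendsto_infsum_dominated(2))
      show "(\<lambda>l. cmod (proj k l * \<alpha> l)) summable_on K"
        by (rule mat_app_abs_summable[OF rb \<alpha> k])
      show "cmod (proj k l * trunc (J n) \<alpha> l) \<le> cmod (proj k l * \<alpha> l)" for n l
        by (simp add: trunc_def)
      show "(\<lambda>n. proj k l * trunc (J n) \<alpha> l) \<longlonglongrightarrow> proj k l * \<alpha> l" if "l \<in> K" for l
        using J_ev[OF that]
        by (intro tendsto_eventually) (auto simp: trunc_def eventually_sequentially)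
    qed
    moreover have "cinner (f n) (dual_vec k) = infsum (\<lambda>l. proj k l * trunc (J n) \<alpha> l) K" for n
      using fun_cong[OF coefs_f, of n k] k by (simp add: analysis_op_def mat_app_def)
    moreover have "infsum (\<lambda>l. proj k l * \<alpha> l) K = \<alpha> k"
      using fun_cong[OF proj, of k] by (simp add: mat_app_def)
    ultimately show ?thesis by simp
  qed
  have f: "f \<in> seqs"
    unfolding seqs_iff
  proof (intro conjI ballI)
    show "convergent (\<lambda>n. cinner (f n) (dual_vec k))" if "k \<in> K" for k
      using lim[OF that] by (rule convergentI)
    have "w k * cmod (cinner (f n) (dual_vec k)) \<le> max C 0 * inf.N \<alpha>" if k: "k \<in> K" for n k
    proof -
      have t: "trunc (J n) \<alpha> \<in> inf.\<L>"
        by (rule inf.mem_trunc[OF \<alpha>])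
      have "w k * cmod (cinner (f n) (dual_vec k)) = w k * cmod (mat_app K proj (trunc (J n) \<alpha>) k)"
        using fun_cong[OF coefs_f, of n k] k by (simp add: analysis_op_def)
      also have "\<dots> \<le> inf.N (mat_app K proj (trunc (J n) \<alpha>))"
        by (rule inf.weighted_le_norm[OF mat_app_mem_linf[OF rb t] k])
      also have "\<dots> \<le> C * inf.N (trunc (J n) \<alpha>)"
        by (rule C[OF t])
      also have "\<dots> \<le> max C 0 * inf.N \<alpha>"
        using inf.norm_trunc_le[OF \<alpha>, of "J n"] inf.norm_nonneg[OF t] by (intro mult_mono) auto
      finally show ?thesis .
    qed
    then show "\<exists>B. \<forall>n. \<forall>k\<in>K. w k * cmod (cinner (f n) (dual_vec k)) \<le> B"
      by blast
  qed
  have "coeff (cls f) k = \<alpha> k" for k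
    using coeff_cls[OF f _ lim] coeff_outside inf.zero_outside[OF \<alpha>] by (cases "k \<in> K") auto
  then show thesis
    using that[OF cls_mem[OF f]] by blast
qed

lemma embed:
  assumes "coefs f \<in> inf.\<L>"
  shows embed_mem: "coorbit_embed K \<psi> w f \<in> \<H>" and coeff_embed: "coeff (coorbit_embed K \<psi> w f) = coefs f"
proof -
  have f: "(\<lambda>_. f) \<in> seqs"
    unfolding seqs_iff using inf.weighted_le_norm[OF assms]
    by (auto simp: convergent_const analysis_op_def)
  show "coorbit_embed K \<psi> w f \<in> \<H>"
    unfolding coorbit_embed_def by (rule cls_mem[OF f])
  show "coeff (coorbit_embed K \<psi> w f) = coefs f"
  proof
    fix k show "coeff (coorbit_embed K \<psi> w f) k = coefs f k"
      unfolding coorbit_embed_def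
      using coeff_cls[OF f _ tendsto_const] coeff_outside by (cases "k \<in> K") (auto simp: analysis_op_def)
  qed
qed

lemma add_mem_coeff:
  assumes "F \<in> \<H>" "G \<in> \<H>"
  shows add_mem: "coorbit_add K \<psi> w F G \<in> \<H>"
    and coeff_add: "coeff (coorbit_add K \<psi> w F G) = (\<lambda>k. coeff F k + coeff G k)"
proof -
  have s: "(\<lambda>n. coorbit_rep F n + coorbit_rep G n) \<in> seqs"
    by (intro seqs_add rep_mem assms)
  show "coorbit_add K \<psi> w F G \<in> \<H>"
    unfolding coorbit_add_def by (rule cls_mem[OF s])
  show "coeff (coorbit_add K \<psi> w F G) = (\<lambda>k. coeff F k + coeff G k)"
  proof
    fix k show "coeff (coorbit_add K \<psi> w F G) k = coeff F k + coeff G k"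
    proof (cases "k \<in> K")
      case True
      show ?thesis
        unfolding coorbit_add_def
        using tendsto_add[OF coeff_lim[OF assms(1) True] coeff_lim[OF assms(2) True]]
        by (intro coeff_cls[OF s True]) (simp add: cinner_add_left)
    qed (simp add: coeff_outside)
  qed
qed

lemma scale_mem_coeff:
  assumes "F \<in> \<H>"
  shows scale_mem: "coorbit_scale K \<psi> w a F \<in> \<H>"
    and coeff_scale: "coeff (coorbit_scale K \<psi> w a F) = (\<lambda>k. a * coeff F k)"
proof -
  have s: "(\<lambda>n. scaleC a (coorbit_rep F n)) \<in> seqs"
    by (intro seqs_scaleC rep_mem assms)
  show "coorbit_scale K \<psi> w a F \<in> \<H>"
    unfolding coorbit_scale_def by (rule cls_mem[OF s])
  show "coeff (coorbit_scale K \<psi> w a F) = (\<lambda>k. a * coeff F k)"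
  proof
    fix k show "coeff (coorbit_scale K \<psi> w a F) k = a * coeff F k"
    proof (cases "k \<in> K")
      case True
      show ?thesis
        unfolding coorbit_scale_def
        using tendsto_mult_left[OF coeff_lim[OF assms True]]
        by (intro coeff_cls[OF s True]) (simp add: cinner_scaleC_left)
    qed (simp add: coeff_outside)
  qed
qed

lemma sum_mem_coeff:
  assumes "\<And>i. i \<in> I \<Longrightarrow> F i \<in> \<H>"
  shows sum_mem: "coorbit_sum K \<psi> w F I \<in> \<H>"
    and coeff_sum: "coeff (coorbit_sum K \<psi> w F I) = (\<lambda>k. \<Sum>i\<in>I. coeff (F i) k)"
proof -
  have s: "(\<lambda>n. \<Sum>i\<in>I. coorbit_rep (F i) n) \<in> seqs"
    by (intro seqs_sum rep_mem assms)
  show "coorbit_sum K \<psi> w F I \<in> \<H>"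
    unfolding coorbit_sum_def by (rule cls_mem[OF s])
  show "coeff (coorbit_sum K \<psi> w F I) = (\<lambda>k. \<Sum>i\<in>I. coeff (F i) k)"
  proof
    fix k show "coeff (coorbit_sum K \<psi> w F I) k = (\<Sum>i\<in>I. coeff (F i) k)"
    proof (cases "k \<in> K")
      case True
      show ?thesis
        unfolding coorbit_sum_def
        using tendsto_sum[of I, OF coeff_lim[OF assms True]]
        by (intro coeff_cls[OF s True]) (simp add: cinner_sum_left)
    qed (simp add: coeff_outside)
  qed
qed

end

section \<open>Coorbit spaces with exponent p and their norm topology\<close>

text \<open>Boundedness for this one exponent is assumed instead of admissibility. Thus the locale
  covers both an admissible weight with the given exponent and the reciprocal weight with exponent
  1, for which only \<open>good_weight\<close> is at hand.\<close>

locale coorbit_lp = coorbit_space K \<A> nrm \<psi> w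
  for K :: "'i set" and \<A> nrm and \<psi> :: "'i \<Rightarrow> 'h::complex_hilbert_space" and w +
  fixes p :: ennreal
  assumes exponent: "p = 0 \<or> 1 \<le> p"
    and mat_bounded: "A \<in> \<A> \<Longrightarrow> mat_bounded K p w p w A"
begin

sublocale lp: weighted_lp K w p
  by unfold_locales (auto simp: pos exponent)

abbreviation \<H>p where "\<H>p \<equiv> coorbit K \<psi> p w"

lemma mat_app_mem: "A \<in> \<A> \<Longrightarrow> c \<in> lp.\<L> \<Longrightarrow> mat_app K A c \<in> lp.\<L>"
  using mat_bounded unfolding mat_bounded_def by blast

lemma mat_app_norm:
  assumes "A \<in> \<A>"
  obtains C where "0 \<le> C" "\<And>c. c \<in> lp.\<L> \<Longrightarrow> lp.N (mat_app K A c) \<le> C * lp.N c"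
proof -
  obtain C where C: "\<And>c. c \<in> lp.\<L> \<Longrightarrow> lp.N (mat_app K A c) \<le> C * lp.N c"
    using mat_bounded[OF assms] unfolding mat_bounded_def by blast
  have "lp.N (mat_app K A c) \<le> max C 0 * lp.N c" if "c \<in> lp.\<L>" for c
    using C[OF that] mult_right_mono[of C "max C 0", OF _ lp.norm_nonneg[OF that]] by simp
  then show thesis
    by (intro that[of "max C 0"]) auto
qed

lemma mat_app_diff:
  assumes "A \<in> \<A>" "c \<in> inf.\<L>" "d \<in> inf.\<L>"
  shows "mat_app K A (\<lambda>k. c k - d k) = (\<lambda>k. mat_app K A c k - mat_app K A d k)"
  unfolding mat_app_def right_diff_distrib
  using row_bounded(1)[OF assms(1)] assms by (intro ext infsum_diff mat_app_summable) auto

text \<open>Identifies the completion with all classes having coefficients in the sequence space.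
  For the approximation let c be a truncation of \<open>coeff F\<close> and f its synthesis; since
  \<open>proj\<close> fixes \<open>coeff F\<close>, the error is \<open>proj\<close> applied to
  \<open>coeff F\<close> minus c, hence a constant times the truncation error.\<close>

lemma coorbit_iff: "F \<in> \<H>p \<longleftrightarrow> F \<in> \<H> \<and> coeff F \<in> lp.\<L>"
proof (cases "p = \<infinity>")
  case True
  then show ?thesis
    using coeff_mem_inf by blast
next
  case False
  have fin: "coefs f \<in> lp.\<L>" if f: "f \<in> coorbit_fin K \<psi>" for f
  proof -
    obtain c where c: "c \<in> fin_seqs K" "f = synthesis_op K \<psi> c"
      using f unfolding coorbit_fin_def by blast
    show ?thesis
      unfolding c(2) analysis_synthesis_fin[OF c(1)]
      by (rule mat_app_mem[OF cross_gram_dual_left lp.mem_fin_seqs[OF c(1)]])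
  qed
  have eq: "F \<in> \<H>p \<longleftrightarrow> F \<in> \<H> \<and> (\<forall>\<epsilon>>0. \<exists>f\<in>coorbit_fin K \<psi>.
      (\<lambda>k. coeff F k - coefs f k) \<in> lp.\<L> \<and> lp.N (\<lambda>k. coeff F k - coefs f k) < \<epsilon>)"
    using False unfolding \<H>_eq coorbit_def[of _ _ p] by simp
  show ?thesis
  proof
    assume F: "F \<in> \<H>p"
    then obtain f where f: "f \<in> coorbit_fin K \<psi>" "(\<lambda>k. coeff F k - coefs f k) \<in> lp.\<L>"
      unfolding eq by (meson zero_less_one)
    have "coeff F \<in> lp.\<L>"
      using lp.mem_add[OF f(2) fin[OF f(1)]] by simp
    then show "F \<in> \<H> \<and> coeff F \<in> lp.\<L>"
      using F eq by blast
  next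
    assume F: "F \<in> \<H> \<and> coeff F \<in> lp.\<L>"
    obtain C where C: "0 \<le> C" "\<And>c. c \<in> lp.\<L> \<Longrightarrow> lp.N (mat_app K proj c) \<le> C * lp.N c"
      using mat_app_norm[OF cross_gram_dual_left] by blast
    have "\<exists>f\<in>coorbit_fin K \<psi>. (\<lambda>k. coeff F k - coefs f k) \<in> lp.\<L> \<and> lp.N (\<lambda>k. coeff F k - coefs f k) < \<epsilon>"
      if "0 < \<epsilon>" for \<epsilon>
    proof -
      have "((\<lambda>J. C * lp.N (\<lambda>k. coeff F k - trunc J (coeff F) k)) \<longlongrightarrow> C * 0) (finite_subsets_at_top K)"
        using F False by (intro tendsto_intros lp.tendsto_trunc) auto
      then have "\<forall>\<^sub>F J in finite_subsets_at_top K. C * lp.N (\<lambda>k. coeff F k - trunc J (coeff F) k) < \<epsilon>"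
        using that by (intro order_tendstoD) auto
      then obtain J where J: "finite J" "J \<subseteq> K" "C * lp.N (\<lambda>k. coeff F k - trunc J (coeff F) k) < \<epsilon>"
        unfolding eventually_finite_subsets_at_top by blast
      define c where "c = trunc J (coeff F)"
      have c: "c \<in> fin_seqs K" "c \<in> lp.\<L>"
        unfolding c_def using J F by (auto intro: lp.trunc_fin_seqs lp.mem_trunc)
      define f where "f = synthesis_op K \<psi> c"
      have f: "f \<in> coorbit_fin K \<psi>"
        using c(1) by (simp add: f_def coorbit_fin_def)
      have "mat_app K proj (\<lambda>k. coeff F k - c k) = (\<lambda>k. coeff F k - coefs f k)"
        using mat_app_diff[OF cross_gram_dual_left lp.mem_linf lp.mem_linf, of "coeff F" c] F c
        by (simp add: proj_coeff f_def analysis_synthesis_fin)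
      moreover have "lp.N (mat_app K proj (\<lambda>k. coeff F k - c k)) < \<epsilon>"
        using C(2)[OF lp.mem_diff[of "coeff F" c]] F c(2) J(3) by (simp add: c_def)
      moreover have "(\<lambda>k. coeff F k - coefs f k) \<in> lp.\<L>"
        using F fin[OF f] by (intro lp.mem_diff) auto
      ultimately show ?thesis
        using f by auto
    qed
    then show "F \<in> \<H>p"
      using F unfolding eq by blast
  qed
qed

lemma \<H>p_subset: "F \<in> \<H>p \<Longrightarrow> F \<in> \<H>"
  by (simp add: coorbit_iff)

lemma coeff_mem: "F \<in> \<H>p \<Longrightarrow> coeff F \<in> lp.\<L>"
  by (simp add: coorbit_iff)

lemma add_mem_p: "F \<in> \<H>p \<Longrightarrow> G \<in> \<H>p \<Longrightarrow> coorbit_add K \<psi> w F G \<in> \<H>p"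
  by (simp add: coorbit_iff add_mem_coeff lp.mem_add)

lemma scale_mem_p: "F \<in> \<H>p \<Longrightarrow> coorbit_scale K \<psi> w a F \<in> \<H>p"
  by (simp add: coorbit_iff scale_mem_coeff lp.mem_scale)

lemma sum_mem_p: "finite I \<Longrightarrow> (\<And>i. i \<in> I \<Longrightarrow> F i \<in> \<H>p) \<Longrightarrow> coorbit_sum K \<psi> w F I \<in> \<H>p"
  by (simp add: coorbit_iff sum_mem_coeff lp.mem_sum)

lemma coorbit_exists_p:
  assumes "\<alpha> \<in> lp.\<L>" "mat_app K proj \<alpha> = \<alpha>"
  obtains F where "F \<in> \<H>p" "coeff F = \<alpha>"
proof -
  obtain F where F: "F \<in> \<H>" "coeff F = \<alpha>"
    using coorbit_exists[OF lp.mem_linf[OF assms(1)] assms(2)] by blast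
  then show thesis
    using that[of F] assms(1) coorbit_iff by simp
qed

lemma embed_mem_p: "coefs f \<in> lp.\<L> \<Longrightarrow> coorbit_embed K \<psi> w f \<in> \<H>p"
  using lp.mem_linf by (simp add: coorbit_iff embed)

lemma norm_diff:
  assumes "F \<in> \<H>p" "G \<in> \<H>p"
  shows "coorbit_norm K \<psi> p w (coorbit_add K \<psi> w F (coorbit_scale K \<psi> w (-1) G)) =
    lp.N (\<lambda>k. coeff F k - coeff G k)"
  using assms by (simp add: coorbit_norm_def coorbit_iff add_mem_coeff scale_mem_coeff)

definition cdist where
  "cdist = (\<lambda>F G. if F \<in> \<H>p \<and> G \<in> \<H>p
     then coorbit_norm K \<psi> p w (coorbit_add K \<psi> w F (coorbit_scale K \<psi> w (-1) G)) else 0)"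

lemma cdist_eq: "F \<in> \<H>p \<Longrightarrow> G \<in> \<H>p \<Longrightarrow> cdist F G = lp.N (\<lambda>k. coeff F k - coeff G k)"
  by (simp add: cdist_def norm_diff)

lemma Metric_space_cdist: "Metric_space \<H>p cdist"
proof
  fix F G H
  show "0 \<le> cdist F G"
    using cdist_eq lp.norm_nonneg[OF lp.mem_diff[OF coeff_mem coeff_mem]]
    by (cases "F \<in> \<H>p \<and> G \<in> \<H>p") (auto simp: cdist_def)
  show "cdist F G = cdist G F"
    using lp.norm_diff_commute[OF coeff_mem coeff_mem]
    by (cases "F \<in> \<H>p \<and> G \<in> \<H>p") (auto simp: cdist_eq, auto simp: cdist_def)
  show "cdist F G = 0 \<longleftrightarrow> F = G" if FG: "F \<in> \<H>p" "G \<in> \<H>p"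
  proof
    assume "cdist F G = 0"
    then have "(\<lambda>k. coeff F k - coeff G k) = (\<lambda>k. 0)"
      using FG by (intro lp.norm_eq_0D lp.mem_diff coeff_mem) (auto simp: cdist_eq)
    then have "coeff F k - coeff G k = 0" for k
      by (rule fun_cong)
    then have "coeff F = coeff G"
      by (intro ext) simp
    then show "F = G"
      using FG \<H>p_subset coeff_eqI by blast
  next
    assume "F = G"
    then show "cdist F G = 0"
      using FG by (simp add: cdist_eq lp.norm_zero)
  qed
  show "cdist F H \<le> cdist F G + cdist G H" if "F \<in> \<H>p" "G \<in> \<H>p" "H \<in> \<H>p"
    using that lp.norm_diff_triangle[OF coeff_mem coeff_mem coeff_mem] by (simp add: cdist_eq)
qed

lemma norm_topology_eq: "coorbit_norm_topology K \<psi> p w = Metric_space.mtopology \<H>p cdist"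
  by (simp add: coorbit_norm_topology_def cdist_def)

lemma limitin_normI:
  assumes "F \<in> \<H>p" "\<forall>\<^sub>F x in net. f x \<in> \<H>p" "((\<lambda>x. lp.N (\<lambda>k. coeff (f x) k - coeff F k)) \<longlongrightarrow> 0) net"
  shows "limitin (coorbit_norm_topology K \<psi> p w) f F net"
proof -
  interpret Metric_space \<H>p cdist
    by (rule Metric_space_cdist)
  have "\<forall>\<^sub>F x in net. f x \<in> \<H>p \<and> cdist (f x) F < \<epsilon>" if "0 < \<epsilon>" for \<epsilon>
    using assms(2) order_tendstoD(2)[OF assms(3) that] by eventually_elim (simp add: cdist_eq assms(1))
  then show ?thesis
    unfolding norm_topology_eq limitin_metric using assms(1) by blast
qed

lemma limitin_norm_unique:
  "limitin (coorbit_norm_topology K \<psi> p w) f F net \<Longrightarrow> limitin (coorbit_norm_topology K \<psi> p w) f G net \<Longrightarrow>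
    net \<noteq> bot \<Longrightarrow> F = G"
  unfolding norm_topology_eq by (rule Metric_space.limitin_metric_unique[OF Metric_space_cdist])

end

section \<open>The pairing and the weak-star topology\<close>

context coorbit_space
begin

lemma dual_coorbit_space: "coorbit_space K \<A> nrm \<psi> (\<lambda>k. 1 / w k)"
  by unfold_locales (rule good_weight_inverse[OF good])

lemma dual_coorbit_lp: "coorbit_lp K \<A> nrm \<psi> (\<lambda>k. 1 / w k) 1"
proof -
  interpret d: coorbit_space K \<A> nrm \<psi> "\<lambda>k. 1 / w k"
    by (rule dual_coorbit_space)
  show ?thesis
    by unfold_locales (auto intro: good_weight_mat_bounded[OF d.good])
qed

abbreviation tests :: "'h coorb set" where "tests \<equiv> coorbit K \<psi> 1 (\<lambda>k. 1 / w k)"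

text \<open>The predual sequence through which H acts. Putting the conjugation here makes the
  pairing the bilinear one of \<open>inf\<close> and \<open>dual\<close>, to which
  \<open>mat_app_swap\<close> applies.\<close>

definition functional :: "'h coorb \<Rightarrow> 'i \<Rightarrow> complex" where
  "functional H = (\<lambda>k. cnj (mat_app K (cross_gram K \<psi> \<psi>) (coeff H) k))"

lemma pairing_eq: "coorbit_pairing K \<psi> F H = (\<Sum>\<^sub>\<infinity>k\<in>K. coeff F k * functional H k)"
  by (simp add: coorbit_pairing_def functional_def)

lemma functional_mem:
  assumes "H \<in> tests"
  shows "functional H \<in> dual.\<L>"
proof -
  interpret d: coorbit_lp K \<A> nrm \<psi> "\<lambda>k. 1 / w k" 1
    by (rule dual_coorbit_lp)
  have "mat_app K (cross_gram K \<psi> \<psi>) (coeff H) \<in> dual.\<L>"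
    by (rule d.mat_app_mem[OF _ d.coeff_mem[OF assms]]) (use localized in \<open>simp add: localized_rel_def\<close>)
  then show ?thesis
    by (simp add: functional_def mem_dual_iff)
qed

lemma embed_test:
  assumes "coefs f \<in> dual.\<L>"
  shows "coorbit_embed K \<psi> (\<lambda>k. 1 / w k) f \<in> tests"
    and "functional (coorbit_embed K \<psi> (\<lambda>k. 1 / w k) f) = (\<lambda>k. if k \<in> K then cinner (\<psi> k) f else 0)"
proof -
  interpret d: coorbit_lp K \<A> nrm \<psi> "\<lambda>k. 1 / w k" 1
    by (rule dual_coorbit_lp)
  show "coorbit_embed K \<psi> (\<lambda>k. 1 / w k) f \<in> tests"
    by (rule d.embed_mem_p[OF assms])
  have coeff: "coeff (coorbit_embed K \<psi> (\<lambda>k. 1 / w k) f) = coefs f"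
    by (rule d.coeff_embed[OF dual.mem_linf[OF assms]])
  show "functional (coorbit_embed K \<psi> (\<lambda>k. 1 / w k) f) = (\<lambda>k. if k \<in> K then cinner (\<psi> k) f else 0)"
    unfolding functional_def coeff mat_app_cross_gram_coefs
    by (auto simp: analysis_op_def cinner_commute[symmetric])
qed

text \<open>Up to conjugation the coefficients of \<xi> k form the k-th row of
  \<open>cross_gram K \<xi> dual_vec\<close>, and rows of \<open>row_bounded\<close> matrices lie in
  the predual.\<close>

lemma coefs_mem_dual:
  assumes "cross_gram K \<xi> dual_vec \<in> \<A>" "k \<in> K"
  shows "coefs (\<xi> k) \<in> dual.\<L>"
proof -
  have eq: "cmod (coefs (\<xi> k) l) = cmod (cross_gram K \<xi> dual_vec k l)" for l
    using assms(2) complex_mod_cnj[of "cinner (dual_vec l) (\<xi> k)"]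
    by (simp add: analysis_op_def cross_gram_def cinner_commute[symmetric])
  have "(\<lambda>l. cmod (coefs (\<xi> k) l) / w l) summable_on K"
    unfolding eq using row_mem_dual[OF row_bounded(1)[OF assms(1)] assms(2)] by (simp add: mem_dual_iff)
  then show ?thesis
    by (auto simp: mem_dual_iff analysis_op_def)
qed

text \<open>Pairing with an embedded frame vector is analysis with respect to \<xi>. This is how
  \<open>matrix_of\<close> and \<open>operator_of\<close> become products of matrices.\<close>

lemma pairing_embed:
  assumes "cross_gram K \<xi> dual_vec \<in> \<A>" "k \<in> K"
  shows "coorbit_pairing K \<psi> F (coorbit_embed K \<psi> (\<lambda>k. 1 / w k) (\<xi> k)) =
    mat_app K (cross_gram K \<xi> \<psi>) (coeff F) k"
  unfolding pairing_eq embed_test(2)[OF coefs_mem_dual[OF assms]] mat_app_def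
  using assms(2) by (intro infsum_cong) (simp add: cross_gram_def mult.commute)

lemma pairing_dual_vec:
  assumes "F \<in> \<H>" "k \<in> K"
  shows "coorbit_pairing K \<psi> F (coorbit_embed K \<psi> (\<lambda>k. 1 / w k) (dual_vec k)) = coeff F k"
  using pairing_embed[OF cross_gram_dual_dual assms(2)] proj_coeff[OF assms(1)] by simp

lemma tests_nonempty: "tests \<noteq> {}"
proof -
  have "coefs 0 \<in> dual.\<L>"
    by (simp add: mem_dual_iff analysis_op_def cong: if_cong)
  from embed_test(1)[OF this] show ?thesis by blast
qed

lemma topspace_weak_star: "topspace (coorbit_weak_star K \<psi> w) = \<H>"
proof -
  obtain H where "H \<in> tests"
    using tests_nonempty by blast
  then have "\<H> \<in> {{F \<in> \<H>. coorbit_pairing K \<psi> F H \<in> U} | H U. H \<in> tests \<and> open U}"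
    by (intro CollectI exI[of _ H] exI[of _ UNIV]) auto
  then show ?thesis
    unfolding coorbit_weak_star_def topology_generated_by_topspace by blast
qed

text \<open>Limits in a generated topology are tested on the generating sets. The generator with U =
  \<open>UNIV\<close> yields eventual membership in the space, and here nonemptiness of
  \<open>tests\<close> enters.\<close>

lemma limitin_weak_star_iff:
  "limitin (coorbit_weak_star K \<psi> w) f F net \<longleftrightarrow> F \<in> \<H> \<and> (\<forall>\<^sub>F x in net. f x \<in> \<H>) \<and>
    (\<forall>H\<in>tests. ((\<lambda>x. coorbit_pairing K \<psi> (f x) H) \<longlongrightarrow> coorbit_pairing K \<psi> F H) net)"
proof
  assume lim: "limitin (coorbit_weak_star K \<psi> w) f F net"
  have F: "F \<in> \<H>"
    using limitin_topspace[OF lim] topspace_weak_star by simp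
  have basis: "\<forall>\<^sub>F x in net. f x \<in> {F \<in> \<H>. coorbit_pairing K \<psi> F H \<in> U}"
    if "H \<in> tests" "open U" "coorbit_pairing K \<psi> F H \<in> U" for H U
  proof (rule limitinD[OF lim])
    show "openin (coorbit_weak_star K \<psi> w) {F \<in> \<H>. coorbit_pairing K \<psi> F H \<in> U}"
      unfolding coorbit_weak_star_def by (rule topology_generated_by_Basis) (use that in blast)
  qed (use F that in simp)
  obtain H where "H \<in> tests"
    using tests_nonempty by blast
  from basis[OF this, of UNIV] have "\<forall>\<^sub>F x in net. f x \<in> \<H>"
    by (auto elim: eventually_mono)
  moreover have "((\<lambda>x. coorbit_pairing K \<psi> (f x) H) \<longlongrightarrow> coorbit_pairing K \<psi> F H) net" if "H \<in> tests" for H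
    using basis[OF that] by (intro topological_tendstoI) (simp add: eventually_conj_iff)
  ultimately show "F \<in> \<H> \<and> (\<forall>\<^sub>F x in net. f x \<in> \<H>) \<and>
      (\<forall>H\<in>tests. ((\<lambda>x. coorbit_pairing K \<psi> (f x) H) \<longlongrightarrow> coorbit_pairing K \<psi> F H) net)"
    using F by blast
next
  assume *: "F \<in> \<H> \<and> (\<forall>\<^sub>F x in net. f x \<in> \<H>) \<and>
      (\<forall>H\<in>tests. ((\<lambda>x. coorbit_pairing K \<psi> (f x) H) \<longlongrightarrow> coorbit_pairing K \<psi> F H) net)"
  have "F \<in> U \<longrightarrow> (\<forall>\<^sub>F x in net. f x \<in> U)"
    if "generate_topology_on {{F \<in> \<H>. coorbit_pairing K \<psi> F H \<in> U} | H U. H \<in> tests \<and> open U} U" for U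
    using that
  proof (induction rule: generate_topology_on.induct)
    case Empty
    then show ?case by simp
  next
    case (Int a b)
    then show ?case by (auto intro: eventually_conj)
  next
    case (UN \<K>)
    show ?case
    proof
      assume "F \<in> \<Union>\<K>"
      then obtain V where V: "V \<in> \<K>" "F \<in> V"
        by blast
      then have "\<forall>\<^sub>F x in net. f x \<in> V"
        using UN by blast
      then show "\<forall>\<^sub>F x in net. f x \<in> \<Union>\<K>"
        by (rule eventually_mono) (use V in blast)
    qed
  next
    case (Basis s)
    then obtain H U where HU: "H \<in> tests" "open U" "s = {F \<in> \<H>. coorbit_pairing K \<psi> F H \<in> U}"
      by blast
    show ?case
    proof
      assume "F \<in> s"
      then have "\<forall>\<^sub>F x in net. coorbit_pairing K \<psi> (f x) H \<in> U"
        using * HU by (intro topological_tendstoD) auto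
      with * show "\<forall>\<^sub>F x in net. f x \<in> s"
        unfolding HU(3) by (auto intro: eventually_conj)
    qed
  qed
  then show "limitin (coorbit_weak_star K \<psi> w) f F net"
    unfolding limitin_def topspace_weak_star using *
    by (auto simp: coorbit_weak_star_def openin_topology_generated_by_iff)
qed

text \<open>The embedded dual frame vectors are test elements, and pairing with them reads off the
  coefficients.\<close>

lemma limitin_weak_star_unique:
  assumes "limitin (coorbit_weak_star K \<psi> w) f F net" "limitin (coorbit_weak_star K \<psi> w) f G net"
    and "net \<noteq> bot"
  shows "F = G"
proof (rule coeff_eqI)
  show FG: "F \<in> \<H>" "G \<in> \<H>"
    using assms limitin_weak_star_iff by blast+
  show "coeff F = coeff G"
  proof
    fix k
    show "coeff F k = coeff G k"
    proof (cases "k \<in> K")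
      case True
      let ?H = "coorbit_embed K \<psi> (\<lambda>k. 1 / w k) (dual_vec k)"
      have "?H \<in> tests"
        by (rule embed_test(1)[OF coefs_mem_dual[OF cross_gram_dual_dual True]])
      then have "coorbit_pairing K \<psi> F ?H = coorbit_pairing K \<psi> G ?H"
        using assms unfolding limitin_weak_star_iff by (blast intro: tendsto_unique[OF assms(3)])
      then show ?thesis
        using FG True by (simp add: pairing_dual_vec)
    qed (simp add: coeff_outside)
  qed
qed

end

section \<open>Unconditional convergence of matrix sums\<close>

lemma mat_app_trunc:
  assumes "finite J" "J \<subseteq> K"
  shows "mat_app K A (trunc J c) = (\<lambda>k. \<Sum>l\<in>J. A k l * c l)"
proof
  fix k
  have "((\<lambda>l. A k l * trunc J c l) has_sum (\<Sum>l\<in>J. A k l * c l)) K"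
    by (rule has_sum_finite_neutralI[OF assms]) (auto simp: trunc_def)
  then show "mat_app K A (trunc J c) k = (\<Sum>l\<in>J. A k l * c l)"
    by (simp add: mat_app_def infsumI)
qed

text \<open>Along growing finite sets of index pairs each single column is exhausted. Convergence of
  truncations in one column is thereby pulled back to subsets of the product.\<close>

lemma filterlim_section:
  assumes "j \<in> L"
  shows "filterlim (\<lambda>R. {k. (k, j) \<in> R}) (finite_subsets_at_top K) (finite_subsets_at_top (K \<times> L))"
  unfolding filterlim_def
proof (rule filter_leI)
  fix P assume "eventually P (finite_subsets_at_top K)"
  then obtain I where I: "finite I" "I \<subseteq> K" "\<forall>J. finite J \<and> I \<subseteq> J \<and> J \<subseteq> K \<longrightarrow> P J"
    unfolding eventually_finite_subsets_at_top by auto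
  have "P {k. (k, j) \<in> R}" if R: "finite R" "I \<times> {j} \<subseteq> R" "R \<subseteq> K \<times> L" for R
  proof (rule I(3)[rule_format], intro conjI)
    have "{k. (k, j) \<in> R} \<subseteq> fst ` R"
      by force
    then show "finite {k. (k, j) \<in> R}"
      using R(1) finite_subset by blast
  qed (use R in auto)
  then show "eventually P (filtermap (\<lambda>R. {k. (k, j) \<in> R}) (finite_subsets_at_top (K \<times> L)))"
    unfolding eventually_filtermap eventually_finite_subsets_at_top
    using I assms by (intro exI[of _ "I \<times> {j}"]) auto
qed

locale lp_matrix = L1: weighted_lp K w1 p1 + L2: weighted_lp K w2 p2
  for K :: "'i set" and w1 p1 w2 p2 +
  fixes M :: "'i matrix"
  assumes bounded: "mat_bounded K p1 w1 p2 w2 M"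
begin

definition op_bound :: real where
  "op_bound = (SOME C. 0 \<le> C \<and> (\<forall>c\<in>L1.\<L>. L2.N (mat_app K M c) \<le> C * L1.N c))"

lemma op_bound:
  shows op_bound_nonneg: "0 \<le> op_bound"
    and norm_mat_app_le: "c \<in> L1.\<L> \<Longrightarrow> L2.N (mat_app K M c) \<le> op_bound * L1.N c"
proof -
  obtain C where C: "\<And>c. c \<in> L1.\<L> \<Longrightarrow> L2.N (mat_app K M c) \<le> C * L1.N c"
    using bounded unfolding mat_bounded_def by blast
  have "L2.N (mat_app K M c) \<le> max C 0 * L1.N c" if "c \<in> L1.\<L>" for c
    using C[OF that] mult_right_mono[of C "max C 0", OF _ L1.norm_nonneg[OF that]] by simp
  then have "\<exists>C. 0 \<le> C \<and> (\<forall>c\<in>L1.\<L>. L2.N (mat_app K M c) \<le> C * L1.N c)"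
    by (intro exI[of _ "max C 0"]) auto
  from someI_ex[OF this, folded op_bound_def]
  show "0 \<le> op_bound" "c \<in> L1.\<L> \<Longrightarrow> L2.N (mat_app K M c) \<le> op_bound * L1.N c"
    by auto
qed

lemma M_matrices: "M \<in> matrices K"
  using bounded by (simp add: mat_bounded_def)

lemma mat_app_mem: "c \<in> L1.\<L> \<Longrightarrow> mat_app K M c \<in> L2.\<L>"
  using bounded by (simp add: mat_bounded_def)

lemma row_summable: "c \<in> L1.\<L> \<Longrightarrow> (\<lambda>l. M k l * c l) summable_on K"
  using bounded matrices_outside[OF M_matrices, of k] by (cases "k \<in> K") (auto simp: mat_bounded_def)

lemma mat_app_diff:
  assumes "c \<in> L1.\<L>" "d \<in> L1.\<L>"
  shows "mat_app K M (\<lambda>k. c k - d k) = (\<lambda>k. mat_app K M c k - mat_app K M d k)"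
  unfolding mat_app_def right_diff_distrib
  using assms by (intro ext infsum_diff row_summable)

text \<open>Adjusting the phases of \<open>c\<close> makes all terms of one row series nonnegative.\<close>

lemma row_abs:
  assumes c: "c \<in> L1.\<L>" and k: "k \<in> K"
  shows row_abs_summable: "(\<lambda>l. M k l * c l) abs_summable_on K"
    and row_abs_le: "w2 k * (\<Sum>\<^sub>\<infinity>l\<in>K. cmod (M k l * c l)) \<le> op_bound * L1.N c"
proof -
  show abs: "(\<lambda>l. M k l * c l) abs_summable_on K"
    using row_summable[OF c] by (simp add: summable_on_iff_abs_summable_on_complex)
  define c' where "c' = (\<lambda>l. cnj (sgn (M k l * c l)) * c l)"
  have "cmod (sgn z) \<le> 1" for z :: complex
    by (simp add: norm_sgn)
  then have "cmod (c' l) \<le> cmod (c l)" for l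
    using mult_right_mono[of "cmod (sgn (M k l * c l))" 1 "cmod (c l)"] by (simp add: c'_def norm_mult)
  then have c': "c' \<in> L1.\<L>" "L1.N c' \<le> L1.N c"
    using L1.mem_solid[OF c, of c'] L1.zero_outside[OF c] by (auto simp: c'_def)
  have phase: "cnj (sgn z) * z = of_real (cmod z)" for z :: complex
  proof (cases "z = 0")
    case False
    have "cnj (sgn z) * z = z * cnj z / of_real (cmod z)"
      by (simp add: sgn_div_norm scaleR_conv_of_real field_simps)
    also have "\<dots> = of_real (cmod z)"
      using False by (simp add: complex_norm_square[symmetric] power2_eq_square)
    finally show ?thesis .
  qed simp
  have "M k l * c' l = of_real (cmod (M k l * c l))" for l
    using phase[of "M k l * c l"] by (simp add: c'_def mult_ac)
  then have "mat_app K M c' k = (\<Sum>\<^sub>\<infinity>l\<in>K. of_real (cmod (M k l * c l)))"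
    by (simp add: mat_app_def)
  also have "\<dots> = of_real (\<Sum>\<^sub>\<infinity>l\<in>K. cmod (M k l * c l))"
    using has_sum_of_real[OF has_sum_infsum[OF abs]] by (rule infsumI)
  finally have "cmod (mat_app K M c' k) = (\<Sum>\<^sub>\<infinity>l\<in>K. cmod (M k l * c l))"
    by (simp add: infsum_nonneg)
  then have "w2 k * (\<Sum>\<^sub>\<infinity>l\<in>K. cmod (M k l * c l)) \<le> L2.N (mat_app K M c')"
    using L2.weighted_le_norm[OF mat_app_mem[OF c'(1)] k] by simp
  also have "\<dots> \<le> op_bound * L1.N c'"
    by (rule norm_mat_app_le[OF c'(1)])
  also have "\<dots> \<le> op_bound * L1.N c"
    using c'(2) op_bound_nonneg by (rule mult_left_mono)
  finally show "w2 k * (\<Sum>\<^sub>\<infinity>l\<in>K. cmod (M k l * c l)) \<le> op_bound * L1.N c" .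
qed

text \<open>\<open>M\<close> with its entries outside R set to 0, applied to c. These are the
  coefficients of a tensor partial sum before synthesis.\<close>

definition part :: "('i \<times> 'i) set \<Rightarrow> ('i \<Rightarrow> complex) \<Rightarrow> 'i \<Rightarrow> complex" where
  "part R c = (\<lambda>k. \<Sum>j | (k, j) \<in> R. M k j * c j)"

lemma finite_sections: "finite R \<Longrightarrow> finite {j. (k, j) \<in> R}" "finite R \<Longrightarrow> finite {i. (i, j) \<in> R}"
proof -
  assume R: "finite R"
  have "{j. (k, j) \<in> R} \<subseteq> snd ` R" "{i. (i, j) \<in> R} \<subseteq> fst ` R"
    by force+
  then show "finite {j. (k, j) \<in> R}" "finite {i. (i, j) \<in> R}"
    using R finite_subset by blast+
qed

lemma sum_part:
  assumes "finite R"
  shows "(\<Sum>k\<in>fst ` R. g k * part R c k) = (\<Sum>(k, j)\<in>R. g k * (M k j * c j))"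
proof -
  have "R = (SIGMA k:fst ` R. {j. (k, j) \<in> R})"
    by force
  then have "(\<Sum>(k, j)\<in>R. g k * (M k j * c j)) = (\<Sum>(k, j)\<in>(SIGMA k:fst ` R. {j. (k, j) \<in> R}). g k * (M k j * c j))"
    by simp
  also have "\<dots> = (\<Sum>k\<in>fst ` R. \<Sum>j | (k, j) \<in> R. g k * (M k j * c j))"
    by (rule sum.Sigma[symmetric]) (use assms finite_sections in auto)
  finally show ?thesis
    by (simp add: part_def sum_distrib_left)
qed

lemma part_outside: "k \<notin> fst ` R \<Longrightarrow> part R c k = 0"
proof -
  assume "k \<notin> fst ` R"
  then have "{j. (k, j) \<in> R} = {}"
    by force
  then show ?thesis
    unfolding part_def by simp
qed

lemma part_fin_seqs: "finite R \<Longrightarrow> R \<subseteq> K \<times> K \<Longrightarrow> part R c \<in> fin_seqs K"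
proof -
  assume R: "finite R" "R \<subseteq> K \<times> K"
  have "{k. part R c k \<noteq> 0} \<subseteq> fst ` R"
    using part_outside by blast
  moreover have "fst ` R \<subseteq> K" "finite (fst ` R)"
    using R by auto
  ultimately show ?thesis
    unfolding fin_seqs_def using finite_subset[of _ "fst ` R"] by blast
qed

lemma part_mem: "finite R \<Longrightarrow> R \<subseteq> K \<times> K \<Longrightarrow> part R c \<in> L2.\<L>"
  by (rule L2.mem_fin_seqs[OF part_fin_seqs])

lemma has_sum_part:
  assumes "finite R" "R \<subseteq> K \<times> K"
  shows "((\<lambda>k. g k * part R c k) has_sum (\<Sum>(k, j)\<in>R. g k * (M k j * c j))) K"
  unfolding sum_part[OF assms(1), symmetric]
  by (rule has_sum_finite_neutralI) (use assms part_outside in auto)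

lemma part_diff: "part R (\<lambda>j. c j - d j) = (\<lambda>k. part R c k - part R d k)"
  by (simp add: part_def right_diff_distrib sum_subtractf)

lemma part_rectangle:
  assumes "finite I" "I \<subseteq> K" "finite J" "J \<subseteq> K"
  shows "part (I \<times> J) c = trunc I (mat_app K M (trunc J c))"
proof
  fix k
  show "part (I \<times> J) c k = trunc I (mat_app K M (trunc J c)) k"
    unfolding mat_app_trunc[OF assms(3,4)] by (cases "k \<in> I") (simp_all add: part_def trunc_def)
qed

text \<open>On a rectangle the partial sum is \<open>M\<close> between two truncations. The error is
  at most \<open>op_bound\<close> times the truncation error of c plus the truncation error of M c;
  the first depends on J alone and the second on I alone, which gives the limit along the product
  filter.\<close>

lemma tendsto_rectangles:
  assumes p: "p1 \<noteq> \<infinity>" "p2 \<noteq> \<infinity>" and c: "c \<in> L1.\<L>"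
  shows "((\<lambda>(I, J). L2.N (\<lambda>k. part (I \<times> J) c k - mat_app K M c k)) \<longlongrightarrow> 0)
    (finite_subsets_at_top K \<times>\<^sub>F finite_subsets_at_top K)"
proof (rule Lim_null_comparison)
  let ?d = "mat_app K M c"
  let ?g = "\<lambda>I. L2.N (\<lambda>k. ?d k - trunc I ?d k)" and ?f = "\<lambda>J. op_bound * L1.N (\<lambda>k. c k - trunc J c k)"
  have d: "?d \<in> L2.\<L>"
    by (rule mat_app_mem[OF c])
  have "(?g \<longlongrightarrow> 0) (finite_subsets_at_top K)"
    by (rule L2.tendsto_trunc[OF d p(2)])
  moreover have "(?f \<longlongrightarrow> 0) (finite_subsets_at_top K)"
    by (rule tendsto_mult_right_zero[OF L1.tendsto_trunc[OF c p(1)]])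
  ultimately have "((\<lambda>x. ?f (snd x) + ?g (fst x)) \<longlongrightarrow> 0 + 0) (finite_subsets_at_top K \<times>\<^sub>F finite_subsets_at_top K)"
    by (intro tendsto_add) (rule filterlim_compose, assumption, rule filterlim_snd filterlim_fst)+
  then show "((\<lambda>x. ?f (snd x) + ?g (fst x)) \<longlongrightarrow> 0) (finite_subsets_at_top K \<times>\<^sub>F finite_subsets_at_top K)"
    by simp
  have "norm (L2.N (\<lambda>k. part (I \<times> J) c k - ?d k)) \<le> ?f J + ?g I"
    if I: "finite I" "I \<subseteq> K" and J: "finite J" "J \<subseteq> K" for I J
  proof -
    let ?e = "mat_app K M (trunc J c)"
    have t: "trunc J c \<in> L1.\<L>"
      by (rule L1.mem_trunc[OF c])
    have e: "?e \<in> L2.\<L>"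
      by (rule mat_app_mem[OF t])
    have ed: "(\<lambda>k. ?e k - ?d k) \<in> L2.\<L>"
      by (rule L2.mem_diff[OF e d])
    have "L2.N (\<lambda>k. trunc I ?e k - ?d k) \<le> L2.N (\<lambda>k. trunc I ?e k - trunc I ?d k) + L2.N (\<lambda>k. trunc I ?d k - ?d k)"
      by (intro L2.norm_diff_triangle L2.mem_trunc d e)
    also have "(\<lambda>k. trunc I ?e k - trunc I ?d k) = trunc I (\<lambda>k. ?e k - ?d k)"
      by (auto simp: trunc_def)
    also have "L2.N (trunc I (\<lambda>k. ?e k - ?d k)) \<le> L2.N (\<lambda>k. ?e k - ?d k)"
      by (rule L2.norm_trunc_le[OF ed])
    also have "\<dots> = L2.N (mat_app K M (\<lambda>k. trunc J c k - c k))"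
      by (simp add: mat_app_diff[OF t c])
    also have "\<dots> \<le> op_bound * L1.N (\<lambda>k. trunc J c k - c k)"
      by (rule norm_mat_app_le[OF L1.mem_diff[OF t c]])
    finally have "L2.N (\<lambda>k. part (I \<times> J) c k - ?d k) \<le> ?f J + ?g I"
      using L1.norm_diff_commute[OF t c] L2.norm_diff_commute[OF L2.mem_trunc[OF d] d]
      by (simp add: part_rectangle[OF I J])
    moreover have "0 \<le> L2.N (\<lambda>k. part (I \<times> J) c k - ?d k)"
      using I J by (intro L2.norm_nonneg L2.mem_diff part_mem d) auto
    ultimately show ?thesis by simp
  qed
  moreover have "\<forall>\<^sub>F x in finite_subsets_at_top K \<times>\<^sub>F finite_subsets_at_top K.
      (finite (fst x) \<and> fst x \<subseteq> K) \<and> (finite (snd x) \<and> snd x \<subseteq> K)"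
    by (rule eventually_prodI) (auto intro!: eventually_finite_subsets_at_top_weakI)
  ultimately show "\<forall>\<^sub>F x in finite_subsets_at_top K \<times>\<^sub>F finite_subsets_at_top K.
      norm (case x of (I, J) \<Rightarrow> L2.N (\<lambda>k. part (I \<times> J) c k - ?d k)) \<le> ?f (snd x) + ?g (fst x)"
    by (auto elim!: eventually_mono)
qed

lemma column_mem: "j \<in> K \<Longrightarrow> (\<lambda>k. M k j) \<in> L2.\<L>"
proof -
  assume j: "j \<in> K"
  have "trunc {j} (\<lambda>_. 1) \<in> L1.\<L>"
    using j by (intro L1.mem_fin_seqs L1.trunc_fin_seqs) auto
  from mat_app_mem[OF this] show ?thesis
    using j by (simp add: mat_app_trunc)
qed

lemma part_column_sum:
  assumes "finite R" "finite J" "snd ` R \<subseteq> J"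
  shows "part R c = (\<lambda>k. \<Sum>j\<in>J. c j * trunc {i. (i, j) \<in> R} (\<lambda>i. M i j) k)"
proof
  fix k
  have "(\<Sum>j\<in>J. c j * trunc {i. (i, j) \<in> R} (\<lambda>i. M i j) k) = (\<Sum>j\<in>J. if (k, j) \<in> R then M k j * c j else 0)"
    by (rule sum.cong) (auto simp: trunc_def)
  also have "\<dots> = (\<Sum>j\<in>J \<inter> {j. (k, j) \<in> R}. M k j * c j)"
    using assms(2) by (simp add: sum.inter_restrict)
  also have "J \<inter> {j. (k, j) \<in> R} = {j. (k, j) \<in> R}"
    using assms(3) by force
  finally show "part R c k = (\<Sum>j\<in>J. c j * trunc {i. (i, j) \<in> R} (\<lambda>i. M i j) k)"
    by (simp add: part_def)
qed

text \<open>For general exponents deleting arbitrary entries destroys the operator bound; two cases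
  survive. If p1 = 1, the sum is split into columns, and a column cut down by R is no larger than
  the full one, whose norm is at most \<open>op_bound\<close> times w1 j. If both exponents are 0,
  the norm sees one row at a time, and \<open>row_abs_le\<close> bounds the absolute row
  sums.\<close>

lemma part_bounded:
  assumes p: "p1 = 1 \<or> p1 = 0 \<and> p2 = 0" and R: "finite R" "R \<subseteq> K \<times> K" and c: "c \<in> L1.\<L>"
  shows "L2.N (part R c) \<le> op_bound * L1.N c"
  using p
proof
  assume p1: "p1 = 1"
  have column: "L2.N (\<lambda>k. M k j) \<le> op_bound * w1 j" if j: "j \<in> K" for j
  proof -
    let ?e = "trunc {j} (\<lambda>_. 1)"
    have e: "?e \<in> L1.\<L>"
      using j by (intro L1.mem_fin_seqs L1.trunc_fin_seqs) auto
    have "((\<lambda>l. w1 l * cmod (?e l)) has_sum w1 j) K"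
      by (rule has_sum_finite_neutralI[of "{j}"]) (use j in \<open>auto simp: trunc_def\<close>)
    then have "L1.N ?e = w1 j"
      using L1.weight_pos by (simp add: p1 lp_norm_1 infsumI)
    then show ?thesis
      using norm_mat_app_le[OF e] j by (simp add: mat_app_trunc)
  qed
  have K: "j \<in> K" if "j \<in> snd ` R" for j
    using that R(2) by auto
  have mem: "trunc I (\<lambda>i. M i j) \<in> L2.\<L>" if "j \<in> snd ` R" for I j
    by (intro L2.mem_trunc column_mem K that)
  have "L2.N (part R c) \<le> (\<Sum>j\<in>snd ` R. L2.N (\<lambda>k. c j * trunc {i. (i, j) \<in> R} (\<lambda>i. M i j) k))"
    unfolding part_column_sum[OF R(1) finite_imageI[OF R(1)] order_refl]
    by (intro L2.norm_sum_le L2.mem_scale mem) (use R in auto)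
  also have "\<dots> \<le> (\<Sum>j\<in>snd ` R. op_bound * (w1 j * cmod (c j)))"
  proof (rule sum_mono)
    fix j assume j: "j \<in> snd ` R"
    have "L2.N (\<lambda>k. c j * trunc {i. (i, j) \<in> R} (\<lambda>i. M i j) k) = cmod (c j) * L2.N (trunc {i. (i, j) \<in> R} (\<lambda>i. M i j))"
      by (rule L2.norm_scale[OF mem[OF j]])
    also have "\<dots> \<le> cmod (c j) * (op_bound * w1 j)"
      using order_trans[OF L2.norm_trunc_le[OF column_mem] column, OF K[OF j] K[OF j]]
      by (intro mult_left_mono) auto
    finally show "L2.N (\<lambda>k. c j * trunc {i. (i, j) \<in> R} (\<lambda>i. M i j) k) \<le> op_bound * (w1 j * cmod (c j))"
      by (simp add: mult_ac)
  qed
  also have "\<dots> = op_bound * (\<Sum>j\<in>snd ` R. w1 j * cmod (c j))"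
    by (simp add: sum_distrib_left)
  also have "(\<Sum>j\<in>snd ` R. w1 j * cmod (c j)) \<le> L1.N c"
  proof -
    have "(\<lambda>j. w1 j * cmod (c j)) summable_on K"
      using c lp_space_1_iff[of K w1] L1.weight_pos p1 by auto
    from finite_sum_le_infsum[OF this, of "snd ` R"] show ?thesis
      using R K L1.weighted_nonneg L1.weight_pos by (auto simp: p1 lp_norm_1)
  qed
  finally show ?thesis
    using op_bound_nonneg by (simp add: mult_left_mono)
next
  assume p0: "p1 = 0 \<and> p2 = 0"
  show ?thesis
  proof (rule L2.norm_le_sup)
    fix k assume k: "k \<in> K"
    have "cmod (part R c k) \<le> (\<Sum>j | (k, j) \<in> R. cmod (M k j * c j))"
      unfolding part_def by (rule norm_sum)
    also have "\<dots> \<le> (\<Sum>\<^sub>\<infinity>j\<in>K. cmod (M k j * c j))"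
      using finite_sections R by (intro finite_sum_le_infsum row_abs_summable[OF c k]) auto
    finally have "w2 k * cmod (part R c k) \<le> w2 k * (\<Sum>\<^sub>\<infinity>j\<in>K. cmod (M k j * c j))"
      using L2.weight_nonneg[OF k] by (rule mult_left_mono)
    also have "\<dots> \<le> op_bound * L1.N c"
      by (rule row_abs_le[OF c k])
    finally show "w2 k * cmod (part R c k) \<le> op_bound * L1.N c" .
  qed (use p0 op_bound_nonneg L1.norm_nonneg[OF c] in auto)
qed

text \<open>The uniform bound reduces convergence to finite sequences: c is split into a truncation
  \<open>c1\<close> and a small rest \<open>c2\<close>. The rest contributes through both M and
  \<open>part\<close>, whence the factor 2; for \<open>c1\<close> only the finitely many columns in
  J remain, each of which converges by \<open>filterlim_section\<close>.\<close>

lemma tendsto_part: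
  assumes p: "p1 = 1 \<or> p1 = 0 \<and> p2 = 0" "p2 \<noteq> \<infinity>" and c: "c \<in> L1.\<L>"
  shows "((\<lambda>R. L2.N (\<lambda>k. part R c k - mat_app K M c k)) \<longlongrightarrow> 0) (finite_subsets_at_top (K \<times> K))"
proof (rule tendstoI)
  fix \<epsilon> :: real assume "0 < \<epsilon>"
  let ?F = "finite_subsets_at_top (K \<times> K)"
  have "p1 \<noteq> \<infinity>"
    using p(1) by (auto simp: infinity_ennreal_def)
  from tendsto_mult_right_zero[OF L1.tendsto_trunc[OF c this], of "2 * op_bound"]
  have "\<forall>\<^sub>F J in finite_subsets_at_top K. 2 * op_bound * L1.N (\<lambda>k. c k - trunc J c k) < \<epsilon> / 2"
    using \<open>0 < \<epsilon>\<close> by (intro order_tendstoD) auto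
  then obtain J where J: "finite J" "J \<subseteq> K" "2 * op_bound * L1.N (\<lambda>k. c k - trunc J c k) < \<epsilon> / 2"
    unfolding eventually_finite_subsets_at_top by blast
  define c1 c2 where "c1 = trunc J c" and "c2 = (\<lambda>k. c k - trunc J c k)"
  have c1: "c1 \<in> L1.\<L>" and c2: "c2 \<in> L1.\<L>"
    unfolding c1_def c2_def by (intro L1.mem_trunc L1.mem_diff c)+
  let ?m = "\<lambda>j k. M k j"
  let ?g = "\<lambda>R. \<Sum>j\<in>J. cmod (c j) * L2.N (\<lambda>k. ?m j k - trunc {i. (i, j) \<in> R} (?m j) k)"
  have "(?g \<longlongrightarrow> (\<Sum>j\<in>J. cmod (c j) * 0)) ?F"
    using J by (intro tendsto_sum tendsto_mult tendsto_const
        filterlim_compose[OF L2.tendsto_trunc filterlim_section] column_mem p(2)) auto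
  then have "\<forall>\<^sub>F R in ?F. ?g R < \<epsilon> / 2"
    using \<open>0 < \<epsilon>\<close> by (intro order_tendstoD) auto
  moreover have "\<forall>\<^sub>F R in ?F. finite R \<and> R \<subseteq> K \<times> K"
    by (intro eventually_finite_subsets_at_top_weakI) auto
  ultimately show "\<forall>\<^sub>F R in ?F. dist (L2.N (\<lambda>k. part R c k - mat_app K M c k)) 0 < \<epsilon>"
  proof eventually_elim
    fix R assume g: "?g R < \<epsilon> / 2" and R: "finite R \<and> R \<subseteq> K \<times> K"
    have Mc: "mat_app K M c \<in> L2.\<L>" "mat_app K M c1 \<in> L2.\<L>" "mat_app K M c2 \<in> L2.\<L>"
      by (intro mat_app_mem c c1 c2)+
    have parts: "part R c \<in> L2.\<L>" "part R c1 \<in> L2.\<L>" "part R c2 \<in> L2.\<L>"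
      using R part_mem by auto
    have diff: "mat_app K M c k - part R c k =
        (mat_app K M c1 k - part R c1 k) + (mat_app K M c2 k - part R c2 k)" for k
      using fun_cong[OF mat_app_diff[OF c c1], of k] fun_cong[OF part_diff[of R c c1], of k]
      by (simp add: c2_def c1_def)
    have "L2.N (\<lambda>k. mat_app K M c k - part R c k) \<le>
        L2.N (\<lambda>k. mat_app K M c1 k - part R c1 k) + L2.N (\<lambda>k. mat_app K M c2 k - part R c2 k)"
      unfolding diff by (intro L2.norm_triangle L2.mem_diff Mc parts)
    also have "L2.N (\<lambda>k. mat_app K M c2 k - part R c2 k) \<le> 2 * op_bound * L1.N c2"
    proof -
      have "L2.N (\<lambda>k. mat_app K M c2 k - part R c2 k) \<le> L2.N (mat_app K M c2) + L2.N (part R c2)"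
        using L2.norm_diff_triangle[OF Mc(3) L2.mem_zero parts(3)] L2.norm_scale[OF parts(3), of "-1"] by simp
      also have "\<dots> \<le> op_bound * L1.N c2 + op_bound * L1.N c2"
        using R by (intro add_mono norm_mat_app_le c2 part_bounded p(1)) auto
      finally show ?thesis by (simp add: mult_ac)
    qed
    also have "L2.N (\<lambda>k. mat_app K M c1 k - part R c1 k) \<le> ?g R"
    proof -
      \<comment> \<open>The column decomposition requires an index set containing all second
        coordinates of R; the added columns contribute 0 because \<open>c1\<close> vanishes off
        J.\<close>
      define J' where "J' = J \<union> snd ` R"
      have J': "finite J'" "snd ` R \<subseteq> J'" "J' \<subseteq> K"
        using J R by (auto simp: J'_def)
      have "mat_app K M c1 k = (\<Sum>j\<in>J. M k j * c j)" for k
        using fun_cong[OF mat_app_trunc[OF J(1,2)], of M c k] by (simp add: c1_def)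
      moreover have "part R c1 k = (\<Sum>j\<in>J. c j * trunc {i. (i, j) \<in> R} (?m j) k)" for k
      proof -
        have "part R c1 k = (\<Sum>j\<in>J'. c1 j * trunc {i. (i, j) \<in> R} (?m j) k)"
          using fun_cong[OF part_column_sum[OF _ J'(1,2)], of c1 k] R by blast
        also have "\<dots> = (\<Sum>j\<in>J. c1 j * trunc {i. (i, j) \<in> R} (?m j) k)"
          by (rule sum.mono_neutral_right) (use J' in \<open>auto simp: J'_def c1_def trunc_def\<close>)
        finally show ?thesis
          by (simp add: c1_def trunc_def)
      qed
      ultimately have eq: "mat_app K M c1 k - part R c1 k =
          (\<Sum>j\<in>J. c j * (?m j k - trunc {i. (i, j) \<in> R} (?m j) k))" for k
        by (simp add: right_diff_distrib sum_subtractf mult.commute)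
      have mem: "(\<lambda>k. ?m j k - trunc {i. (i, j) \<in> R} (?m j) k) \<in> L2.\<L>" if "j \<in> J" for j
        using that J by (intro L2.mem_diff L2.mem_trunc column_mem) auto
      have "L2.N (\<lambda>k. mat_app K M c1 k - part R c1 k) \<le>
          (\<Sum>j\<in>J. L2.N (\<lambda>k. c j * (?m j k - trunc {i. (i, j) \<in> R} (?m j) k)))"
        unfolding eq by (intro L2.norm_sum_le J L2.mem_scale mem)
      also have "\<dots> = ?g R"
        by (intro sum.cong refl L2.norm_scale mem)
      finally show ?thesis .
    qed
    finally have "L2.N (\<lambda>k. mat_app K M c k - part R c k) < \<epsilon>"
      using g J(3) by (simp add: c2_def)
    moreover have "0 \<le> L2.N (\<lambda>k. mat_app K M c k - part R c k)"
      by (intro L2.norm_nonneg L2.mem_diff Mc parts)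
    ultimately show "dist (L2.N (\<lambda>k. part R c k - mat_app K M c k)) 0 < \<epsilon>"
      using L2.norm_diff_commute[OF Mc(1) parts(1)] by simp
  qed
qed

end

section \<open>Operators between coorbit spaces\<close>

context hilbert_frame
begin

text \<open>A frame and its dual cancel when they meet inside a product. Both the membership of
  mixed cross-Gram matrices in \<A> and the identities \<open>V_U\<close> and \<open>Y_X\<close> of
  the final locale come from this.\<close>

lemma mat_mult_cross_gram:
  "mat_mult K (cross_gram K \<xi> \<psi>) (cross_gram K (dual_frame K \<psi>) \<eta>) = cross_gram K \<xi> \<eta>"
  "mat_mult K (cross_gram K \<xi> (dual_frame K \<psi>)) (cross_gram K \<psi> \<eta>) = cross_gram K \<xi> \<eta>"
proof -
  have "mat_mult K (cross_gram K \<xi> \<alpha>) (cross_gram K \<beta> \<eta>) = cross_gram K \<xi> \<eta>"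
    if *: "\<And>f g. ((\<lambda>k. cinner f (\<beta> k) * cinner (\<alpha> k) g) has_sum cinner f g) K" for \<alpha> \<beta>
  proof (intro ext)
    fix k l
    show "mat_mult K (cross_gram K \<xi> \<alpha>) (cross_gram K \<beta> \<eta>) k l = cross_gram K \<xi> \<eta> k l"
    proof (cases "k \<in> K \<and> l \<in> K")
      case True
      have "((\<lambda>m. cross_gram K \<xi> \<alpha> k m * cross_gram K \<beta> \<eta> m l) has_sum cinner (\<eta> l) (\<xi> k)) K"
        using *[of "\<eta> l" "\<xi> k"]
        by (rule has_sum_cong[THEN iffD1, rotated]) (use True in \<open>simp add: cross_gram_def mult.commute\<close>)
      then show ?thesis
        using True by (simp add: mat_mult_def infsumI cross_gram_def)
    next
      case False
      then have "cross_gram K \<xi> \<alpha> k m * cross_gram K \<beta> \<eta> m l = 0" for m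
        by (auto simp: cross_gram_def)
      then show ?thesis
        using False by (simp add: mat_mult_def) (auto simp: cross_gram_def)
    qed
  qed
  from this[OF has_sum_cinner_dual_left] this[OF has_sum_cinner_dual_right]
  show "mat_mult K (cross_gram K \<xi> \<psi>) (cross_gram K (dual_frame K \<psi>) \<eta>) = cross_gram K \<xi> \<eta>"
    "mat_mult K (cross_gram K \<xi> (dual_frame K \<psi>)) (cross_gram K \<psi> \<eta>) = cross_gram K \<xi> \<eta>"
    by auto
qed

end

context coorbit_space
begin

lemma proj_mat_app:
  assumes "cross_gram K dual_vec \<xi> \<in> \<A>" "c \<in> inf.\<L>"
  shows "mat_app K proj (mat_app K (cross_gram K dual_vec \<xi>) c) = mat_app K (cross_gram K dual_vec \<xi>) c"
  using mat_app_mat_app[OF row_bounded(1)[OF cross_gram_dual_left] row_bounded(1)[OF assms(1)] assms(2)]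
  by (simp add: mat_mult_cross_gram)

lemma pairing_mat_app:
  assumes A: "A \<in> \<A>" and c: "c \<in> inf.\<L>" and F: "coeff F = mat_app K A c" and H: "H \<in> tests"
  shows "coorbit_pairing K \<psi> F H = (\<Sum>\<^sub>\<infinity>l\<in>K. vec_mat K (functional H) A l * c l)"
  using mat_app_swap[OF row_bounded(1)[OF A] c functional_mem[OF H]]
  by (simp add: pairing_eq F mult.commute)

text \<open>Moving A to the test side turns the pairing into the series of e l * c l with e in the
  predual, which converges absolutely. The pairings with the truncated classes are its partial
  sums.\<close>

lemma limitin_weak_star_trunc:
  assumes A: "A \<in> \<A>" and c: "c \<in> inf.\<L>" and F: "F \<in> \<H>" "coeff F = mat_app K A c"
    and FJ: "\<And>J. finite J \<Longrightarrow> J \<subseteq> K \<Longrightarrow> FJ J \<in> \<H>"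
      "\<And>J. finite J \<Longrightarrow> J \<subseteq> K \<Longrightarrow> coeff (FJ J) = mat_app K A (trunc J c)"
  shows "limitin (coorbit_weak_star K \<psi> w) FJ F (finite_subsets_at_top K)"
  unfolding limitin_weak_star_iff
proof (intro conjI ballI F(1))
  show "\<forall>\<^sub>F J in finite_subsets_at_top K. FJ J \<in> \<H>"
    by (rule eventually_finite_subsets_at_top_weakI) (rule FJ(1))
  fix H assume H: "H \<in> tests"
  define e where "e = vec_mat K (functional H) A"
  have e: "e \<in> dual.\<L>"
    unfolding e_def by (rule vec_mat_mem_dual[OF row_bounded(1)[OF A] functional_mem[OF H]])
  have "(\<lambda>l. e l * c l) summable_on K"
    using abs_summable_summable[OF pairing_abs_summable[OF c e]] by (simp add: mult.commute)
  then have "((\<lambda>J. \<Sum>l\<in>J. e l * c l) \<longlongrightarrow> coorbit_pairing K \<psi> F H) (finite_subsets_at_top K)"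
    unfolding pairing_mat_app[OF A c F(2) H] e_def[symmetric] by (rule infsum_tendsto)
  moreover have "coorbit_pairing K \<psi> (FJ J) H = (\<Sum>l\<in>J. e l * c l)" if J: "finite J" "J \<subseteq> K" for J
  proof -
    have "((\<lambda>l. e l * trunc J c l) has_sum (\<Sum>l\<in>J. e l * c l)) K"
      by (rule has_sum_finite_neutralI[OF J]) (auto simp: trunc_def)
    then show ?thesis
      unfolding pairing_mat_app[OF A inf.mem_trunc[OF c] FJ(2)[OF J] H] e_def[symmetric]
      by (rule infsumI)
  qed
  ultimately show "((\<lambda>J. coorbit_pairing K \<psi> (FJ J) H) \<longlongrightarrow> coorbit_pairing K \<psi> F H) (finite_subsets_at_top K)"
    by (elim Lim_transform_eventually) (auto intro!: eventually_finite_subsets_at_top_weakI)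
qed

end

context coorbit_lp
begin

lemma norm_mat_app_tendsto_0:
  assumes A: "A \<in> \<A>" and c: "c \<in> lp.\<L>" and f: "\<forall>\<^sub>F x in net. f x \<in> lp.\<L>"
    and lim: "((\<lambda>x. lp.N (\<lambda>k. f x k - c k)) \<longlongrightarrow> 0) net"
  shows "((\<lambda>x. lp.N (\<lambda>k. mat_app K A (f x) k - mat_app K A c k)) \<longlongrightarrow> 0) net"
proof -
  obtain C where C: "0 \<le> C" "\<And>c. c \<in> lp.\<L> \<Longrightarrow> lp.N (mat_app K A c) \<le> C * lp.N c"
    using mat_app_norm[OF A] by blast
  show ?thesis
  proof (rule Lim_null_comparison)
    show "((\<lambda>x. C * lp.N (\<lambda>k. f x k - c k)) \<longlongrightarrow> 0) net"
      by (rule tendsto_mult_right_zero[OF lim])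
    show "\<forall>\<^sub>F x in net. norm (lp.N (\<lambda>k. mat_app K A (f x) k - mat_app K A c k)) \<le> C * lp.N (\<lambda>k. f x k - c k)"
      using f
    proof eventually_elim
      fix x assume x: "f x \<in> lp.\<L>"
      have eq: "(\<lambda>k. mat_app K A (f x) k - mat_app K A c k) = mat_app K A (\<lambda>k. f x k - c k)"
        by (rule mat_app_diff[OF A lp.mem_linf[OF x] lp.mem_linf[OF c], symmetric])
      show "norm (lp.N (\<lambda>k. mat_app K A (f x) k - mat_app K A c k)) \<le> C * lp.N (\<lambda>k. f x k - c k)"
        unfolding eq using C(2)[OF lp.mem_diff[OF x c]]
          lp.norm_nonneg[OF mat_app_mem[OF A lp.mem_diff[OF x c]]] by simp
    qed
  qed
qed

lemma limitin_norm_mat_app: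
  assumes A: "A \<in> \<A>" and c: "c \<in> lp.\<L>" and F: "F \<in> \<H>p" "coeff F = mat_app K A c"
    and FJ: "\<forall>\<^sub>F x in net. FJ x \<in> \<H>p \<and> f x \<in> lp.\<L> \<and> coeff (FJ x) = mat_app K A (f x)"
    and lim: "((\<lambda>x. lp.N (\<lambda>k. f x k - c k)) \<longlongrightarrow> 0) net"
  shows "limitin (coorbit_norm_topology K \<psi> p w) FJ F net"
proof (rule limitin_normI[OF F(1)])
  show "\<forall>\<^sub>F x in net. FJ x \<in> \<H>p"
    using FJ by (auto elim: eventually_mono)
  have "\<forall>\<^sub>F x in net. f x \<in> lp.\<L>"
    using FJ by (auto elim: eventually_mono)
  from norm_mat_app_tendsto_0[OF A c this lim]
  show "((\<lambda>x. lp.N (\<lambda>k. coeff (FJ x) k - coeff F k)) \<longlongrightarrow> 0) net"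
    by (rule Lim_transform_eventually) (use FJ in \<open>auto simp: F(2) elim!: eventually_mono\<close>)
qed

lemma coefs_column:
  assumes "l \<in> K"
  shows "coefs (\<xi> l) = (\<lambda>k. cross_gram K dual_vec \<xi> k l)"
  using assms by (auto simp: analysis_op_def cross_gram_def)

lemma coefs_column_mem:
  assumes A: "cross_gram K dual_vec \<xi> \<in> \<A>" and l: "l \<in> K"
  shows "coefs (\<xi> l) \<in> lp.\<L>"
proof -
  have "trunc {l} (\<lambda>_. 1) \<in> lp.\<L>"
    using l by (intro lp.mem_fin_seqs lp.trunc_fin_seqs) auto
  from mat_app_mem[OF A this] show ?thesis
    using l by (simp add: mat_app_trunc coefs_column)
qed

lemma embed_column:
  assumes A: "cross_gram K dual_vec \<xi> \<in> \<A>" and l: "l \<in> K"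
  shows "coorbit_embed K \<psi> w (\<xi> l) \<in> \<H>p"
    and "coeff (coorbit_embed K \<psi> w (\<xi> l)) = (\<lambda>k. cross_gram K dual_vec \<xi> k l)"
  using embed_mem_p[OF coefs_column_mem[OF A l]] coeff_embed[OF lp.mem_linf[OF coefs_column_mem[OF A l]]]
  by (simp_all add: coefs_column[OF l])

lemma coorbit_synthesis:
  assumes A: "cross_gram K dual_vec \<xi> \<in> \<A>" and c: "c \<in> lp.\<L>"
  obtains F where "F \<in> \<H>p" "coeff F = mat_app K (cross_gram K dual_vec \<xi>) c"
  using coorbit_exists_p[OF mat_app_mem[OF A c] proj_mat_app[OF A lp.mem_linf[OF c]]] by blast

end

text \<open>The pair \<open>(a, b)\<close> stands for \<open>(\<phi>, dual \<phi>)\<close> or \<open>(dual \<phi>, \<phi>)\<close>, and \<open>(x, y)\<close> for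
  \<open>(\<psi>, dual \<psi>)\<close> or \<open>(dual \<psi>, \<psi>)\<close>. On coefficient sequences the matrix \<open>M\<close> of \<open>T\<close>
  with respect to \<open>b\<close> and \<open>y\<close> acts as \<open>U T Y\<close>, so that \<open>V M X = V U T Y X = T\<close>.\<close>

locale expansion = coorbit_frame K \<A> nrm \<psi>
  + X1: coorbit_lp K \<A> nrm \<psi> w1 p1 + X2: coorbit_lp K \<A> nrm \<psi> w2 p2
  for K :: "'i set" and \<A> nrm and \<psi> :: "'i \<Rightarrow> 'h::complex_hilbert_space" and w1 p1 w2 p2 +
  fixes a b x y :: "'i \<Rightarrow> 'h" and T :: "'h coorb \<Rightarrow> 'h coorb"
  assumes U_mem: "cross_gram K b \<psi> \<in> \<A>" and V_mem: "cross_gram K dual_vec a \<in> \<A>"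
    and X_mem: "cross_gram K x \<psi> \<in> \<A>" and Y_mem: "cross_gram K dual_vec y \<in> \<A>"
    and b_test: "cross_gram K b dual_vec \<in> \<A>" and x_test: "cross_gram K x dual_vec \<in> \<A>"
    and V_U: "mat_mult K (cross_gram K dual_vec a) (cross_gram K b \<psi>) = proj"
    and Y_X: "mat_mult K (cross_gram K dual_vec y) (cross_gram K x \<psi>) = proj"
    and zero_exponents: "p1 = 0 \<Longrightarrow> p2 = 0"
    and T_blin: "T \<in> coorbit_blinops K \<psi> p1 w1 p2 w2"
    and T_weak_star: "p1 = \<infinity> \<Longrightarrow> continuous_map (coorbit_weak_star K \<psi> w1) (coorbit_weak_star K \<psi> w2) T"
begin

abbreviation U where "U \<equiv> cross_gram K b \<psi>"
abbreviation V where "V \<equiv> cross_gram K dual_vec a"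
abbreviation X where "X \<equiv> cross_gram K x \<psi>"
abbreviation Y where "Y \<equiv> cross_gram K dual_vec y"

definition M :: "'i matrix" where "M = matrix_of K \<psi> w1 w2 b y T"

lemma T_mem: "F \<in> X1.\<H>p \<Longrightarrow> T F \<in> X2.\<H>p"
  using T_blin by (auto simp: coorbit_blinops_def)

lemma T_extensional: "F \<notin> X1.\<H>p \<Longrightarrow> T F = undefined"
  using T_blin by (auto simp: coorbit_blinops_def PiE_def extensional_def)

lemma coeff_T_add:
  assumes "F \<in> X1.\<H>p" "G \<in> X1.\<H>p"
  shows "coeff (T (coorbit_add K \<psi> w1 F G)) = (\<lambda>k. coeff (T F) k + coeff (T G) k)"
proof -
  have "T (coorbit_add K \<psi> w1 F G) = coorbit_add K \<psi> w2 (T F) (T G)"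
    using T_blin assms by (auto simp: coorbit_blinops_def)
  then show ?thesis
    using assms by (simp add: X2.coeff_add X2.\<H>p_subset T_mem)
qed

lemma coeff_T_scale:
  assumes "F \<in> X1.\<H>p"
  shows "coeff (T (coorbit_scale K \<psi> w1 z F)) = (\<lambda>k. z * coeff (T F) k)"
proof -
  have "T (coorbit_scale K \<psi> w1 z F) = coorbit_scale K \<psi> w2 z (T F)"
    using T_blin assms by (auto simp: coorbit_blinops_def)
  then show ?thesis
    using assms by (simp add: X2.coeff_scale X2.\<H>p_subset T_mem)
qed

lemma T_bounded:
  obtains C where "0 \<le> C" "\<And>F. F \<in> X1.\<H>p \<Longrightarrow> X2.lp.N (coeff (T F)) \<le> C * X1.lp.N (coeff F)"
proof -
  obtain C where C: "\<And>F. F \<in> X1.\<H>p \<Longrightarrow> X2.lp.N (coeff (T F)) \<le> C * X1.lp.N (coeff F)"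
    using T_blin unfolding coorbit_blinops_def coorbit_norm_def by blast
  have "X2.lp.N (coeff (T F)) \<le> max C 0 * X1.lp.N (coeff F)" if F: "F \<in> X1.\<H>p" for F
    using C[OF F] mult_right_mono[of C "max C 0", OF _ X1.lp.norm_nonneg[OF X1.coeff_mem[OF F]]] by simp
  then show thesis
    by (intro that[of "max C 0"]) auto
qed

lemma norm_T_diff:
  obtains C where "0 \<le> C" "\<And>F G. F \<in> X1.\<H>p \<Longrightarrow> G \<in> X1.\<H>p \<Longrightarrow>
    X2.lp.N (\<lambda>k. coeff (T F) k - coeff (T G) k) \<le> C * X1.lp.N (\<lambda>k. coeff F k - coeff G k)"
proof -
  obtain C where C: "0 \<le> C" "\<And>F. F \<in> X1.\<H>p \<Longrightarrow> X2.lp.N (coeff (T F)) \<le> C * X1.lp.N (coeff F)"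
    using T_bounded by blast
  have "X2.lp.N (\<lambda>k. coeff (T F) k - coeff (T G) k) \<le> C * X1.lp.N (\<lambda>k. coeff F k - coeff G k)"
    if FG: "F \<in> X1.\<H>p" "G \<in> X1.\<H>p" for F G
  proof -
    let ?G = "coorbit_scale K \<psi> w1 (-1) G"
    have G: "?G \<in> X1.\<H>p"
      by (rule X1.scale_mem_p[OF FG(2)])
    have "coeff (coorbit_add K \<psi> w1 F ?G) = (\<lambda>k. coeff F k - coeff G k)"
      using FG G by (simp add: X1.coeff_add X1.coeff_scale X1.\<H>p_subset)
    moreover have "coeff (T (coorbit_add K \<psi> w1 F ?G)) = (\<lambda>k. coeff (T F) k - coeff (T G) k)"
      using FG by (simp add: coeff_T_add[OF FG(1) G] coeff_T_scale)
    ultimately show ?thesis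
      using C(2)[OF X1.add_mem_p[OF FG(1) G]] by simp
  qed
  with C(1) show thesis by (rule that)
qed

lemma coeff_T_finite_sum:
  assumes "finite J" "J \<subseteq> K" "F \<in> X1.\<H>p" "coeff F = (\<lambda>k. \<Sum>l\<in>J. Y k l * c l)"
  shows "coeff (T F) = (\<lambda>k. \<Sum>l\<in>J. coeff (T (coorbit_embed K \<psi> w1 (y l))) k * c l)"
  using assms
proof (induction J arbitrary: F rule: finite_induct)
  case empty
  \<comment> \<open>A class with zero coefficients equals 0 times itself, so homogeneity of
    \<open>T\<close> gives zero coefficients for its image.\<close>
  have "coorbit_scale K \<psi> w1 0 F = F"
    using empty by (intro X1.coeff_eqI X1.scale_mem) (auto simp: X1.coeff_scale X1.\<H>p_subset)
  then have "coeff (T F) = (\<lambda>k. 0 * coeff (T F) k)"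
    using coeff_T_scale[OF empty(2), of 0] by simp
  then show ?case by simp
next
  case (insert l J)
  let ?e = "coorbit_embed K \<psi> w1 (y l)"
  have l: "l \<in> K" and J: "J \<subseteq> K"
    using insert.prems by auto
  note e = X1.embed_column[OF Y_mem l]
  have "trunc J c \<in> X1.lp.\<L>"
    using insert.hyps J by (intro X1.lp.mem_fin_seqs X1.lp.trunc_fin_seqs)
  then obtain G where G: "G \<in> X1.\<H>p" "coeff G = mat_app K Y (trunc J c)"
    using X1.coorbit_synthesis[OF Y_mem] by blast
  then have G': "coeff G = (\<lambda>k. \<Sum>l\<in>J. Y k l * c l)"
    using insert.hyps J by (simp add: mat_app_trunc)
  let ?ce = "coorbit_scale K \<psi> w1 (c l) ?e"
  have ce: "?ce \<in> X1.\<H>p"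
    by (rule X1.scale_mem_p[OF e(1)])
  have "F = coorbit_add K \<psi> w1 ?ce G"
  proof (rule X1.coeff_eqI)
    show "coeff F = coeff (coorbit_add K \<psi> w1 ?ce G)"
      using insert.prems insert.hyps ce G(1) e
      by (simp add: X1.coeff_add X1.coeff_scale X1.\<H>p_subset G' mult.commute)
  qed (use insert.prems X1.add_mem_p[OF ce G(1)] X1.\<H>p_subset in auto)
  then have "coeff (T F) = (\<lambda>k. c l * coeff (T ?e) k + coeff (T G) k)"
    by (simp add: coeff_T_add[OF ce G(1)] coeff_T_scale[OF e(1)])
  then show ?case
    using insert.hyps insert.IH[OF J G(1) G'] by (simp add: mult.commute)
qed

section \<open>The matrix of the operator on coefficient sequences\<close>

lemma M_eq:
  assumes "k \<in> K" "l \<in> K"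
  shows "M k l = mat_app K U (coeff (T (coorbit_embed K \<psi> w1 (y l)))) k"
  using assms X2.pairing_embed[OF b_test assms(1)] by (simp add: M_def matrix_of_def)

lemma M_matrices: "M \<in> matrices K"
  by (auto simp: M_def matrix_of_def matrices_def)

lemma has_sum_row:
  assumes c: "c \<in> X1.lp.\<L>" and F: "F \<in> X1.\<H>p" "coeff F = mat_app K Y c" and k: "k \<in> K"
  shows "((\<lambda>j. M k j * c j) has_sum mat_app K U (coeff (T F)) k) K"
proof -
  \<comment> \<open>The class synthesised by y from the truncation of c. By \<open>partial\<close>
    below, the row sum over J is the k-th coordinate of U applied to
    \<open>coeff (T (FJ J))\<close>, so what remains is continuity of that coordinate along
    J.\<close>
  define FJ where "FJ J = (SOME G. G \<in> X1.\<H>p \<and> coeff G = mat_app K Y (trunc J c))" for J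
  have FJ: "FJ J \<in> X1.\<H>p" "coeff (FJ J) = mat_app K Y (trunc J c)" for J
  proof -
    have "\<exists>G. G \<in> X1.\<H>p \<and> coeff G = mat_app K Y (trunc J c)"
      using X1.coorbit_synthesis[OF Y_mem X1.lp.mem_trunc[OF c]] by blast
    from someI_ex[OF this, folded FJ_def]
    show "FJ J \<in> X1.\<H>p" "coeff (FJ J) = mat_app K Y (trunc J c)" by auto
  qed
  have TF: "T G \<in> X2.\<H>p" "coeff (T G) \<in> X2.lp.\<L>" "coeff (T G) \<in> X2.inf.\<L>" if "G \<in> X1.\<H>p" for G
    using T_mem[OF that] X2.coeff_mem X2.lp.mem_linf by blast+
  have e: "coorbit_embed K \<psi> w1 (y l) \<in> X1.\<H>p" if "l \<in> K" for l
    by (rule X1.embed_column(1)[OF Y_mem that])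
  have partial: "(\<Sum>j\<in>J. M k j * c j) = mat_app K U (coeff (T (FJ J))) k" if J: "finite J" "J \<subseteq> K" for J
  proof -
    have "coeff (FJ J) = (\<lambda>k. \<Sum>l\<in>J. Y k l * c l)"
      using FJ(2) J by (simp add: mat_app_trunc)
    note eq = coeff_T_finite_sum[OF J FJ(1) this]
    have "((\<lambda>i. \<Sum>l\<in>J. U k i * coeff (T (coorbit_embed K \<psi> w1 (y l))) i * c l) has_sum
        (\<Sum>l\<in>J. mat_app K U (coeff (T (coorbit_embed K \<psi> w1 (y l)))) k * c l)) K"
      using J(1,2)
    proof (induction J rule: finite_induct)
      case (insert l J)
      have "(\<lambda>i. U k i * coeff (T (coorbit_embed K \<psi> w1 (y l))) i) summable_on K"
        using insert.prems by (intro X2.mat_app_summable X2.row_bounded(1) U_mem TF e) auto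
      then have "((\<lambda>i. U k i * coeff (T (coorbit_embed K \<psi> w1 (y l))) i * c l) has_sum
          mat_app K U (coeff (T (coorbit_embed K \<psi> w1 (y l)))) k * c l) K"
        unfolding mat_app_def by (intro has_sum_cmult_left has_sum_infsum)
      from has_sum_add[OF this insert.IH] show ?case
        using insert by simp
    qed simp
    then have "mat_app K U (coeff (T (FJ J))) k =
        (\<Sum>l\<in>J. mat_app K U (coeff (T (coorbit_embed K \<psi> w1 (y l)))) k * c l)"
      unfolding eq by (simp add: mat_app_def infsumI sum_distrib_left mult.assoc)
    also have "\<dots> = (\<Sum>j\<in>J. M k j * c j)"
      using J k by (intro sum.cong) (auto simp: M_eq)
    finally show ?thesis ..
  qed
  have "((\<lambda>J. mat_app K U (coeff (T (FJ J))) k) \<longlongrightarrow> mat_app K U (coeff (T F)) k) (finite_subsets_at_top K)"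
  proof (cases "p1 = \<infinity>")
    case True
    \<comment> \<open>The k-th coordinate after U is itself the pairing with the embedded b k, a
      test element; hence weak-star convergence of the images suffices.\<close>
    let ?H = "coorbit_embed K \<psi> (\<lambda>k. 1 / w2 k) (b k)"
    have H: "?H \<in> X2.tests"
      by (rule X2.embed_test(1)[OF X2.coefs_mem_dual[OF b_test k]])
    have "limitin (coorbit_weak_star K \<psi> w1) FJ F (finite_subsets_at_top K)"
      using X1.limitin_weak_star_trunc[OF Y_mem X1.lp.mem_linf[OF c] X1.\<H>p_subset[OF F(1)] F(2)]
        FJ X1.\<H>p_subset by blast
    from continuous_map_limit[OF T_weak_star[OF True] this]
    have "((\<lambda>J. coorbit_pairing K \<psi> (T (FJ J)) ?H) \<longlongrightarrow> coorbit_pairing K \<psi> (T F) ?H) (finite_subsets_at_top K)"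
      using H unfolding X2.limitin_weak_star_iff o_def by blast
    then show ?thesis
      by (simp add: X2.pairing_embed[OF b_test k])
  next
    case False
    have "((\<lambda>J. X1.lp.N (\<lambda>k. trunc J c k - c k)) \<longlongrightarrow> 0) (finite_subsets_at_top K)"
      using X1.lp.tendsto_trunc[OF c False] X1.lp.norm_diff_commute[OF c X1.lp.mem_trunc[OF c]] by simp
    from X1.norm_mat_app_tendsto_0[OF Y_mem c _ this]
    have lim1: "((\<lambda>J. X1.lp.N (\<lambda>k. coeff (FJ J) k - coeff F k)) \<longlongrightarrow> 0) (finite_subsets_at_top K)"
      by (simp add: FJ F(2) X1.lp.mem_trunc[OF c])
    obtain C where C: "0 \<le> C" "\<And>F G. F \<in> X1.\<H>p \<Longrightarrow> G \<in> X1.\<H>p \<Longrightarrow>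
        X2.lp.N (\<lambda>k. coeff (T F) k - coeff (T G) k) \<le> C * X1.lp.N (\<lambda>k. coeff F k - coeff G k)"
      using norm_T_diff by blast
    have "((\<lambda>J. X2.lp.N (\<lambda>k. coeff (T (FJ J)) k - coeff (T F) k)) \<longlongrightarrow> 0) (finite_subsets_at_top K)"
    proof (rule Lim_null_comparison)
      show "((\<lambda>J. C * X1.lp.N (\<lambda>k. coeff (FJ J) k - coeff F k)) \<longlongrightarrow> 0) (finite_subsets_at_top K)"
        by (rule tendsto_mult_right_zero[OF lim1])
      show "\<forall>\<^sub>F J in finite_subsets_at_top K. norm (X2.lp.N (\<lambda>k. coeff (T (FJ J)) k - coeff (T F) k))
          \<le> C * X1.lp.N (\<lambda>k. coeff (FJ J) k - coeff F k)"
        using C(2)[OF FJ(1) F(1)] X2.lp.norm_nonneg[OF X2.lp.mem_diff[OF TF(2)[OF FJ(1)] TF(2)[OF F(1)]]]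
        by simp
    qed
    from X2.norm_mat_app_tendsto_0[OF U_mem TF(2)[OF F(1)] _ this]
    have lim2: "((\<lambda>J. X2.lp.N (\<lambda>k. mat_app K U (coeff (T (FJ J))) k - mat_app K U (coeff (T F)) k)) \<longlongrightarrow> 0)
        (finite_subsets_at_top K)"
      by (simp add: TF(2)[OF FJ(1)])
    \<comment> \<open>Coordinates are norm continuous: the k-th one is bounded by the norm divided
      by w2 k.\<close>
    have "((\<lambda>J. mat_app K U (coeff (T (FJ J))) k - mat_app K U (coeff (T F)) k) \<longlongrightarrow> 0) (finite_subsets_at_top K)"
    proof (rule Lim_null_comparison)
      let ?D = "\<lambda>J. X2.lp.N (\<lambda>k. mat_app K U (coeff (T (FJ J))) k - mat_app K U (coeff (T F)) k)"
      show "((\<lambda>J. ?D J * (1 / w2 k)) \<longlongrightarrow> 0) (finite_subsets_at_top K)"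
        by (rule tendsto_mult_left_zero[OF lim2])
      have "(\<lambda>k. mat_app K U (coeff (T (FJ J))) k - mat_app K U (coeff (T F)) k) \<in> X2.lp.\<L>" for J
        by (intro X2.lp.mem_diff X2.mat_app_mem U_mem TF FJ F)
      from X2.lp.weighted_le_norm[OF this k]
      show "\<forall>\<^sub>F J in finite_subsets_at_top K.
          norm (mat_app K U (coeff (T (FJ J))) k - mat_app K U (coeff (T F)) k) \<le> ?D J * (1 / w2 k)"
        using X2.pos[OF k] by (simp add: field_simps)
    qed
    then show ?thesis
      by (simp add: LIM_zero_cancel)
  qed
  then show ?thesis
    unfolding has_sum_def
    by (rule Lim_transform_eventually) (auto intro!: eventually_finite_subsets_at_top_weakI simp: partial)
qed

lemma mat_app_M:
  assumes "c \<in> X1.lp.\<L>" "F \<in> X1.\<H>p" "coeff F = mat_app K Y c"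
  shows "mat_app K M c = mat_app K U (coeff (T F))"
proof
  fix k
  show "mat_app K M c k = mat_app K U (coeff (T F)) k"
  proof (cases "k \<in> K")
    case True
    then show ?thesis
      using has_sum_row[OF assms True] by (simp add: mat_app_def infsumI)
  next
    case False
    then show ?thesis
      by (simp add: mat_app_outside[OF M_matrices] mat_app_outside[OF cross_gram_matrices])
  qed
qed

lemma mat_bounded_M: "mat_bounded K p1 w1 p2 w2 M"
proof -
  obtain CY where CY: "0 \<le> CY" "\<And>c. c \<in> X1.lp.\<L> \<Longrightarrow> X1.lp.N (mat_app K Y c) \<le> CY * X1.lp.N c"
    using X1.mat_app_norm[OF Y_mem] by blast
  obtain CT where CT: "0 \<le> CT" "\<And>F. F \<in> X1.\<H>p \<Longrightarrow> X2.lp.N (coeff (T F)) \<le> CT * X1.lp.N (coeff F)"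
    using T_bounded by blast
  obtain CU where CU: "0 \<le> CU" "\<And>c. c \<in> X2.lp.\<L> \<Longrightarrow> X2.lp.N (mat_app K U c) \<le> CU * X2.lp.N c"
    using X2.mat_app_norm[OF U_mem] by blast
  have "(\<forall>k\<in>K. (\<lambda>l. M k l * c l) summable_on K) \<and> mat_app K M c \<in> X2.lp.\<L> \<and>
      X2.lp.N (mat_app K M c) \<le> (CU * (CT * CY)) * X1.lp.N c" if c: "c \<in> X1.lp.\<L>" for c
  proof -
    obtain F where F: "F \<in> X1.\<H>p" "coeff F = mat_app K Y c"
      using X1.coorbit_synthesis[OF Y_mem c] by blast
    have TF: "coeff (T F) \<in> X2.lp.\<L>"
      by (rule X2.coeff_mem[OF T_mem[OF F(1)]])
    have "X2.lp.N (mat_app K U (coeff (T F))) \<le> CU * X2.lp.N (coeff (T F))"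
      by (rule CU(2)[OF TF])
    also have "\<dots> \<le> CU * (CT * X1.lp.N (coeff F))"
      by (intro mult_left_mono CT CU F)
    also have "\<dots> \<le> CU * (CT * (CY * X1.lp.N c))"
      unfolding F(2) by (intro mult_left_mono CT CU CY c)
    finally show ?thesis
      using has_sum_imp_summable[OF has_sum_row[OF c F]] X2.mat_app_mem[OF U_mem TF]
      by (simp add: mat_app_M[OF c F] mult.assoc)
  qed
  then show ?thesis
    unfolding mat_bounded_def using M_matrices by blast
qed

sublocale lp_matrix K w1 p1 w2 p2 M
  by unfold_locales (rule mat_bounded_M)

section \<open>Reconstruction of the operator and the tensor expansions\<close>

text \<open>Since Y X = \<open>proj\<close> fixes \<open>coeff H\<close>, the class that y
  synthesises from c is H itself. So \<open>mat_app_M\<close> applies with F = H, and V U =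
  \<open>proj\<close> then recovers the coefficients of T H.\<close>

lemma coefficients:
  assumes H: "H \<in> X1.\<H>p"
  defines "c \<equiv> mat_app K X (coeff H)"
  shows coefficients_mem: "c \<in> X1.lp.\<L>"
    and coefficients_pairing: "j \<in> K \<Longrightarrow> coorbit_pairing K \<psi> H (coorbit_embed K \<psi> (\<lambda>i. 1 / w1 i) (x j)) = c j"
    and mat_app_M_coefficients: "mat_app K M c = mat_app K U (coeff (T H))"
    and mat_app_V_M: "mat_app K V (mat_app K M c) = coeff (T H)"
proof -
  show c: "c \<in> X1.lp.\<L>"
    unfolding c_def by (rule X1.mat_app_mem[OF X_mem X1.coeff_mem[OF H]])
  show "j \<in> K \<Longrightarrow> coorbit_pairing K \<psi> H (coorbit_embed K \<psi> (\<lambda>i. 1 / w1 i) (x j)) = c j"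
    unfolding c_def by (rule X1.pairing_embed[OF x_test])
  have "mat_app K Y c = mat_app K proj (coeff H)"
    unfolding c_def Y_X[symmetric]
    by (intro X1.mat_app_mat_app X1.row_bounded(1) Y_mem X_mem X1.coeff_mem_inf X1.\<H>p_subset H)
  also have "\<dots> = coeff H"
    by (rule X1.proj_coeff[OF X1.\<H>p_subset[OF H]])
  finally show *: "mat_app K M c = mat_app K U (coeff (T H))"
    using mat_app_M[OF c H] by simp
  have TH: "T H \<in> X2.\<H>"
    by (rule X2.\<H>p_subset[OF T_mem[OF H]])
  have "mat_app K V (mat_app K U (coeff (T H))) = mat_app K proj (coeff (T H))"
    unfolding V_U[symmetric]
    by (intro X2.mat_app_mat_app X2.row_bounded(1) V_mem U_mem X2.coeff_mem_inf TH)
  also have "\<dots> = coeff (T H)"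
    by (rule X2.proj_coeff[OF TH])
  finally show "mat_app K V (mat_app K M c) = coeff (T H)"
    by (simp add: *)
qed

lemma embed_a:
  assumes "k \<in> K"
  shows "coorbit_embed K \<psi> w2 (a k) \<in> X2.\<H>p" "coorbit_embed K \<psi> w2 (a k) \<in> X2.\<H>"
    and "coeff (coorbit_embed K \<psi> w2 (a k)) = (\<lambda>i. V i k)"
  using X2.embed_column[OF V_mem assms] X2.\<H>p_subset by auto

lemma operator_of_M: "operator_of K \<psi> p1 w1 p2 w2 a x M = T"
proof
  fix H
  show "operator_of K \<psi> p1 w1 p2 w2 a x M H = T H"
  proof (cases "H \<in> X1.\<H>p")
    \<comment> \<open>Outside the domain both sides are \<open>undefined\<close>:
      \<open>operator_of\<close> is a restricted function and \<open>T\<close> is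
      extensional.\<close>
    case False
    then show ?thesis
      by (simp add: operator_of_def T_extensional)
  next
    case True
    define c where "c = mat_app K X (coeff H)"
    note coefs = coefficients[OF True, folded c_def]
    define d where "d = mat_app K M c"
    have d: "d \<in> X2.lp.\<L>"
      unfolding d_def by (rule mat_app_mem[OF coefs(1)])
    define top where "top = (if p2 = \<infinity> then coorbit_weak_star K \<psi> w2 else coorbit_norm_topology K \<psi> p2 w2)"
    define FI where "FI = coorbit_sum K \<psi> w2 (\<lambda>k. coorbit_scale K \<psi> w2
        (\<Sum>\<^sub>\<infinity>j\<in>K. M k j * coorbit_pairing K \<psi> H (coorbit_embed K \<psi> (\<lambda>i. 1 / w1 i) (x j)))
        (coorbit_embed K \<psi> w2 (a k)))"
    have inner: "(\<Sum>\<^sub>\<infinity>j\<in>K. M k j * coorbit_pairing K \<psi> H (coorbit_embed K \<psi> (\<lambda>i. 1 / w1 i) (x j))) = d k" for k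
      unfolding d_def mat_app_def by (rule infsum_cong) (simp add: coefs(2))
    have FI: "FI I \<in> X2.\<H>p" "coeff (FI I) = mat_app K V (trunc I d)" if I: "finite I" "I \<subseteq> K" for I
    proof -
      have *: "coorbit_embed K \<psi> w2 (a k) \<in> X2.\<H>p" "coorbit_embed K \<psi> w2 (a k) \<in> X2.\<H>"
        "coeff (coorbit_embed K \<psi> w2 (a k)) = (\<lambda>i. V i k)" if "k \<in> I" for k
        using embed_a[of k] I that by auto
      show "FI I \<in> X2.\<H>p"
        unfolding FI_def inner by (intro X2.sum_mem_p I X2.scale_mem_p *)
      have "coeff (FI I) = (\<lambda>i. \<Sum>k\<in>I. coeff (coorbit_scale K \<psi> w2 (d k) (coorbit_embed K \<psi> w2 (a k))) i)"
        unfolding FI_def inner by (intro X2.coeff_sum X2.scale_mem *)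
      also have "\<dots> = (\<lambda>i. \<Sum>k\<in>I. V i k * d k)"
        by (intro ext sum.cong refl) (simp add: X2.coeff_scale * mult.commute)
      also have "\<dots> = mat_app K V (trunc I d)"
        using I by (simp add: mat_app_trunc)
      finally show "coeff (FI I) = mat_app K V (trunc I d)" .
    qed
    have TH: "T H \<in> X2.\<H>p" "coeff (T H) = mat_app K V d"
      using T_mem[OF True] coefs(4) by (auto simp: d_def)
    have lim: "limitin top FI (T H) (finite_subsets_at_top K)"
    proof (cases "p2 = \<infinity>")
      case p2: True
      have "limitin (coorbit_weak_star K \<psi> w2) FI (T H) (finite_subsets_at_top K)"
        by (rule X2.limitin_weak_star_trunc[OF V_mem X2.lp.mem_linf[OF d] X2.\<H>p_subset[OF TH(1)] TH(2)])
          (use FI X2.\<H>p_subset in auto)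
      then show ?thesis
        by (simp add: top_def p2)
    next
      case p2: False
      have "((\<lambda>J. X2.lp.N (\<lambda>k. trunc J d k - d k)) \<longlongrightarrow> 0) (finite_subsets_at_top K)"
        using X2.lp.tendsto_trunc[OF d p2] X2.lp.norm_diff_commute[OF d X2.lp.mem_trunc[OF d]] by simp
      then have "limitin (coorbit_norm_topology K \<psi> p2 w2) FI (T H) (finite_subsets_at_top K)"
        by (rule X2.limitin_norm_mat_app[OF V_mem d TH, rotated])
          (auto intro!: eventually_finite_subsets_at_top_weakI simp: FI X2.lp.mem_trunc[OF d])
      then show ?thesis
        by (simp add: top_def p2)
    qed
    have "(THE F. limitin top FI F (finite_subsets_at_top K)) = T H"
    proof (rule the_equality[where P = "\<lambda>F. limitin top FI F (finite_subsets_at_top K)", OF lim])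
      fix F assume "limitin top FI F (finite_subsets_at_top K)"
      then show "F = T H"
        using lim X2.limitin_weak_star_unique[of FI F "finite_subsets_at_top K" "T H"]
          X2.limitin_norm_unique[of FI F "finite_subsets_at_top K" "T H"]
        by (cases "p2 = \<infinity>") (simp_all add: top_def)
    qed
    then show ?thesis
      unfolding operator_of_def using True by (simp add: top_def FI_def)
  qed
qed

lemma tensor_partial_sum:
  assumes H: "H \<in> X1.\<H>p" and Q: "finite Q" "Q \<subseteq> K \<times> K"
  defines "c \<equiv> mat_app K X (coeff H)"
  shows "tensor_partial_sum K \<psi> w1 w2 a x M Q H \<in> X2.\<H>p"
    and "coeff (tensor_partial_sum K \<psi> w1 w2 a x M Q H) = mat_app K V (part Q c)"
proof -
  let ?t = "\<lambda>z. coorbit_scale K \<psi> w2 (M (fst z) (snd z)) (coorbit_tensor K \<psi> w2 (coorbit_embed K \<psi> w2 (a (fst z)))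
          (coorbit_embed K \<psi> (\<lambda>i. 1 / w1 i) (x (snd z))) H)"
  have eq: "tensor_partial_sum K \<psi> w1 w2 a x M Q H = coorbit_sum K \<psi> w2 ?t Q"
    by (simp add: tensor_partial_sum_def case_prod_unfold)
  have mem: "?t z \<in> X2.\<H>p" and coeff_t: "coeff (?t z) = (\<lambda>i. V i (fst z) * (M (fst z) (snd z) * c (snd z)))"
    if "z \<in> Q" for z
  proof -
    have z: "fst z \<in> K" "snd z \<in> K"
      using that Q by auto
    note e = embed_a[OF z(1)]
    show "?t z \<in> X2.\<H>p"
      unfolding coorbit_tensor_def by (intro X2.scale_mem_p e)
    show "coeff (?t z) = (\<lambda>i. V i (fst z) * (M (fst z) (snd z) * c (snd z)))"
      unfolding coorbit_tensor_def coefficients_pairing[OF H z(2)] c_def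
      by (simp add: X2.coeff_scale X2.scale_mem e mult_ac)
  qed
  show "tensor_partial_sum K \<psi> w1 w2 a x M Q H \<in> X2.\<H>p"
    unfolding eq by (intro X2.sum_mem_p Q mem)
  have "coeff (coorbit_sum K \<psi> w2 ?t Q) = (\<lambda>i. \<Sum>z\<in>Q. coeff (?t z) i)"
    by (intro X2.coeff_sum X2.\<H>p_subset mem)
  also have "\<dots> = (\<lambda>i. \<Sum>z\<in>Q. V i (fst z) * (M (fst z) (snd z) * c (snd z)))"
    by (intro ext sum.cong refl) (simp only: coeff_t)
  also have "\<dots> = mat_app K V (part Q c)"
    using infsumI[OF has_sum_part[OF Q]] by (auto simp: mat_app_def case_prod_unfold)
  finally show "coeff (tensor_partial_sum K \<psi> w1 w2 a x M Q H) = mat_app K V (part Q c)"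
    by (simp add: eq)
qed

text \<open>By \<open>row_abs_le\<close> the absolute row sums of M c are at most a constant divided
  by w2 k, which is summable against e. The double family is thus absolutely summable for every pair
  of exponents, and so the weak-star expansion is unconditional over all index pairs.\<close>

lemma has_sum_pairing:
  assumes c: "c \<in> X1.lp.\<L>" and e: "e \<in> X2.dual.\<L>"
  shows "((\<lambda>(k, j). e k * (M k j * c j)) has_sum (\<Sum>\<^sub>\<infinity>k\<in>K. e k * mat_app K M c k)) (K \<times> K)"
proof (rule has_sum_SigmaI)
  show "((\<lambda>j. (\<lambda>(k, j). e k * (M k j * c j)) (k, j)) has_sum e k * mat_app K M c k) K" if "k \<in> K" for k
    using has_sum_cmult_right[OF has_sum_infsum[OF row_summable[OF c, of k]], of "e k"]
    by (simp add: mat_app_def)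
  have "mat_app K M c \<in> X2.inf.\<L>"
    by (rule X2.lp.mem_linf[OF mat_app_mem[OF c]])
  from abs_summable_summable[OF X2.pairing_abs_summable[OF this e]]
  have "(\<lambda>k. e k * mat_app K M c k) summable_on K"
    by (simp add: mult.commute)
  then show "((\<lambda>k. e k * mat_app K M c k) has_sum (\<Sum>\<^sub>\<infinity>k\<in>K. e k * mat_app K M c k)) K"
    by (rule has_sum_infsum)
  let ?B = "op_bound * X1.lp.N c"
  have inner: "(\<lambda>j. e k * (M k j * c j)) abs_summable_on K" if "k \<in> K" for k
    using summable_on_cmult_right[OF row_abs_summable[OF c that], of "cmod (e k)"] by (simp add: norm_mult)
  have le: "(\<Sum>\<^sub>\<infinity>j\<in>K. cmod (e k * (M k j * c j))) \<le> ?B * (cmod (e k) / w2 k)" if k: "k \<in> K" for k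
  proof -
    have "(\<Sum>\<^sub>\<infinity>j\<in>K. cmod (e k * (M k j * c j))) = cmod (e k) * (\<Sum>\<^sub>\<infinity>j\<in>K. cmod (M k j * c j))"
      by (simp only: norm_mult[of "e k"] infsum_cmult_right')
    also have "\<dots> \<le> cmod (e k) * (?B / w2 k)"
      using row_abs_le[OF c k] X2.pos[OF k] by (intro mult_left_mono) (auto simp: field_simps)
    finally show ?thesis by (simp add: mult_ac)
  qed
  have "(\<lambda>k. ?B * (cmod (e k) / w2 k)) summable_on K"
    using e by (intro summable_on_cmult_right) (simp add: X2.mem_dual_iff)
  then have "(\<lambda>k. \<Sum>\<^sub>\<infinity>j\<in>K. cmod (e k * (M k j * c j))) summable_on K"
    by (rule summable_on_comparison_test) (use le in \<open>auto simp: infsum_nonneg\<close>)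
  then have "(\<lambda>(k, j). e k * (M k j * c j)) abs_summable_on K \<times> K"
    unfolding Infinite_Sum.abs_summable_on_Sigma_iff using inner by (simp add: infsum_nonneg)
  then show "(\<lambda>(k, j). e k * (M k j * c j)) summable_on K \<times> K"
    by (rule abs_summable_summable)
qed

text \<open>In each mode of convergence the partial sum has coefficients V applied to
  \<open>part\<close>, so continuity of V reduces the claim to M: \<open>has_sum_pairing\<close> for
  the weak-star limit, \<open>tendsto_rectangles\<close> for the double series, and
  \<open>tendsto_part\<close> for exponents 0 and 1.\<close>

lemma unconditional_expansion: "unconditional_expansion K \<psi> p1 w1 p2 w2 a x M T"
  unfolding unconditional_expansion_def
proof (intro ballI conjI impI)
  fix H assume H: "H \<in> X1.\<H>p"
  define c where "c = mat_app K X (coeff H)"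
  note coefs = coefficients[OF H, folded c_def]
  note tps = tensor_partial_sum[OF H, folded c_def]
  define d where "d = mat_app K M c"
  have d: "d \<in> X2.lp.\<L>"
    unfolding d_def by (rule mat_app_mem[OF coefs(1)])
  have TH: "T H \<in> X2.\<H>p" "coeff (T H) = mat_app K V d"
    using T_mem[OF H] coefs(4) by (auto simp: d_def)
  show "limitin (coorbit_weak_star K \<psi> w2) (\<lambda>R. tensor_partial_sum K \<psi> w1 w2 a x M R H) (T H)
      (finite_subsets_at_top (K \<times> K))"
    unfolding X2.limitin_weak_star_iff
  proof (intro conjI ballI)
    show "T H \<in> X2.\<H>"
      by (rule X2.\<H>p_subset[OF TH(1)])
    show "\<forall>\<^sub>F R in finite_subsets_at_top (K \<times> K). tensor_partial_sum K \<psi> w1 w2 a x M R H \<in> X2.\<H>"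
      by (rule eventually_finite_subsets_at_top_weakI) (rule X2.\<H>p_subset[OF tps(1)])
    fix H' assume H': "H' \<in> X2.tests"
    \<comment> \<open>Moving V to the test side leaves the pairing of M c with a predual
      sequence.\<close>
    define e where "e = vec_mat K (X2.functional H') V"
    have e: "e \<in> X2.dual.\<L>"
      unfolding e_def by (rule X2.vec_mat_mem_dual[OF X2.row_bounded(1)[OF V_mem] X2.functional_mem[OF H']])
    have lim: "coorbit_pairing K \<psi> (T H) H' = (\<Sum>\<^sub>\<infinity>k\<in>K. e k * d k)"
      unfolding e_def by (rule X2.pairing_mat_app[OF V_mem X2.lp.mem_linf[OF d] TH(2) H'])
    have partial: "coorbit_pairing K \<psi> (tensor_partial_sum K \<psi> w1 w2 a x M R H) H' = (\<Sum>(k, j)\<in>R. e k * (M k j * c j))"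
      if R: "finite R" "R \<subseteq> K \<times> K" for R
      unfolding X2.pairing_mat_app[OF V_mem X2.lp.mem_linf[OF part_mem[OF R]] tps(2)[OF R] H', folded e_def]
      by (rule infsumI[OF has_sum_part[OF R]])
    show "((\<lambda>R. coorbit_pairing K \<psi> (tensor_partial_sum K \<psi> w1 w2 a x M R H) H') \<longlongrightarrow> coorbit_pairing K \<psi> (T H) H')
        (finite_subsets_at_top (K \<times> K))"
      using has_sum_pairing[OF coefs(1) e] unfolding has_sum_def lim d_def
      by (rule Lim_transform_eventually) (auto intro!: eventually_finite_subsets_at_top_weakI simp: partial)
  qed
  show "limitin (coorbit_norm_topology K \<psi> p2 w2) (\<lambda>(I, J). tensor_partial_sum K \<psi> w1 w2 a x M (I \<times> J) H) (T H)
      (finite_subsets_at_top K \<times>\<^sub>F finite_subsets_at_top K)" if p: "p1 \<noteq> \<infinity> \<and> p2 \<noteq> \<infinity>"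
  proof (rule X2.limitin_norm_mat_app[OF V_mem d TH, where f = "\<lambda>(I, J). part (I \<times> J) c"])
    have "\<forall>\<^sub>F x in finite_subsets_at_top K \<times>\<^sub>F finite_subsets_at_top K.
        (finite (fst x) \<and> fst x \<subseteq> K) \<and> (finite (snd x) \<and> snd x \<subseteq> K)"
      by (rule eventually_prodI) (auto intro!: eventually_finite_subsets_at_top_weakI)
    then show "\<forall>\<^sub>F z in finite_subsets_at_top K \<times>\<^sub>F finite_subsets_at_top K.
        (case z of (I, J) \<Rightarrow> tensor_partial_sum K \<psi> w1 w2 a x M (I \<times> J) H) \<in> X2.\<H>p \<and>
        (case z of (I, J) \<Rightarrow> part (I \<times> J) c) \<in> X2.lp.\<L> \<and>
        coeff (case z of (I, J) \<Rightarrow> tensor_partial_sum K \<psi> w1 w2 a x M (I \<times> J) H) =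
          mat_app K V (case z of (I, J) \<Rightarrow> part (I \<times> J) c)"
    proof (rule eventually_mono)
      fix z :: "'i set \<times> 'i set"
      assume z: "(finite (fst z) \<and> fst z \<subseteq> K) \<and> (finite (snd z) \<and> snd z \<subseteq> K)"
      then have R: "finite (fst z \<times> snd z)" "fst z \<times> snd z \<subseteq> K \<times> K"
        by auto
      show "(case z of (I, J) \<Rightarrow> tensor_partial_sum K \<psi> w1 w2 a x M (I \<times> J) H) \<in> X2.\<H>p \<and>
        (case z of (I, J) \<Rightarrow> part (I \<times> J) c) \<in> X2.lp.\<L> \<and>
        coeff (case z of (I, J) \<Rightarrow> tensor_partial_sum K \<psi> w1 w2 a x M (I \<times> J) H) =
          mat_app K V (case z of (I, J) \<Rightarrow> part (I \<times> J) c)"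
        using tps[OF R] part_mem[OF R] by (simp add: case_prod_unfold)
    qed
    show "((\<lambda>z. X2.lp.N (\<lambda>k. (case z of (I, J) \<Rightarrow> part (I \<times> J) c) k - d k)) \<longlongrightarrow> 0)
        (finite_subsets_at_top K \<times>\<^sub>F finite_subsets_at_top K)"
      using tendsto_rectangles[OF _ _ coefs(1)] p by (simp add: case_prod_unfold d_def)
  qed
  show "limitin (coorbit_norm_topology K \<psi> p2 w2) (\<lambda>R. tensor_partial_sum K \<psi> w1 w2 a x M R H) (T H)
      (finite_subsets_at_top (K \<times> K))" if p: "p1 \<in> {0, 1} \<and> p2 \<noteq> \<infinity>"
  proof (rule X2.limitin_norm_mat_app[OF V_mem d TH, where f = "\<lambda>R. part R c"])
    show "\<forall>\<^sub>F R in finite_subsets_at_top (K \<times> K). tensor_partial_sum K \<psi> w1 w2 a x M R H \<in> X2.\<H>p \<and>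
        part R c \<in> X2.lp.\<L> \<and> coeff (tensor_partial_sum K \<psi> w1 w2 a x M R H) = mat_app K V (part R c)"
      by (rule eventually_finite_subsets_at_top_weakI) (use tps part_mem in auto)
    show "((\<lambda>R. X2.lp.N (\<lambda>k. part R c k - d k)) \<longlongrightarrow> 0) (finite_subsets_at_top (K \<times> K))"
      unfolding d_def using p zero_exponents by (intro tendsto_part coefs(1)) auto
  qed
qed

end

theorem proposition4:
  fixes K :: "'d::euclidean_space set"
    and \<A> :: "'d matrix set" and nrm :: "'d matrix \<Rightarrow> real"
    and \<psi> \<phi> :: "'d \<Rightarrow> 'h::complex_hilbert_space"
    and w1 w2 :: "'d \<Rightarrow> real" and p1 p2 :: ennreal
  assumes "countable K" and "separated K"
    and "separable_space (euclidean :: 'h topology)"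
    and "solid_spectral_matrix_algebra K \<A> nrm"
    and "is_frame K \<psi>" and "localized_rel K \<A> \<psi> \<psi>"
    and "is_frame K \<phi>" and "localized_rel K \<A> \<phi> \<phi>"
    and "localized_rel K \<A> \<phi> \<psi>"
    and "admissible_weight K \<A> w1" and "admissible_weight K \<A> w2"
    and "1 \<le> p1 \<and> 1 \<le> p2 \<or> p1 = 0 \<and> p2 = 0"
    and "T \<in> coorbit_blinops K \<psi> p1 w1 p2 w2"
    and "p1 = \<infinity> \<longrightarrow> continuous_map (coorbit_weak_star K \<psi> w1) (coorbit_weak_star K \<psi> w2) T"
  shows
   "mat_bounded K p1 w1 p2 w2
       (matrix_of K \<psi> w1 w2 (dual_frame K \<phi>) (dual_frame K \<psi>) T) \<and>
    mat_bounded K p1 w1 p2 w2 (matrix_of K \<psi> w1 w2 \<phi> \<psi> T) \<and>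
    ((operator_of K \<psi> p1 w1 p2 w2 \<phi> \<psi> \<circ>
        matrix_of K \<psi> w1 w2 (dual_frame K \<phi>) (dual_frame K \<psi>)) T = id T) \<and>
    (id T = (operator_of K \<psi> p1 w1 p2 w2 (dual_frame K \<phi>) (dual_frame K \<psi>) \<circ>
        matrix_of K \<psi> w1 w2 \<phi> \<psi>) T) \<and>
    unconditional_expansion K \<psi> p1 w1 p2 w2 \<phi> \<psi>
       (matrix_of K \<psi> w1 w2 (dual_frame K \<phi>) (dual_frame K \<psi>) T) T \<and>
    unconditional_expansion K \<psi> p1 w1 p2 w2 (dual_frame K \<phi>) (dual_frame K \<psi>)
       (matrix_of K \<psi> w1 w2 \<phi> \<psi> T) T"
proof -
  interpret A: solid_spectral_matrix_algebra K \<A> nrm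
    by (rule assms(4))
  interpret \<psi>: coorbit_frame K \<A> nrm \<psi>
    by unfold_locales (rule assms)+
  interpret \<phi>: localized_frame K \<A> nrm \<phi>
    by unfold_locales (rule assms)+
  have exponents: "p1 = 0 \<or> 1 \<le> p1" "p2 = 0 \<or> 1 \<le> p2" "p1 = 0 \<Longrightarrow> p2 = 0"
    using assms(12) by auto
  interpret X1: coorbit_lp K \<A> nrm \<psi> w1 p1
    by unfold_locales
      (simp_all add: A.admissible_good_weight A.admissible_mat_bounded assms exponents)
  interpret X2: coorbit_lp K \<A> nrm \<psi> w2 p2
    by unfold_locales
      (simp_all add: A.admissible_good_weight A.admissible_mat_bounded assms exponents)
  have cross_gram_adj: "cross_gram K \<eta> \<xi> \<in> \<A>" if "cross_gram K \<xi> \<eta> \<in> \<A>" for \<xi> \<eta> :: "'d \<Rightarrow> 'h"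
  proof -
    have "mat_adj (cross_gram K \<xi> \<eta>) = cross_gram K \<eta> \<xi>"
      by (intro ext) (simp add: mat_adj_def cross_gram_def cinner_commute[symmetric])
    then show ?thesis
      using A.adj_closed[OF that] by simp
  qed
  let ?\<psi>d = "dual_frame K \<psi>" and ?\<phi>d = "dual_frame K \<phi>"
  have \<psi>\<psi>: "cross_gram K \<psi> \<psi> \<in> \<A>" and \<phi>\<psi>: "cross_gram K \<phi> \<psi> \<in> \<A>"
    using assms(6,9) by (auto simp: localized_rel_def)
  note \<psi>d = \<psi>.cross_gram_dual_left \<psi>.cross_gram_dual_right \<psi>.cross_gram_dual_dual
  note \<phi>d = \<phi>.cross_gram_dual_left \<phi>.cross_gram_dual_right \<phi>.cross_gram_dual_dual
  \<comment> \<open>The dual Gram matrix of \<phi> times the cross-Gram matrix of \<phi> and \<psi>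
    collapses, since dual \<phi> meets \<phi> in the middle. The other mixed matrices arise in the
    same way, using adjoints.\<close>
  have \<phi>d\<psi>: "cross_gram K ?\<phi>d \<psi> \<in> \<A>"
    using A.mult_closed[OF \<phi>d(3) \<phi>\<psi>] by (simp add: \<phi>.mat_mult_cross_gram)
  have \<psi>d\<phi>: "cross_gram K ?\<psi>d \<phi> \<in> \<A>"
    using A.mult_closed[OF \<psi>d(3) cross_gram_adj[OF \<phi>\<psi>]] by (simp add: \<psi>.mat_mult_cross_gram)
  have \<psi>d\<phi>d: "cross_gram K ?\<psi>d ?\<phi>d \<in> \<A>"
    using A.mult_closed[OF \<psi>d(3) cross_gram_adj[OF \<phi>d\<psi>]] by (simp add: \<psi>.mat_mult_cross_gram)
  \<comment> \<open>Here synthesis is by \<phi> and analysis by \<psi>, which gives the first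
    factorization; in \<open>E2\<close> both frames are exchanged with their duals.\<close>
  interpret E1: expansion K \<A> nrm \<psi> w1 p1 w2 p2 \<phi> ?\<phi>d \<psi> ?\<psi>d T
    by unfold_locales
      (use assms(13,14) exponents \<psi>\<psi> \<phi>d\<psi> \<psi>d\<phi> \<psi>d cross_gram_adj[OF \<psi>d\<phi>d] in
        \<open>simp_all add: \<psi>.mat_mult_cross_gram \<phi>.mat_mult_cross_gram\<close>)
  interpret E2: expansion K \<A> nrm \<psi> w1 p1 w2 p2 ?\<phi>d \<phi> ?\<psi>d \<psi> T
    by unfold_locales
      (use assms(13,14) exponents \<phi>\<psi> \<psi>d\<phi>d \<psi>d cross_gram_adj[OF \<psi>d\<phi>] in
        \<open>simp_all add: \<psi>.mat_mult_cross_gram \<phi>.mat_mult_cross_gram\<close>)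
  show ?thesis
    using E1.mat_bounded_M E2.mat_bounded_M E1.operator_of_M E2.operator_of_M
      E1.unconditional_expansion E2.unconditional_expansion
    by (simp add: E1.M_def E2.M_def)
qed

end
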